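(* Let $T_*\in\mathcal T(s)$ with $1\le s<K$. (a) If $T_*\in\mathcal T'(s)$, $\xi=O(1)$, $\kappa^{-1}(A_{\underline J},s)=O(1)$ and $s\log K=O(N)$, then $$\|\widehat T_{\rm mle}-T_*\|_1=O_{\mathbb P}\left(\sqrt{\frac{s\log K}{N}}\right).$$ (b) If, for some sufficiently large absolute constant $C>0$ and some sufficiently small absolute constant $c>0$, $$N\ge C\,\frac{\log(s\vee n)}{\kappa^4(A_{\underline J},s)\,T_{\min}^3}\quad\text{and}\quad \left(\kappa^{-1}(A_{\underline J},s)\sqrt{\frac{\xi s}{T_{\min}}}+1\right)\sqrt{\frac{\xi\log K}{T_{\min}N}}\le c\,\min_{k\in S_*^c}\sum_{j\in\overline J^c}A_{jk},$$ and $\kappa^{-1}(A_{\overline J},s)=O(1)$, then $$\|\widehat T_{\rm mle}-T_*\|_1=O_{\mathbb P}\left(\sqrt{\frac{s}{N}}\right).$$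
   Context: Setting. $p>K\ge1$, $N\ge 1$ and $n\ge1$ are integers ($n$ is the number of documents in the corpus; it enters only through the displayed formulas), $\Delta_d=\{x\in\mathbb R^d: x_j\ge 0\ \forall j,\ \sum_j x_j=1\}$, $a\vee b=\max\{a,b\}$. $A\in\mathbb R^{p\times K}$ is a known matrix whose columns belong to $\Delta_p$; $A_{j\cdot}\in\mathbb R^K$ denotes its $j$-th row (as a column vector), $A_{jS}$ its subvector with indices in $S$ and, for $U\subseteq[p]$, $A_U$ denotes the submatrix of rows in $U$. $T_*\in\Delta_K$, $\Pi_*=AT_*\in\Delta_p$, and the data $X\in\mathbb R^p$ satisfies $NX\sim\mathrm{Multinomial}_p(N;\Pi_* )$. $S_*=\mathrm{supp}(T_* )$, $S_*^c=[K]\setminus S_*$, $T_{\min}=\min_{k\in S_*}T_{*k}$, $\mathcal T(s)=\{T\in\Delta_K:|\mathrm{supp}(T)|=s\}$, and $\mathcal T'(s)=\{T\in\mathcal T(s):\min_{k\in\mathrm{supp}(T)}T_k\ge c_\star/s\}$ for some absolute constant $c_\star\in(0,1]$. Estimator. $J=\{j\in[p]:X_j>0\}$ and $\widehat T_{\rm mle}\in\arg\max_{T\in\Delta_K}\sum_{j\in J}X_j\log(A_{j\cdot}^\top T)$. Quantities. $\overline J=\{j:\Pi_{*j}>0\}$, $\overline J^c=[p]\setminus\overline J$; $\varepsilon_j=2\sqrt{\Pi_{*j}\log p/N}+\frac{4\log p}{3N}$; $\underline J=\{j:\Pi_{*j}>2\varepsilon_j\}$; $\xi=\max_{j\in\overline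 J}\|A_{jS_*^c}\|_\infty/\|A_{jS_*}\|_1$. For a matrix $M$ with $K$ columns, $$\kappa(M,s)=\min_{S\subseteq[K],\,|S|\le s}\ \min_{v\in\mathcal C(S)}\frac{\|Mv\|_1}{\|v\|_1},\qquad \mathcal C(S)=\{v\in\mathbb R^K\setminus\{0\}:\|v_S\|_1\ge\|v_{S^c}\|_1\}.$$ Asymptotic notation. $O$ and $O_{\mathbb P}$ refer to a sequence of problem instances along which all of $N,n,p,K,s,A,T_*$ may vary; $Z=O_{\mathbb P}(a)$ means that $Z/a$ is bounded in probability along the sequence. *)

theory Defs
  imports "HOL-Probability.Probability" "HOL-Library.Landau_Symbols"
begin

text \<open>
  Since all dimensions vary along the sequence of problem instances, a vector of \<open>\<real>\<^sup>d\<close> is a function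
  \<open>nat \<Rightarrow> real\<close> of which only the coordinates in \<open>{..<d}\<close> matter, a \<open>p \<times> K\<close> matrix \<open>A\<close> has entries
  \<open>A j k\<close> with \<open>j < p\<close>, \<open>k < K\<close>, and the index sets \<open>[p]\<close>, \<open>[K]\<close> are \<open>{..<p}\<close>, \<open>{..<K}\<close>.
\<close>

definition prob_simplex :: "nat \<Rightarrow> (nat \<Rightarrow> real) set" where
  "prob_simplex d = {x. (\<forall>j<d. 0 \<le> x j) \<and> (\<Sum>j<d. x j) = 1}"

definition supp :: "nat \<Rightarrow> (nat \<Rightarrow> real) \<Rightarrow> nat set" where
  "supp K T = {k. k < K \<and> T k \<noteq> 0}"

definition l1_on :: "nat set \<Rightarrow> (nat \<Rightarrow> real) \<Rightarrow> real" where
  "l1_on S v = (\<Sum>k\<in>S. \<bar>v k\<bar>)"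

definition mat_vec :: "nat \<Rightarrow> (nat \<Rightarrow> nat \<Rightarrow> real) \<Rightarrow> (nat \<Rightarrow> real) \<Rightarrow> nat \<Rightarrow> real" where
  "mat_vec K A T j = (\<Sum>k<K. A j k * T k)"

definition sparse_simplex :: "nat \<Rightarrow> nat \<Rightarrow> (nat \<Rightarrow> real) set" where
  "sparse_simplex K s = {T \<in> prob_simplex K. card (supp K T) = s}"

definition T_min :: "nat \<Rightarrow> (nat \<Rightarrow> real) \<Rightarrow> real" where
  "T_min K T = Min (T ` supp K T)"

definition balanced_sparse_simplex :: "real \<Rightarrow> nat \<Rightarrow> nat \<Rightarrow> (nat \<Rightarrow> real) set" where
  "balanced_sparse_simplex cstar K s = {T \<in> sparse_simplex K s. T_min K T \<ge> cstar / real s}"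


subsection \<open>Data\<close>

definition categorical_pmf :: "nat \<Rightarrow> (nat \<Rightarrow> real) \<Rightarrow> nat pmf" where
  "categorical_pmf p q = embed_pmf (\<lambda>j. if j < p then q j else 0)"

lemma pmf_categorical:
  assumes "q \<in> prob_simplex p"
  shows "pmf (categorical_pmf p q) j = (if j < p then q j else 0)"
proof -
  have nn: "\<And>j. 0 \<le> (if j < p then q j else 0)"
    using assms by (auto simp: prob_simplex_def)
  have "(\<integral>\<^sup>+ j. ennreal (if j < p then q j else 0) \<partial>count_space UNIV)
      = (\<Sum>j<p. ennreal (if j < p then q j else 0))"
    by (rule nn_integral_count_space'[of "{..<p}"]) auto
  also have "\<dots> = ennreal (\<Sum>j<p. if j < p then q j else 0)"
    by (rule sum_ennreal) (use nn in blast)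
  also have "(\<Sum>j<p. if j < p then q j else 0) = (\<Sum>j<p. q j)"
    by (rule sum.cong) auto
  also have "\<dots> = 1"
    using assms by (simp add: prob_simplex_def)
  finally show ?thesis
    unfolding categorical_pmf_def by (subst pmf_embed_pmf) (use nn in auto)
qed

text \<open>The multinomial law: the vector of category counts of \<open>N\<close> independent categorical draws.\<close>

definition multinomial_pmf :: "nat \<Rightarrow> nat \<Rightarrow> (nat \<Rightarrow> real) \<Rightarrow> (nat \<Rightarrow> nat) pmf" where
  "multinomial_pmf p N q =
     map_pmf (\<lambda>xs j. count_list xs j) (replicate_pmf N (categorical_pmf p q))"

text \<open>The law of the frequency vector \<open>X\<close> with \<open>N X\<close> multinomial.\<close>

definition freq_pmf :: "nat \<Rightarrow> nat \<Rightarrow> (nat \<Rightarrow> real) \<Rightarrow> (nat \<Rightarrow> real) pmf" where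
  "freq_pmf p N q = map_pmf (\<lambda>y j. real (y j) / real N) (multinomial_pmf p N q)"


subsection \<open>Maximum likelihood estimator\<close>

text \<open>As \<open>ln 0 = 0\<close> in the library, the convention \<open>log 0 = -\<infinity>\<close> needs extended reals.\<close>

definition ext_ln :: "real \<Rightarrow> ereal" where
  "ext_ln x = (if x > 0 then ereal (ln x) else -\<infinity>)"

definition log_lik ::
  "nat \<Rightarrow> nat \<Rightarrow> (nat \<Rightarrow> nat \<Rightarrow> real) \<Rightarrow> (nat \<Rightarrow> real) \<Rightarrow> (nat \<Rightarrow> real) \<Rightarrow> ereal" where
  "log_lik p K A x T = (\<Sum>j\<in>{j. j < p \<and> x j > 0}. ereal (x j) * ext_ln (mat_vec K A T j))"

definition is_mle ::
  "nat \<Rightarrow> nat \<Rightarrow> (nat \<Rightarrow> nat \<Rightarrow> real) \<Rightarrow> (nat \<Rightarrow> real) \<Rightarrow> (nat \<Rightarrow> real) \<Rightarrow> bool" where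
  "is_mle p K A x T \<longleftrightarrow> is_arg_max (log_lik p K A x) (\<lambda>T. T \<in> prob_simplex K) T"


subsection \<open>Deterministic quantities\<close>

definition J_bar :: "nat \<Rightarrow> (nat \<Rightarrow> real) \<Rightarrow> nat set" where
  "J_bar p q = {j. j < p \<and> q j > 0}"

definition eps :: "nat \<Rightarrow> nat \<Rightarrow> (nat \<Rightarrow> real) \<Rightarrow> nat \<Rightarrow> real" where
  "eps p N q j = 2 * sqrt (q j * ln (real p) / real N) + 4 * ln (real p) / (3 * real N)"

definition J_under :: "nat \<Rightarrow> nat \<Rightarrow> (nat \<Rightarrow> real) \<Rightarrow> nat set" where
  "J_under p N q = {j. j < p \<and> q j > 2 * eps p N q j}"

text \<open>The maxima are over nonempty finite sets, and the denominators are nonzero, whenever the columns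
  of \<open>A\<close> lie in the simplex and \<open>T\<close> is a point of the simplex without full support.\<close>

definition xi :: "nat \<Rightarrow> nat \<Rightarrow> (nat \<Rightarrow> nat \<Rightarrow> real) \<Rightarrow> (nat \<Rightarrow> real) \<Rightarrow> real" where
  "xi p K A T = Max ((\<lambda>j. Max ((\<lambda>k. \<bar>A j k\<bar>) ` ({..<K} - supp K T)) / l1_on (supp K T) (A j))
                       ` J_bar p (mat_vec K A T))"

definition cone :: "nat \<Rightarrow> nat set \<Rightarrow> (nat \<Rightarrow> real) set" where
  "cone K S = {v. (\<exists>k<K. v k \<noteq> 0) \<and> l1_on S v \<ge> l1_on ({..<K} - S) v}"

text \<open>\<open>kappa U K A s\<close> is the restricted \<open>\<ell>\<^sub>1\<close> condition number of the submatrix of \<open>A\<close> with rows in \<open>U\<close>.\<close>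

definition kappa :: "nat set \<Rightarrow> nat \<Rightarrow> (nat \<Rightarrow> nat \<Rightarrow> real) \<Rightarrow> nat \<Rightarrow> real" where
  "kappa U K A s = Inf {l1_on U (mat_vec K A v) / l1_on {..<K} v | S v.
                          S \<subseteq> {..<K} \<and> card S \<le> s \<and> v \<in> cone K S}"


subsection \<open>Sequences of problem instances\<close>

text \<open>The estimator \<open>That\<close> is an arbitrary selection from the set of maximisers, as a function of the
  data; it only matters on the (finite) set of possible data vectors.\<close>

definition admissible_sequence ::
  "(nat \<Rightarrow> nat) \<Rightarrow> (nat \<Rightarrow> nat) \<Rightarrow> (nat \<Rightarrow> nat) \<Rightarrow> (nat \<Rightarrow> nat) \<Rightarrow> (nat \<Rightarrow> nat) \<Rightarrow>
   (nat \<Rightarrow> nat \<Rightarrow> nat \<Rightarrow> real) \<Rightarrow> (nat \<Rightarrow> nat \<Rightarrow> real) \<Rightarrow>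
   (nat \<Rightarrow> (nat \<Rightarrow> real) \<Rightarrow> nat \<Rightarrow> real) \<Rightarrow> bool" where
  "admissible_sequence N n p K s A T That \<longleftrightarrow>
     (\<forall>m. N m \<ge> 1 \<and> n m \<ge> 1 \<and> p m > K m \<and> K m \<ge> 1 \<and>
          1 \<le> s m \<and> s m < K m \<and>
          (\<forall>k<K m. (\<lambda>j. A m j k) \<in> prob_simplex (p m)) \<and>
          T m \<in> sparse_simplex (K m) (s m) \<and>
          (\<forall>x \<in> set_pmf (freq_pmf (p m) (N m) (mat_vec (K m) (A m) (T m))).
             is_mle (p m) (K m) (A m) x (That m x)))"

definition error :: "nat \<Rightarrow> (nat \<Rightarrow> real) \<Rightarrow> (nat \<Rightarrow> real) \<Rightarrow> real" where
  "error K T T' = l1_on {..<K} (\<lambda>k. T' k - T k)"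

text \<open>\<open>Z m = O\<^sub>P(a m)\<close>, where \<open>Z m\<close> is a statistic of data with law \<open>P m\<close>.\<close>

definition bigo_prob :: "(nat \<Rightarrow> 'a pmf) \<Rightarrow> (nat \<Rightarrow> 'a \<Rightarrow> real) \<Rightarrow> (nat \<Rightarrow> real) \<Rightarrow> bool" where
  "bigo_prob P Z a \<longleftrightarrow>
     (\<forall>\<epsilon>>0. \<exists>B. \<forall>m. measure_pmf.prob (P m) {x. \<bar>Z m x / a m\<bar> > B} \<le> \<epsilon>)"

text \<open>\<open>f\<^sup>-\<^sup>1 = O(1)\<close> for \<open>f \<ge> 0\<close>, where \<open>f m = 0\<close> means \<open>f\<^sup>-\<^sup>1 = \<infinity>\<close> (whereas \<open>inverse 0 = 0\<close> in the library).\<close>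

definition inverse_bounded :: "(nat \<Rightarrow> real) \<Rightarrow> bool" where
  "inverse_bounded f \<longleftrightarrow>
     eventually (\<lambda>m. f m > 0) sequentially \<and> (\<lambda>m. inverse (f m)) \<in> O(\<lambda>_. 1)"

text \<open>The two pointwise conditions on one instance, with constants \<open>C\<close> and \<open>c\<close>; the condition
  \<open>0 < \<kappa>\<close> is the finiteness of \<open>\<kappa>\<^sup>-\<^sup>1\<close>.\<close>

definition fast_rate_condition ::
  "real \<Rightarrow> real \<Rightarrow> nat \<Rightarrow> nat \<Rightarrow> nat \<Rightarrow> nat \<Rightarrow> nat \<Rightarrow>
   (nat \<Rightarrow> nat \<Rightarrow> real) \<Rightarrow> (nat \<Rightarrow> real) \<Rightarrow> bool" where
  "fast_rate_condition C c N n p K s A T \<longleftrightarrow>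
     (let q = mat_vec K A T;
          \<kappa> = kappa (J_under p N q) K A s;
          \<xi> = xi p K A T;
          t = T_min K T
      in 0 < \<kappa> \<and>
         real N \<ge> C * (ln (real (max s n)) / (\<kappa> ^ 4 * t ^ 3)) \<and>
         (inverse \<kappa> * sqrt (\<xi> * real s / t) + 1) * sqrt (\<xi> * ln (real K) / (t * real N))
           \<le> c * Min ((\<lambda>k. \<Sum>j\<in>{..<p} - J_bar p q. A j k) ` ({..<K} - supp K T)))"

end

theory Submission
  imports Defs
begin

text \<open>
  Let \<open>v\<close> be the estimation error, \<open>\<Pi>\<^sub>* = A T\<^sub>*\<close> the cell probabilities, and \<open>e = A v / \<Pi>\<^sub>*\<close> the
  relative change of the cell probabilities.  Both parts start from the fact that the likelihood at the
  maximiser is at least the likelihood at \<open>T\<^sub>*\<close>, that is, \<open>0 \<le> \<Sum> X\<^sub>j log (1 + e\<^sub>j)\<close>.  Expanding the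
  logarithm bounds an empirical quadratic form in \<open>e\<close> by the linear form \<open>\<Sum> X\<^sub>j e\<^sub>j\<close>.  Since
  the entries of \<open>v\<close> sum to zero, the linear form is pure noise minus the mass that \<open>v\<close> puts on
  rows outside the support of \<open>\<Pi>\<^sub>*\<close> (\<open>sum_x_pert\<close>).  Since \<open>T\<^sub>*\<close> and the estimate are
  probability vectors, \<open>v\<close> lies in the cone of the restricted condition number (\<open>ascent_in_cone\<close>), which
  turns bounds on \<open>e\<close> into bounds on \<open>\<parallel>v\<parallel>\<^sub>1\<close>.

  For part (a), the noise is at most \<open>\<parallel>v\<parallel>\<^sub>1\<close> times the largest deviation of \<open>K\<close> averages of bounded
  variables, of order \<open>sqrt (s log K / N)\<close> by Bernstein's inequality (\<open>freq_bernstein\<close>).  The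
  quadratic form is at least a multiple of \<open>\<parallel>v\<parallel>\<^sub>1\<^sup>2\<close>, because frequencies of rows in \<open>J_under\<close> are at
  least a fraction of their means (\<open>slow_rate_deterministic\<close>).

  For part (b), the noise is split.  On the span of the \<open>s\<close> active topics it is measured in the
  \<open>\<chi>\<^sup>2\<close> norm: in an orthonormal basis of that span its expected square is at most \<open>s / N\<close>, which
  gives the rate without a logarithm (\<open>S_controlled_prob\<close>).  For the inactive topics there are two regimes,
  according to the size of \<open>(\<xi> / T\<^sub>m\<^sub>i\<^sub>n) log K\<close>.  If it is large, the separation hypothesis
  makes the mass on unobserved rows outweigh the noise of every inactive topic, with probability as
  close to one as desired (\<open>penalised_local_bound\<close>, \<open>fast_rate_leaking\<close>).  If it is bounded, that
  noise is of order \<open>1 / sqrt N\<close> and harmless (\<open>unpenalised_local_bound\<close>, \<open>fast_rate_light\<close>).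
  In both regimes the error on inactive topics is at most the one on active topics, by the cone property.

  Boundedness in probability asks for failure probabilities below any \<open>\<epsilon> > 0\<close>, also along sequences on
  which \<open>p\<close>, \<open>K\<close>, \<open>s\<close> and \<open>n\<close> stay bounded, where bounds such as \<open>p\<^sup>-\<^sup>2\<close> or \<open>K\<^sup>-\<^sup>1\<close> do not
  tend to zero.  The bounds for single instances are therefore proved with a constant that depends on
  \<open>\<epsilon>\<close>, and small \<open>N\<close> is dealt with by the trivial bound \<open>2\<close> on the error.
\<close>

section \<open>Moments and tails of multinomial frequencies\<close>

lemma set_pmf_categorical:
  assumes "q \<in> prob_simplex p"
  shows "set_pmf (categorical_pmf p q) = {j. j < p \<and> q j > 0}"
proof -
  have "\<And>j. j < p \<Longrightarrow> 0 \<le> q j"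
    using assms by (auto simp: prob_simplex_def)
  then show ?thesis
    using pmf_categorical[OF assms] by (force simp: set_pmf_eq less_le)
qed

abbreviation "draws N p q \<equiv> replicate_pmf N (categorical_pmf p q)"

lemma finite_set_pmf_replicate_categorical:
  assumes "q \<in> prob_simplex p"
  shows "finite (set_pmf (draws N p q))"
proof -
  have "finite {xs. set xs \<subseteq> {j. j < p \<and> q j > 0} \<and> length xs = N}"
    by (rule finite_lists_length_eq) auto
  then show ?thesis
    unfolding set_replicate_pmf set_pmf_categorical[OF assms]
    by (rule finite_subset[rotated]) (auto simp: in_lists_conv_set)
qed

lemma expectation_replicate_Suc:
  fixes F :: "nat list \<Rightarrow> real"
  assumes q: "q \<in> prob_simplex p"
  shows "measure_pmf.expectation (draws (Suc N) p q) F =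
    (\<Sum>j<p. q j * measure_pmf.expectation (draws N p q) (\<lambda>xs. F (j # xs)))"
proof -
  let ?c = "categorical_pmf p q"
  have "replicate_pmf (Suc N) ?c = ?c \<bind> (\<lambda>x. map_pmf (\<lambda>xs. x # xs) (replicate_pmf N ?c))"
    by (simp add: map_pmf_def)
  also have "measure_pmf.expectation \<dots> F =
      (\<Sum>j<p. pmf ?c j *\<^sub>R measure_pmf.expectation (map_pmf (\<lambda>xs. j # xs) (replicate_pmf N ?c)) F)"
    by (rule pmf_expectation_bind)
       (use finite_set_pmf_replicate_categorical[OF q] set_pmf_categorical[OF q] in auto)
  also have "\<dots> = (\<Sum>j<p. q j * measure_pmf.expectation (replicate_pmf N ?c) (\<lambda>xs. F (j # xs)))"
    by (rule sum.cong) (auto simp: pmf_categorical[OF q])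
  finally show ?thesis .
qed

lemma expectation_replicate_exp:
  assumes q: "q \<in> prob_simplex p"
  shows "measure_pmf.expectation (draws N p q) (\<lambda>xs. exp (\<Sum>x\<leftarrow>xs. g x)) =
    (\<Sum>j<p. q j * exp (g j)) ^ N"
proof (induction N)
  case (Suc N)
  then show ?case
    by (subst expectation_replicate_Suc[OF q]) (simp add: exp_add sum_distrib_right mult.assoc)
qed simp

lemma expectation_replicate_square:
  assumes q: "q \<in> prob_simplex p" and g: "(\<Sum>j<p. q j * g j) = 0"
  shows "measure_pmf.expectation (draws N p q) (\<lambda>xs. (\<Sum>x\<leftarrow>xs. g x)\<^sup>2) =
    real N * (\<Sum>j<p. q j * (g j)\<^sup>2)"
proof -
  let ?P = "\<lambda>N. draws N p q"
  have i: "integrable (measure_pmf (?P N)) f" for N and f :: "nat list \<Rightarrow> real"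
    by (rule integrable_measure_pmf_finite[OF finite_set_pmf_replicate_categorical[OF q]])
  have q1: "(\<Sum>j<p. q j) = 1"
    using q by (auto simp: prob_simplex_def)
  have 1: "measure_pmf.expectation (?P N) (\<lambda>xs. \<Sum>x\<leftarrow>xs. g x) = 0" for N
  proof (induction N)
    case (Suc N)
    show ?case
      by (subst expectation_replicate_Suc[OF q]) (simp add: Bochner_Integration.integral_add[OF i i] Suc g)
  qed simp
  show "measure_pmf.expectation (?P N) (\<lambda>xs. (\<Sum>x\<leftarrow>xs. g x)\<^sup>2) = real N * (\<Sum>j<p. q j * (g j)\<^sup>2)"
  proof (induction N)
    case (Suc N)
    have "measure_pmf.expectation (?P N) (\<lambda>xs. (\<Sum>x\<leftarrow>j # xs. g x)\<^sup>2) =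
        (g j)\<^sup>2 + real N * (\<Sum>j<p. q j * (g j)\<^sup>2)" for j
    proof -
      have "(\<lambda>xs. (\<Sum>x\<leftarrow>j # xs. g x)\<^sup>2) = (\<lambda>xs. (g j)\<^sup>2 + (2 * g j * (\<Sum>x\<leftarrow>xs. g x) + (\<Sum>x\<leftarrow>xs. g x)\<^sup>2))"
        by (auto simp: power2_eq_square algebra_simps)
      then show ?thesis
        by (simp only: Bochner_Integration.integral_add[OF i i] Suc) (simp add: 1)
    qed
    then show ?case
      by (subst expectation_replicate_Suc[OF q])
         (simp add: distrib_left distrib_right sum.distrib sum_distrib_right[symmetric] q1)
  qed simp
qed

lemma sum_count_list:
  fixes h :: "nat \<Rightarrow> real"
  assumes "set xs \<subseteq> {..<p}"
  shows "(\<Sum>j<p. real (count_list xs j) * h j) = (\<Sum>x\<leftarrow>xs. h x)"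
  using assms
proof (induction xs)
  case (Cons a xs)
  have "(\<Sum>j<p. real (count_list (a # xs) j) * h j)
      = (\<Sum>j<p. real (count_list xs j) * h j + (if j = a then h j else 0))"
    by (rule sum.cong) (auto simp: algebra_simps)
  also have "\<dots> = (\<Sum>x\<leftarrow>xs. h x) + h a"
    using Cons by (simp add: sum.distrib)
  finally show ?case by simp
qed simp

lemma freq_pmf_eq:
  "freq_pmf p N q =
    map_pmf (\<lambda>xs j. real (count_list xs j) / real N) (draws N p q)"
  by (simp add: freq_pmf_def multinomial_pmf_def map_pmf_comp)

lemma finite_set_pmf_freq:
  "q \<in> prob_simplex p \<Longrightarrow> finite (set_pmf (freq_pmf p N q))"
  by (simp add: freq_pmf_eq finite_set_pmf_replicate_categorical)

lemma integrable_freq: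
  fixes f :: "(nat \<Rightarrow> real) \<Rightarrow> real"
  shows "q \<in> prob_simplex p \<Longrightarrow> integrable (measure_pmf (freq_pmf p N q)) f"
  by (rule integrable_measure_pmf_finite[OF finite_set_pmf_freq])

text \<open>A linear functional of the frequencies is an average over the draws, so that its law is that
  of a mean of independent bounded variables.\<close>

lemma expectation_freq_linear:
  fixes f :: "real \<Rightarrow> real"
  assumes q: "q \<in> prob_simplex p" and N: "N \<ge> 1"
  shows "measure_pmf.expectation (freq_pmf p N q) (\<lambda>x. f (\<Sum>j<p. (x j - q j) * h j)) =
    measure_pmf.expectation (draws N p q)
      (\<lambda>xs. f ((\<Sum>x\<leftarrow>xs. h x - (\<Sum>j<p. q j * h j)) / real N))"
proof -
  have "(\<Sum>j<p. (real (count_list xs j) / real N - q j) * h j)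
      = (\<Sum>x\<leftarrow>xs. h x - (\<Sum>j<p. q j * h j)) / real N"
    if "xs \<in> set_pmf (draws N p q)" for xs
  proof -
    have xs: "set xs \<subseteq> {..<p}" "length xs = N"
      using that unfolding set_replicate_pmf set_pmf_categorical[OF q] by (auto simp: in_lists_conv_set)
    have "(\<Sum>j<p. (real (count_list xs j) / real N - q j) * h j)
        = (\<Sum>j<p. real (count_list xs j) * h j) / real N - (\<Sum>j<p. q j * h j)"
      by (simp add: left_diff_distrib sum_subtractf sum_divide_distrib)
    also have "\<dots> = ((\<Sum>x\<leftarrow>xs. h x) - real N * (\<Sum>j<p. q j * h j)) / real N"
      using N by (subst sum_count_list[OF xs(1)]) (simp add: field_simps)
    also have "\<dots> = (\<Sum>x\<leftarrow>xs. h x - (\<Sum>j<p. q j * h j)) / real N"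
      using xs(2) by (simp add: sum_list_subtractf sum_list_triv)
    finally show ?thesis .
  qed
  then show ?thesis
    unfolding freq_pmf_eq integral_map_pmf
    by (intro integral_cong_AE) (auto simp: AE_measure_pmf_iff)
qed

lemma expectation_freq_square:
  assumes q: "q \<in> prob_simplex p" and N: "N \<ge> 1"
  shows "measure_pmf.expectation (freq_pmf p N q) (\<lambda>x. (\<Sum>j<p. (x j - q j) * h j)\<^sup>2)
    \<le> (\<Sum>j<p. q j * (h j)\<^sup>2) / real N"
proof -
  define \<mu> where "\<mu> = (\<Sum>j<p. q j * h j)"
  have q1: "(\<Sum>j<p. q j) = 1" "\<And>j. j < p \<Longrightarrow> 0 \<le> q j"
    using q by (auto simp: prob_simplex_def)
  have c: "(\<Sum>j<p. q j * (h j - \<mu>)) = 0"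
    using q1 by (simp add: right_diff_distrib sum_subtractf sum_distrib_right[symmetric] \<mu>_def)
  have "measure_pmf.expectation (freq_pmf p N q) (\<lambda>x. (\<Sum>j<p. (x j - q j) * h j)\<^sup>2)
      = (real N * (\<Sum>j<p. q j * (h j - \<mu>)\<^sup>2)) / (real N)\<^sup>2"
    unfolding expectation_freq_linear[OF q N, of "\<lambda>y. y\<^sup>2"] \<mu>_def[symmetric]
    by (simp add: power_divide expectation_replicate_square[OF q c])
  also have "\<dots> = (\<Sum>j<p. q j * (h j - \<mu>)\<^sup>2) / real N"
    using N by (simp add: power2_eq_square)
  also have "(\<Sum>j<p. q j * (h j - \<mu>)\<^sup>2) = (\<Sum>j<p. q j * (h j)\<^sup>2 - 2 * \<mu> * (q j * h j) + \<mu>\<^sup>2 * q j)"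
    by (rule sum.cong) (auto simp: power2_eq_square algebra_simps)
  also have "\<dots> = (\<Sum>j<p. q j * (h j)\<^sup>2) - \<mu>\<^sup>2"
    by (simp add: sum.distrib sum_subtractf sum_distrib_left[symmetric] q1 \<mu>_def[symmetric] power2_eq_square)
  also have "\<dots> / real N \<le> (\<Sum>j<p. q j * (h j)\<^sup>2) / real N"
    by (intro divide_right_mono) auto
  finally show ?thesis .
qed

lemma exp_le_quadratic:
  fixes x :: real
  assumes "x \<le> 1"
  shows "exp x \<le> 1 + x + x\<^sup>2"
proof (cases "x \<ge> 0")
  case True
  then show ?thesis using exp_bound assms by simp
next
  case False
  define a where "a = - x"
  have a: "a > 0" "x = - a" using False by (auto simp: a_def)
  have pos: "1 - a + a\<^sup>2 > 0"
    using zero_le_power2[of "a - 1/2"] by (simp add: power2_eq_square algebra_simps)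
  have "1 \<le> (1 + a + a\<^sup>2 / 2) * (1 - a + a\<^sup>2)"
  proof -
    have "(1 + a + a\<^sup>2 / 2) * (1 - a + a\<^sup>2) = 1 + a^2/2 + a^3/2 + a^4/2"
      by (simp add: field_simps power2_eq_square power3_eq_cube power4_eq_xxxx)
    then show ?thesis using a(1) by simp
  qed
  also have "\<dots> \<le> exp a * (1 - a + a\<^sup>2)"
    using exp_lower_Taylor_quadratic[of a] a pos by (intro mult_right_mono) auto
  finally have "exp (- a) \<le> 1 - a + a\<^sup>2"
    by (simp add: exp_minus field_simps)
  then show ?thesis using a by simp
qed

lemma markov_finite_pmf:
  fixes f :: "'a \<Rightarrow> real"
  assumes "finite (set_pmf P)" and "\<And>x. 0 \<le> f x" and "c > 0"
  shows "measure_pmf.prob P {x. f x \<ge> c} \<le> measure_pmf.expectation P f / c"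
  using integral_Markov_inequality_measure[of "measure_pmf P" f "{}" c] assms
    integrable_measure_pmf_finite[OF assms(1), of f] by simp

text \<open>The one-sided Bernstein bound.  Only an upper bound on \<open>h\<close> enters, because
  \<open>e\<^sup>y \<le> 1 + y + y\<^sup>2\<close> for all \<open>y \<le> 1\<close>; thus lower tails of nonnegative functionals
  need no bound on their size.\<close>

lemma freq_bernstein:
  assumes q: "q \<in> prob_simplex p" and N: "N \<ge> 1"
    and b: "b > 0" "\<And>j. j < p \<Longrightarrow> h j \<le> b"
    and v: "v > 0" "(\<Sum>j<p. q j * (h j)\<^sup>2) \<le> v" and t: "t > 0"
  shows "measure_pmf.prob (freq_pmf p N q) {x. (\<Sum>j<p. (x j - q j) * h j) > t}
    \<le> exp (- (real N * min (t\<^sup>2 / (4 * v)) (t / (2 * b))))"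
proof -
  \<comment> \<open>The minimiser of the Chernoff exponent, truncated so that \<open>\<theta> h \<le> 1\<close>.\<close>
  define \<theta> where "\<theta> = min (1 / b) (t / (2 * v))"
  define \<mu> where "\<mu> = (\<Sum>j<p. q j * h j)"
  have q1: "(\<Sum>j<p. q j) = 1" "\<And>j. j < p \<Longrightarrow> 0 \<le> q j"
    using q by (auto simp: prob_simplex_def)
  have th: "\<theta> > 0" "\<theta> * b \<le> 1" "\<theta> * v \<le> t / 2"
    using b(1) v(1) t by (auto simp: \<theta>_def min_def field_simps)
  have S: "(\<Sum>j<p. q j * exp (\<theta> * (h j - \<mu>))) \<le> exp (\<theta>\<^sup>2 * v)"
  proof -
    have "(\<Sum>j<p. q j * exp (\<theta> * h j)) \<le> (\<Sum>j<p. q j * (1 + \<theta> * h j + (\<theta> * h j)\<^sup>2))"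
    proof (intro sum_mono mult_left_mono exp_le_quadratic)
      fix j assume "j \<in> {..<p}"
      then have "\<theta> * h j \<le> \<theta> * b"
        using b(2)[of j] th(1) by (intro mult_left_mono) auto
      then show "\<theta> * h j \<le> 1" using th(2) by simp
    qed (use q1 in auto)
    also have "\<dots> = 1 + \<theta> * \<mu> + \<theta>\<^sup>2 * (\<Sum>j<p. q j * (h j)\<^sup>2)"
      by (simp add: distrib_left sum.distrib q1 \<mu>_def sum_distrib_left power_mult_distrib mult_ac)
    also have "\<dots> \<le> 1 + \<theta> * \<mu> + \<theta>\<^sup>2 * v"
      using v by (intro add_left_mono mult_left_mono) auto
    also have "\<dots> \<le> exp (\<theta> * \<mu> + \<theta>\<^sup>2 * v)"
      using exp_ge_add_one_self[of "\<theta> * \<mu> + \<theta>\<^sup>2 * v"] by (simp add: add.assoc)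
    finally have "exp (- \<theta> * \<mu>) * (\<Sum>j<p. q j * exp (\<theta> * h j)) \<le> exp (- \<theta> * \<mu>) * exp (\<theta> * \<mu> + \<theta>\<^sup>2 * v)"
      by (intro mult_left_mono) auto
    then show ?thesis
      by (simp add: sum_distrib_left exp_diff exp_minus exp_add right_diff_distrib field_simps)
  qed
  have "measure_pmf.expectation (freq_pmf p N q) (\<lambda>x. exp (real N * \<theta> * (\<Sum>j<p. (x j - q j) * h j)))
      = measure_pmf.expectation (draws N p q) (\<lambda>xs. exp (\<Sum>x\<leftarrow>xs. \<theta> * (h x - \<mu>)))"
    unfolding expectation_freq_linear[OF q N, of "\<lambda>y. exp (real N * \<theta> * y)"] \<mu>_def[symmetric]
    using N by (simp add: sum_list_const_mult)
  also have "\<dots> = (\<Sum>j<p. q j * exp (\<theta> * (h j - \<mu>))) ^ N"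
    by (rule expectation_replicate_exp[OF q])
  also have "\<dots> \<le> exp (\<theta>\<^sup>2 * v) ^ N"
    by (intro power_mono S sum_nonneg mult_nonneg_nonneg) (use q1 in auto)
  also have "\<dots> = exp (real N * (\<theta>\<^sup>2 * v))"
    by (simp add: exp_of_nat_mult)
  finally have E: "measure_pmf.expectation (freq_pmf p N q)
      (\<lambda>x. exp (real N * \<theta> * (\<Sum>j<p. (x j - q j) * h j))) \<le> exp (real N * (\<theta>\<^sup>2 * v))" .
  have "measure_pmf.prob (freq_pmf p N q) {x. (\<Sum>j<p. (x j - q j) * h j) > t}
      \<le> measure_pmf.prob (freq_pmf p N q)
          {x. exp (real N * \<theta> * (\<Sum>j<p. (x j - q j) * h j)) \<ge> exp (real N * \<theta> * t)}"
    using th(1) N by (intro measure_pmf.finite_measure_mono) (auto intro!: mult_left_mono)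
  also have "\<dots> \<le> measure_pmf.expectation (freq_pmf p N q)
      (\<lambda>x. exp (real N * \<theta> * (\<Sum>j<p. (x j - q j) * h j))) / exp (real N * \<theta> * t)"
    by (rule markov_finite_pmf[OF finite_set_pmf_freq[OF q]]) auto
  also have "\<dots> \<le> exp (real N * (\<theta>\<^sup>2 * v)) / exp (real N * \<theta> * t)"
    by (intro divide_right_mono E) auto
  also have "\<dots> = exp (- (real N * (\<theta> * (t - \<theta> * v))))"
    by (simp add: exp_diff[symmetric] power2_eq_square algebra_simps)
  also have "\<dots> \<le> exp (- (real N * min (t\<^sup>2 / (4 * v)) (t / (2 * b))))"
  proof -
    have "min (t\<^sup>2 / (4 * v)) (t / (2 * b)) = \<theta> * (t / 2)"
      using t unfolding \<theta>_def
      by (subst mult.commute, subst min_mult_distrib_left) (simp add: min.commute power2_eq_square)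
    also have "\<dots> \<le> \<theta> * (t - \<theta> * v)"
      using th by (intro mult_left_mono) auto
    finally show ?thesis
      by (simp add: mult_left_mono)
  qed
  finally show ?thesis .
qed

lemma set_pmf_freqD:
  assumes q: "q \<in> prob_simplex p" and N: "N \<ge> 1" and x: "x \<in> set_pmf (freq_pmf p N q)"
  shows "\<And>j. 0 \<le> x j" "(\<Sum>j<p. x j) = 1" "\<And>j. x j > 0 \<Longrightarrow> j < p \<and> q j > 0"
proof -
  obtain xs where xs: "x = (\<lambda>j. real (count_list xs j) / real N)"
      "xs \<in> set_pmf (draws N p q)"
    using x by (auto simp: freq_pmf_eq)
  have s: "set xs \<subseteq> {j. j < p \<and> q j > 0}" "length xs = N"
    using xs(2) unfolding set_replicate_pmf set_pmf_categorical[OF q] by (auto simp: in_lists_conv_set)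
  show "\<And>j. 0 \<le> x j" by (simp add: xs)
  have "set xs \<subseteq> {..<p}" using s by auto
  from sum_count_list[OF this, of "\<lambda>_. 1"] show "(\<Sum>j<p. x j) = 1"
    using s N by (simp add: xs sum_divide_distrib[symmetric] sum_list_triv)
  show "j < p \<and> q j > 0" if "x j > 0" for j
    using that s(1) count_list_0_iff[of xs j] by (cases "j \<in> set xs") (auto simp: xs)
qed

section \<open>Elementary inequalities\<close>

text \<open>The loss against the tangent is quadratic near \<open>0\<close> and linear at infinity, so the bound
  remains useful for likelihood ratios of any size.\<close>

lemma ln_one_plus_le:
  fixes x :: real
  assumes "x > -1"
  shows "ln (1 + x) \<le> x - x\<^sup>2 / (2 * (2 + x))"
proof -
  define g where "g = (\<lambda>y::real. y - y\<^sup>2 / (2 * (2 + y)) - ln (1 + y))"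
  define g' where "g' = (\<lambda>y::real. y * (y\<^sup>2 + 3 * y + 4) / (2 * (1 + y) * (2 + y)\<^sup>2))"
  have d: "(g has_real_derivative g' y) (at y)" if "y > -1" for y
  proof -
    have "(g has_real_derivative
        (1 - (2 * y * (2 * (2 + y)) - y\<^sup>2 * 2) / (2 * (2 + y))\<^sup>2 - 1 / (1 + y))) (at y)"
      unfolding g_def using that by (auto intro!: derivative_eq_intros simp: power2_eq_square)
    moreover have "1 - (2 * y * (2 * (2 + y)) - y\<^sup>2 * 2) / (2 * (2 + y))\<^sup>2 - 1 / (1 + y) = g' y"
      using that unfolding g'_def
      by (simp add: divide_simps) (simp add: algebra_simps power2_eq_square)
    ultimately show ?thesis by simp
  qed
  have pos: "y\<^sup>2 + 3 * y + 4 > 0" for y :: real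
    using zero_le_power2[of "y + 3/2"] by (simp add: power2_eq_square algebra_simps)
  have "g 0 \<le> g x"
  proof (cases "x \<ge> 0")
    case True
    then show ?thesis
    proof (rule DERIV_nonneg_imp_nondecreasing)
      fix y assume "0 \<le> y" "y \<le> x"
      then show "\<exists>z. (g has_real_derivative z) (at y) \<and> 0 \<le> z"
        using pos[of y] d[of y] by (intro exI[of _ "g' y"] conjI) (auto simp: g'_def)
    qed
  next
    case False
    then have "x \<le> 0" by simp
    then show ?thesis
    proof (rule DERIV_nonpos_imp_nonincreasing)
      fix y assume "x \<le> y" "y \<le> 0"
      then show "\<exists>z. (g has_real_derivative z) (at y) \<and> z \<le> 0"
        using pos[of y] assms d[of y]
        by (intro exI[of _ "g' y"] conjI) (auto intro!: divide_nonpos_nonneg mult_nonpos_nonneg simp: g'_def)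
    qed
  qed
  then show ?thesis by (simp add: g_def)
qed

text \<open>The quadratic gain is taken in \<open>r\<close> alone: the term in \<open>z\<close> stays linear, hence usable
  without any upper bound on \<open>z\<close>.\<close>

lemma ln_one_plus_add_le:
  fixes r z :: real
  assumes r: "\<bar>r\<bar> \<le> 1/2" and z: "z \<ge> 0"
  shows "ln (1 + (r + z)) \<le> r - r\<^sup>2 / 5 + z + 2 * \<bar>r\<bar> * z"
proof -
  have pos: "1 + r > 0" using r by (auto simp: abs_le_iff)
  have "1 + (r + z) = (1 + r) * (1 + z / (1 + r))"
    using pos by (simp add: field_simps)
  then have "ln (1 + (r + z)) = ln (1 + r) + ln (1 + z / (1 + r))"
    using pos z by (simp only: ln_mult_pos add_pos_nonneg divide_nonneg_pos zero_less_one)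
  also have "ln (1 + z / (1 + r)) \<le> z / (1 + r)"
    using pos z by (intro ln_add_one_self_le_self) auto
  also have "z / (1 + r) \<le> z * (1 + 2 * \<bar>r\<bar>)"
  proof -
    have "1 \<le> (1 + r) * (1 + 2 * \<bar>r\<bar>)"
    proof (cases "r \<ge> 0")
      case False
      then have "0 \<le> (- r) * (1 - 2 * (- r))" using r by (intro mult_nonneg_nonneg) auto
      then show ?thesis using False by (simp add: algebra_simps)
    qed (simp add: algebra_simps)
    then have "z * 1 \<le> z * ((1 + r) * (1 + 2 * \<bar>r\<bar>))" using z by (rule mult_left_mono)
    then show ?thesis using pos by (simp add: divide_le_eq mult_ac)
  qed
  also have "ln (1 + r) \<le> r - r\<^sup>2 / (2 * (2 + r))"
    using r by (intro ln_one_plus_le) auto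
  also have "\<dots> \<le> r - r\<^sup>2 / 5"
    using r by (intro diff_left_mono divide_left_mono mult_pos_pos) auto
  finally show ?thesis by (simp add: algebra_simps)
qed

lemma sum_mult_le_sqrt:
  fixes a b w :: "'i \<Rightarrow> real"
  assumes "\<And>i. i \<in> I \<Longrightarrow> 0 \<le> w i"
  shows "(\<Sum>i\<in>I. w i * (\<bar>a i\<bar> * \<bar>b i\<bar>)) \<le> sqrt (\<Sum>i\<in>I. w i * (a i)\<^sup>2) * sqrt (\<Sum>i\<in>I. w i * (b i)\<^sup>2)"
proof -
  have "(\<Sum>i\<in>I. w i * (\<bar>a i\<bar> * \<bar>b i\<bar>)) = (\<Sum>i\<in>I. (sqrt (w i) * \<bar>a i\<bar>) * (sqrt (w i) * \<bar>b i\<bar>))"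
  proof (rule sum.cong)
    fix i assume "i \<in> I"
    then have "w i = sqrt (w i) * sqrt (w i)" using assms by simp
    then show "w i * (\<bar>a i\<bar> * \<bar>b i\<bar>) = (sqrt (w i) * \<bar>a i\<bar>) * (sqrt (w i) * \<bar>b i\<bar>)"
      by (metis mult.assoc mult.left_commute)
  qed simp
  also have "\<dots> \<le> \<bar>\<dots>\<bar>" by simp
  also have "\<dots> = sqrt ((\<Sum>i\<in>I. (sqrt (w i) * \<bar>a i\<bar>) * (sqrt (w i) * \<bar>b i\<bar>))\<^sup>2)" by simp
  also have "\<dots> \<le> sqrt ((\<Sum>i\<in>I. (sqrt (w i) * \<bar>a i\<bar>)\<^sup>2) * (\<Sum>i\<in>I. (sqrt (w i) * \<bar>b i\<bar>)\<^sup>2))"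
    by (intro real_sqrt_le_mono Cauchy_Schwarz_ineq_sum)
  also have "(\<Sum>i\<in>I. (sqrt (w i) * \<bar>a i\<bar>)\<^sup>2) = (\<Sum>i\<in>I. w i * (a i)\<^sup>2)"
    using assms by (intro sum.cong) (auto simp: power_mult_distrib)
  also have "(\<Sum>i\<in>I. (sqrt (w i) * \<bar>b i\<bar>)\<^sup>2) = (\<Sum>i\<in>I. w i * (b i)\<^sup>2)"
    using assms by (intro sum.cong) (auto simp: power_mult_distrib)
  finally show ?thesis by (simp add: real_sqrt_mult)
qed

section \<open>Orthonormal systems for a weighted inner product\<close>

definition orthonormal_on :: "'i set \<Rightarrow> ('i \<Rightarrow> real) \<Rightarrow> nat \<Rightarrow> (nat \<Rightarrow> 'i \<Rightarrow> real) \<Rightarrow> bool" where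
  "orthonormal_on I w r \<phi> \<longleftrightarrow>
    (\<forall>a<r. \<forall>b<r. (\<Sum>i\<in>I. w i * (\<phi> a i * \<phi> b i)) = (if a = b then 1 else 0))"

text \<open>The change of basis is recorded in both directions: expanding the inputs in the orthonormal system
  gives norms, and expanding the system in the inputs gives pointwise bounds on it.\<close>

lemma gram_schmidt:
  fixes f :: "'k \<Rightarrow> 'i \<Rightarrow> real"
  assumes "finite S" and I: "finite I" and w: "\<And>i. i \<in> I \<Longrightarrow> w i > 0"
  shows "\<exists>r \<phi>. r \<le> card S \<and> orthonormal_on I w r \<phi> \<and>
    (\<forall>k\<in>S. \<exists>c. \<forall>i\<in>I. f k i = (\<Sum>a<r. c a * \<phi> a i)) \<and>
    (\<forall>a<r. \<exists>c. \<forall>i\<in>I. \<phi> a i = (\<Sum>k\<in>S. c k * f k i))"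
  using assms(1)
proof induction
  case empty
  then show ?case by (intro exI[of _ 0]) (auto simp: orthonormal_on_def)
next
  case (insert l S)
  then obtain r \<phi> where r: "r \<le> card S" and on: "orthonormal_on I w r \<phi>"
    and fs: "\<forall>k\<in>S. \<exists>c. \<forall>i\<in>I. f k i = (\<Sum>a<r. c a * \<phi> a i)"
    and ps: "\<forall>a<r. \<exists>c. \<forall>i\<in>I. \<phi> a i = (\<Sum>k\<in>S. c k * f k i)" by blast
  define \<gamma> where "\<gamma> a = (\<Sum>i\<in>I. w i * (f l i * \<phi> a i))" for a
  define g where "g i = f l i - (\<Sum>a<r. \<gamma> a * \<phi> a i)" for i
  define n where "n = (\<Sum>i\<in>I. w i * (g i)\<^sup>2)"
  have orth: "(\<Sum>i\<in>I. w i * (g i * \<phi> b i)) = 0" if "b < r" for b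
  proof -
    have "(\<Sum>i\<in>I. w i * (g i * \<phi> b i)) = \<gamma> b - (\<Sum>i\<in>I. \<Sum>a<r. \<gamma> a * (w i * (\<phi> a i * \<phi> b i)))"
      by (simp add: g_def \<gamma>_def left_diff_distrib right_diff_distrib sum_subtractf sum_distrib_right
          sum_distrib_left mult_ac)
    also have "(\<Sum>i\<in>I. \<Sum>a<r. \<gamma> a * (w i * (\<phi> a i * \<phi> b i))) = (\<Sum>a<r. \<gamma> a * (\<Sum>i\<in>I. w i * (\<phi> a i * \<phi> b i)))"
      by (subst sum.swap) (simp add: sum_distrib_left)
    also have "\<dots> = (\<Sum>a<r. if a = b then \<gamma> a else 0)"
      using on that by (intro sum.cong) (auto simp: orthonormal_on_def)
    also have "\<dots> = \<gamma> b" using that by simp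
    finally show ?thesis by simp
  qed
  have n0: "n \<ge> 0" unfolding n_def by (intro sum_nonneg mult_nonneg_nonneg) (auto dest: w)
  have old: "\<exists>c. \<forall>i\<in>I. \<phi> b i = (\<Sum>k\<in>insert l S. c k * f k i)" if b: "b < r" for b
  proof -
    obtain c where c: "\<forall>i\<in>I. \<phi> b i = (\<Sum>k\<in>S. c k * f k i)" using ps b by blast
    have "(\<Sum>k\<in>S. (c(l := 0)) k * f k i) = (\<Sum>k\<in>S. c k * f k i)" for i
      using insert by (intro sum.cong) auto
    then show ?thesis using c insert by (intro exI[of _ "c(l := 0)"]) simp
  qed
  show ?case
  proof (cases "n = 0")
    case True
    then have "\<forall>i\<in>I. w i * (g i)\<^sup>2 = 0"
      unfolding n_def using w I by (subst (asm) sum_nonneg_eq_0_iff) (auto simp: less_imp_le)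
    then have "g i = 0" if "i \<in> I" for i using w that by force
    then have "\<forall>i\<in>I. f l i = (\<Sum>a<r. \<gamma> a * \<phi> a i)"
      by (auto simp: g_def)
    moreover note old
    ultimately show ?thesis
      using r on fs insert by (intro exI[of _ r] exI[of _ \<phi>]) auto
  next
    case False
    then have np: "n > 0" using n0 by simp
    define \<psi> where "\<psi> = \<phi>(r := (\<lambda>i. g i / sqrt n))"
    have psi: "\<psi> a = \<phi> a" if "a < r" for a using that by (simp add: \<psi>_def)
    have psir: "\<psi> r i = g i / sqrt n" for i by (simp add: \<psi>_def)
    have o1: "(\<Sum>i\<in>I. w i * (\<psi> r i * \<phi> b i)) = 0" if "b < r" for b
    proof -
      have "(\<Sum>i\<in>I. w i * (\<psi> r i * \<phi> b i)) = (\<Sum>i\<in>I. w i * (g i * \<phi> b i)) / sqrt n"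
        by (simp add: psir sum_divide_distrib)
      then show ?thesis using orth[OF that] by simp
    qed
    have o2: "(\<Sum>i\<in>I. w i * (\<psi> r i * \<psi> r i)) = 1"
    proof -
      have "(\<Sum>i\<in>I. w i * (\<psi> r i * \<psi> r i)) = n / n"
        unfolding n_def sum_divide_distrib using np
        by (intro sum.cong) (auto simp: psir power2_eq_square n_def)
      then show ?thesis using np by simp
    qed
    have "orthonormal_on I w (Suc r) \<psi>"
      unfolding orthonormal_on_def
    proof (intro allI impI)
      fix a b assume ab: "a < Suc r" "b < Suc r"
      consider "a < r" "b < r" | "a = r" "b < r" | "a < r" "b = r" | "a = r" "b = r"
        using ab by linarith
      then show "(\<Sum>i\<in>I. w i * (\<psi> a i * \<psi> b i)) = (if a = b then 1 else 0)"
      proof cases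
        case 1 then show ?thesis using on by (simp add: psi orthonormal_on_def)
      next
        case 2 then show ?thesis using o1 by (simp add: psi)
      next
        case 3 then show ?thesis using o1[of a] by (simp add: psi mult.commute[of "\<phi> a _"])
      next
        case 4 then show ?thesis using o2 by simp
      qed
    qed
    moreover have "\<exists>c. \<forall>i\<in>I. f k i = (\<Sum>a<Suc r. c a * \<psi> a i)" if "k \<in> insert l S" for k
    proof (cases "k = l")
      case True
      have "(\<Sum>a<r. (\<gamma>(r := sqrt n)) a * \<psi> a i) = (\<Sum>a<r. \<gamma> a * \<phi> a i)" for i
        by (intro sum.cong) (auto simp: psi)
      then show ?thesis
        using np True by (intro exI[of _ "\<gamma>(r := sqrt n)"]) (simp add: psir g_def)
    next
      case False
      then have "k \<in> S" using that by simp
      then obtain c where c: "\<forall>i\<in>I. f k i = (\<Sum>a<r. c a * \<phi> a i)" using fs by blast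
      have "(\<Sum>a<r. (c(r := 0)) a * \<psi> a i) = (\<Sum>a<r. c a * \<phi> a i)" for i
        by (intro sum.cong) (auto simp: psi)
      then show ?thesis using c by (intro exI[of _ "c(r := 0)"]) simp
    qed
    moreover have "\<exists>c. \<forall>i\<in>I. \<psi> a i = (\<Sum>k\<in>insert l S. c k * f k i)" if a: "a < Suc r" for a
    proof -
      show ?thesis
      proof (cases "a < r")
        case True then show ?thesis using old psi by simp
      next
        case False
        then have [simp]: "a = r" using a by simp
        obtain c where c: "\<And>b i. b < r \<Longrightarrow> i \<in> I \<Longrightarrow> \<phi> b i = (\<Sum>k\<in>insert l S. c b k * f k i)"
          using old by metis
        define e where "e k = ((if k = l then 1 else 0) - (\<Sum>b<r. \<gamma> b * c b k)) / sqrt n" for k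
        have "\<psi> r i = (\<Sum>k\<in>insert l S. e k * f k i)" if i: "i \<in> I" for i
        proof -
          have "(\<Sum>b<r. \<gamma> b * \<phi> b i) = (\<Sum>b<r. \<gamma> b * (\<Sum>k\<in>insert l S. c b k * f k i))"
            using c i by (intro sum.cong) auto
          also have "\<dots> = (\<Sum>k\<in>insert l S. (\<Sum>b<r. \<gamma> b * c b k) * f k i)"
            unfolding sum_distrib_left sum_distrib_right
            by (subst sum.swap) (simp add: mult_ac)
          finally have 1: "(\<Sum>b<r. \<gamma> b * \<phi> b i) = (\<Sum>k\<in>insert l S. (\<Sum>b<r. \<gamma> b * c b k) * f k i)" .
          have 2: "f l i = (\<Sum>k\<in>insert l S. (if k = l then 1 else 0) * f k i)"
            using insert by (auto intro!: sum.neutral)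
          have "g i = (\<Sum>k\<in>insert l S. ((if k = l then 1 else 0) - (\<Sum>b<r. \<gamma> b * c b k)) * f k i)"
            unfolding g_def 1 by (subst 2) (simp only: left_diff_distrib sum_subtractf)
          then show ?thesis
            unfolding psir e_def by (simp only: sum_divide_distrib) (simp only: times_divide_eq_left)
        qed
        then show ?thesis by auto
      qed
    qed
    moreover have "Suc r \<le> card (insert l S)" using r insert by simp
    ultimately show ?thesis by blast
  qed
qed

lemma sum_square_orthonormal:
  assumes "orthonormal_on I w r \<phi>"
  shows "(\<Sum>i\<in>I. w i * (\<Sum>a<r. c a * \<phi> a i)\<^sup>2) = (\<Sum>a<r. (c a)\<^sup>2)"
proof -
  have "(\<Sum>i\<in>I. w i * (\<Sum>a<r. c a * \<phi> a i)\<^sup>2)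
      = (\<Sum>i\<in>I. \<Sum>a<r. \<Sum>b<r. c a * c b * (w i * (\<phi> a i * \<phi> b i)))"
    by (simp add: power2_eq_square sum_product sum_distrib_left mult_ac)
  also have "\<dots> = (\<Sum>a<r. \<Sum>b<r. c a * c b * (\<Sum>i\<in>I. w i * (\<phi> a i * \<phi> b i)))"
    by (subst sum.swap, intro sum.cong refl, subst sum.swap) (simp add: sum_distrib_left)
  also have "\<dots> = (\<Sum>a<r. \<Sum>b<r. if b = a then c a * c b else 0)"
    using assms by (intro sum.cong refl) (auto simp: orthonormal_on_def)
  also have "\<dots> = (\<Sum>a<r. (c a)\<^sup>2)"
    by (simp add: power2_eq_square)
  finally show ?thesis .
qed

section \<open>A single problem instance\<close>

text \<open>The data enter all estimates below through the sums of \<open>(x j - q j) * h j\<close> for fixed functions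
  \<open>h\<close>, which are built from the density ratios of the topics.\<close>

locale topic_instance =
  fixes N p K s :: nat and A :: "nat \<Rightarrow> nat \<Rightarrow> real" and T :: "nat \<Rightarrow> real"
  assumes N_pos: "1 \<le> N" and s_pos: "1 \<le> s" and s_less: "s < K" and K_less: "K < p"
    and columns: "\<And>k. k < K \<Longrightarrow> (\<lambda>j. A j k) \<in> prob_simplex p"
    and T_sparse: "T \<in> sparse_simplex K s"
begin

abbreviation "q \<equiv> mat_vec K A T"
abbreviation "S \<equiv> supp K T"
abbreviation "Sc \<equiv> {..<K} - supp K T"
abbreviation "J \<equiv> J_bar p q"
abbreviation "tmin \<equiv> T_min K T"
abbreviation "law \<equiv> freq_pmf p N q"
abbreviation "Pr \<equiv> measure_pmf.prob law"
abbreviation "mean (f :: (nat \<Rightarrow> real) \<Rightarrow> real) \<equiv> measure_pmf.expectation law f"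
abbreviation "l1 \<equiv> l1_on {..<K}"

text \<open>\<open>score k\<close> is the density ratio \<open>A\<^sub>j\<^sub>k / \<Pi>\<^sub>*\<^sub>j\<close>.  Division by zero makes it vanish outside the
  support of \<open>\<Pi>\<^sub>*\<close>, where no data are seen.\<close>

definition score :: "nat \<Rightarrow> nat \<Rightarrow> real" where "score k j = A j k / q j"

text \<open>\<open>pert v\<close> is the relative change of \<open>\<Pi>\<^sub>*\<close> when \<open>T\<^sub>*\<close> moves by \<open>v\<close>.\<close>

definition pert :: "(nat \<Rightarrow> real) \<Rightarrow> nat \<Rightarrow> real" where "pert v j = (\<Sum>k<K. v k * score k j)"

definition Z :: "(nat \<Rightarrow> real) \<Rightarrow> nat \<Rightarrow> real" where "Z x k = (\<Sum>j<p. (x j - q j) * score k j)"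

definition leak :: "nat \<Rightarrow> real" where "leak k = (\<Sum>j\<in>{..<p} - J. A j k)"

definition qnorm :: "(nat \<Rightarrow> real) \<Rightarrow> real" where "qnorm f = sqrt (\<Sum>j<p. q j * (f j)\<^sup>2)"

lemma K_ge_2: "2 \<le> K" and K_pos: "0 < K"
  using s_pos s_less by auto

lemma A_nonneg: "j < p \<Longrightarrow> k < K \<Longrightarrow> 0 \<le> A j k"
  using columns by (auto simp: prob_simplex_def)

lemma A_sum: "k < K \<Longrightarrow> (\<Sum>j<p. A j k) = 1"
  using columns by (auto simp: prob_simplex_def)

lemma T_nonneg: "k < K \<Longrightarrow> 0 \<le> T k" and T_sum: "(\<Sum>k<K. T k) = 1" and card_S: "card S = s"
  using T_sparse by (auto simp: sparse_simplex_def prob_simplex_def)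

lemma S_sub: "S \<subseteq> {..<K}" and finite_S [simp]: "finite S"
  by (auto simp: supp_def)

lemma S_nonempty: "S \<noteq> {}"
  using card_S s_pos by auto

lemma Sc_nonempty: "Sc \<noteq> {}"
proof
  assume "Sc = {}"
  then have "card {..<K} \<le> card S" by (intro card_mono) auto
  then show False using card_S s_less by simp
qed

lemma sum_split_S: "(\<Sum>k<K. f k) = (\<Sum>k\<in>S. f k) + (\<Sum>k\<in>Sc. f k)" for f :: "nat \<Rightarrow> real"
  using sum.subset_diff[OF S_sub, of f] by simp

lemma q_nonneg: "j < p \<Longrightarrow> 0 \<le> q j"
  by (auto simp: mat_vec_def intro!: sum_nonneg mult_nonneg_nonneg A_nonneg T_nonneg)

lemma q_simplex: "q \<in> prob_simplex p"
proof -
  have "(\<Sum>j<p. q j) = (\<Sum>k<K. (\<Sum>j<p. A j k) * T k)"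
    unfolding mat_vec_def sum_distrib_right by (rule sum.swap)
  also have "\<dots> = 1" by (simp add: A_sum T_sum)
  finally show ?thesis by (auto simp: prob_simplex_def q_nonneg)
qed

lemma q_sum: "(\<Sum>j<p. q j) = 1"
  using q_simplex by (auto simp: prob_simplex_def)

lemma J_sub: "J \<subseteq> {..<p}" and J_iff: "j \<in> J \<longleftrightarrow> j < p \<and> q j > 0"
  by (auto simp: J_bar_def)

lemma finite_J [simp]: "finite J"
  using J_sub finite_subset by blast

lemma tmin_le: "k \<in> S \<Longrightarrow> tmin \<le> T k"
  by (auto simp: T_min_def)

lemma tmin_pos: "0 < tmin"
proof -
  have "tmin \<in> T ` S" unfolding T_min_def using S_nonempty by (intro Min_in) auto
  then obtain k where "k \<in> S" "tmin = T k" by auto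
  then show ?thesis using T_nonneg[of k] by (auto simp: supp_def)
qed

lemma T_sum_S: "(\<Sum>k\<in>S. T k) = 1"
  using T_sum sum_split_S[of T] by (simp add: supp_def)

lemma s_tmin: "real s * tmin \<le> 1"
proof -
  have "real s * tmin = (\<Sum>k\<in>S. tmin)" by (simp add: card_S)
  also have "\<dots> \<le> (\<Sum>k\<in>S. T k)" by (intro sum_mono tmin_le)
  finally show ?thesis by (simp add: T_sum_S)
qed

lemma tmin_le_1: "tmin \<le> 1"
proof -
  have "1 * tmin \<le> real s * tmin" using s_pos tmin_pos by (intro mult_right_mono) auto
  then show ?thesis using s_tmin by simp
qed

lemma tmin_eq_1: "s = 1 \<Longrightarrow> tmin = 1"
proof -
  assume "s = 1"
  then obtain k where k: "S = {k}" using card_S card_1_singletonE by blast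
  then have "T k = 1" using T_sum_S by simp
  then show ?thesis by (simp add: T_min_def k)
qed

lemma q_eq_S: "q j = (\<Sum>k\<in>S. A j k * T k)"
proof -
  have "q j = (\<Sum>k\<in>S. A j k * T k) + (\<Sum>k\<in>Sc. A j k * T k)"
    unfolding mat_vec_def by (rule sum_split_S)
  also have "(\<Sum>k\<in>Sc. A j k * T k) = 0" by (auto simp: supp_def intro!: sum.neutral)
  finally show ?thesis by simp
qed

text \<open>The weights of the active topics are at least \<open>T\<^sub>m\<^sub>i\<^sub>n\<close>, so that \<open>\<Pi>\<^sub>*\<close> dominates the active
  columns; through \<open>\<xi>\<close> it then dominates the inactive ones on its support.\<close>

lemma l1_S_le:
  assumes "j < p"
  shows "tmin * l1_on S (A j) \<le> q j"
  unfolding q_eq_S l1_on_def sum_distrib_left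
proof (rule sum_mono)
  fix k assume k: "k \<in> S"
  then have "0 \<le> A j k" using S_sub assms by (intro A_nonneg) auto
  then show "tmin * \<bar>A j k\<bar> \<le> A j k * T k"
    using mult_left_mono[OF tmin_le[OF k], of "A j k"] by (simp add: mult.commute[of tmin])
qed

lemma l1_S_pos: "j \<in> J \<Longrightarrow> 0 < l1_on S (A j)"
proof (rule ccontr)
  assume j: "j \<in> J" and "\<not> 0 < l1_on S (A j)"
  moreover have "0 \<le> l1_on S (A j)" by (auto simp: l1_on_def intro!: sum_nonneg)
  ultimately have "l1_on S (A j) = 0" by linarith
  then have "(\<Sum>k\<in>S. \<bar>A j k\<bar>) = 0" by (simp add: l1_on_def)
  then have "\<forall>k\<in>S. A j k = 0" by (subst (asm) sum_nonneg_eq_0_iff) auto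
  then have "q j = 0" by (simp add: q_eq_S)
  then show False using j by (simp add: J_iff)
qed

lemma score_nonneg: "j < p \<Longrightarrow> k < K \<Longrightarrow> 0 \<le> score k j"
  by (auto simp: score_def intro!: divide_nonneg_nonneg A_nonneg q_nonneg)

lemma score_outside: "j < p \<Longrightarrow> j \<notin> J \<Longrightarrow> score k j = 0"
  using q_nonneg[of j] by (auto simp: score_def J_iff)

lemma score_le_S:
  assumes "k \<in> S" "j < p"
  shows "score k j \<le> 1 / tmin"
proof (cases "j \<in> J")
  case True
  have "\<bar>A j k\<bar> \<le> l1_on S (A j)"
    unfolding l1_on_def by (rule member_le_sum) (use assms in auto)
  then have "tmin * A j k \<le> tmin * l1_on S (A j)"
    using tmin_pos by (intro mult_left_mono) auto
  also have "\<dots> \<le> q j" by (rule l1_S_le[OF assms(2)])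
  finally show ?thesis using True tmin_pos by (simp add: score_def J_iff field_simps)
qed (use assms score_outside tmin_pos in auto)

lemma A_le_xi:
  assumes "k \<in> Sc" "j \<in> J"
  shows "A j k \<le> xi p K A T * l1_on S (A j)"
proof -
  have "A j k \<le> \<bar>A j k\<bar>" by simp
  also have "\<dots> \<le> Max ((\<lambda>k. \<bar>A j k\<bar>) ` Sc)"
    using assms by (intro Max_ge) auto
  also have "\<dots> = \<dots> / l1_on S (A j) * l1_on S (A j)"
    using l1_S_pos[OF assms(2)] by simp
  also have "\<dots> \<le> xi p K A T * l1_on S (A j)"
    unfolding xi_def using assms l1_S_pos[OF assms(2)]
    by (intro mult_right_mono Max_ge) auto
  finally show ?thesis .
qed

lemma J_nonempty: "J \<noteq> {}"
proof
  assume "J = {}"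
  then have "\<forall>j<p. q j = 0" using q_nonneg J_iff by force
  then show False using q_sum by simp
qed

lemma xi_nonneg: "0 \<le> xi p K A T"
proof -
  obtain j k where j: "j \<in> J" and k: "k \<in> Sc" using J_nonempty Sc_nonempty by auto
  have "0 \<le> A j k" using j k by (intro A_nonneg) (auto simp: J_iff)
  also have "\<dots> \<le> xi p K A T * l1_on S (A j)" by (rule A_le_xi[OF k j])
  finally show ?thesis using l1_S_pos[OF j] by (simp add: zero_le_mult_iff)
qed

text \<open>The bound that \<open>\<xi>\<close> yields on the scores of inactive topics.\<close>

definition ratio :: real where "ratio = xi p K A T / tmin"

lemma ratio_nonneg: "0 \<le> ratio"
  using xi_nonneg tmin_pos by (simp add: ratio_def)

lemma score_le_Sc:
  assumes "k \<in> Sc" "j < p"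
  shows "score k j \<le> ratio"
proof (cases "j \<in> J")
  case True
  have "tmin * A j k \<le> tmin * (xi p K A T * l1_on S (A j))"
    using A_le_xi[OF assms(1) True] tmin_pos by (intro mult_left_mono) auto
  also have "\<dots> = xi p K A T * (tmin * l1_on S (A j))" by simp
  also have "\<dots> \<le> xi p K A T * q j"
    by (intro mult_left_mono l1_S_le assms xi_nonneg)
  finally show ?thesis using True tmin_pos by (simp add: score_def ratio_def J_iff field_simps)
qed (use assms score_outside ratio_nonneg in auto)

lemma score_le: "k < K \<Longrightarrow> j < p \<Longrightarrow> ratio \<le> R \<Longrightarrow> score k j \<le> 1 / tmin + R"
  using score_le_S[of k j] score_le_Sc[of k j] ratio_nonneg tmin_pos
  by (cases "k \<in> S") (auto intro: order.trans add_increasing add_increasing2)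

lemma q_score: "j < p \<Longrightarrow> q j * score k j = (if j \<in> J then A j k else 0)"
  using q_nonneg[of j] by (auto simp: score_def J_iff)

lemma sum_q_score:
  assumes "k < K"
  shows "(\<Sum>j<p. q j * score k j) = 1 - leak k"
proof -
  have "(\<Sum>j<p. q j * score k j) = (\<Sum>j<p. if j \<in> J then A j k else 0)"
    by (intro sum.cong) (auto simp: q_score)
  also have "\<dots> = (\<Sum>j\<in>J. A j k)"
    using J_sub by (simp add: sum.If_cases Int_absorb1)
  also have "\<dots> = (\<Sum>j<p. A j k) - leak k"
    using sum.subset_diff[OF J_sub, of "\<lambda>j. A j k"] by (simp add: leak_def)
  finally show ?thesis by (simp add: A_sum assms)
qed

lemma leak_nonneg: "k < K \<Longrightarrow> 0 \<le> leak k"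
  by (auto simp: leak_def intro!: sum_nonneg A_nonneg)

lemma leak_le_1: "k < K \<Longrightarrow> leak k \<le> 1"
  using sum_nonneg[of "{..<p}" "\<lambda>j. q j * score k j"] sum_q_score
  by (simp add: q_nonneg score_nonneg)

lemma leak_S:
  assumes "k \<in> S"
  shows "leak k = 0"
  unfolding leak_def
proof (intro sum.neutral ballI)
  fix j assume j: "j \<in> {..<p} - J"
  then have "q j = 0" using q_nonneg[of j] by (auto simp: J_iff)
  moreover have "0 \<le> A j l * T l" if "l \<in> S" for l
    using that S_sub j by (intro mult_nonneg_nonneg A_nonneg T_nonneg) auto
  ultimately have "\<forall>l\<in>S. A j l * T l = 0"
    using q_eq_S[of j] by (simp add: sum_nonneg_eq_0_iff)
  then show "A j k = 0" using assms by (auto simp: supp_def)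
qed

lemma sum_q_score_square:
  assumes "k < K" and "\<And>j. j < p \<Longrightarrow> score k j \<le> b"
  shows "(\<Sum>j<p. q j * (score k j)\<^sup>2) \<le> b"
proof -
  have b: "0 \<le> b" using score_nonneg[of 0 k] assms(2)[of 0] assms(1) K_less by simp
  have "(\<Sum>j<p. q j * (score k j)\<^sup>2) \<le> (\<Sum>j<p. q j * (b * score k j))"
    unfolding power2_eq_square
    by (intro sum_mono mult_left_mono mult_right_mono) (auto simp: assms q_nonneg score_nonneg)
  also have "\<dots> = b * (\<Sum>j<p. q j * score k j)"
    by (simp add: sum_distrib_left mult_ac)
  also have "\<dots> \<le> b * 1"
    using b leak_nonneg[OF assms(1)] by (intro mult_left_mono) (auto simp: sum_q_score assms)
  finally show ?thesis by simp
qed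

lemma pert_scale: "pert (\<lambda>k. c * v k) j = c * pert v j"
  by (simp add: pert_def sum_distrib_left mult_ac)

lemma pert_add: "pert (\<lambda>k. v k + w k) j = pert v j + pert w j"
  by (simp add: pert_def distrib_right sum.distrib)

lemma pert_outside: "j < p \<Longrightarrow> j \<notin> J \<Longrightarrow> pert v j = 0"
  by (simp add: pert_def score_outside)

lemma q_pert: "j \<in> J \<Longrightarrow> q j * pert v j = mat_vec K A v j"
  by (auto simp: pert_def mat_vec_def score_def J_iff sum_distrib_left intro!: sum.cong)

lemma sum_q_abs_le_qnorm: "(\<Sum>j<p. q j * \<bar>f j\<bar>) \<le> qnorm f"
  using sum_mult_le_sqrt[of "{..<p}" q f "\<lambda>_. 1"] by (simp add: qnorm_def q_nonneg q_sum)

lemma qnorm_nonneg: "0 \<le> qnorm f"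
  by (auto simp: qnorm_def intro!: sum_nonneg mult_nonneg_nonneg q_nonneg)

lemma qnorm_square: "(qnorm f)\<^sup>2 = (\<Sum>j<p. q j * (f j)\<^sup>2)"
  by (auto simp: qnorm_def intro!: sum_nonneg mult_nonneg_nonneg q_nonneg)

lemma qnorm_scale: "0 \<le> c \<Longrightarrow> qnorm (\<lambda>j. c * f j) = c * qnorm f"
  by (simp add: qnorm_def power_mult_distrib mult.left_commute[of _ "c\<^sup>2"]
      sum_distrib_left[symmetric] real_sqrt_mult)

subsection \<open>Restricted condition numbers\<close>

lemma kappa_bdd:
  "bdd_below {l1_on U (mat_vec K A v) / l1 v | S v. S \<subseteq> {..<K} \<and> card S \<le> s \<and> v \<in> cone K S}"
  by (rule bdd_belowI[of _ 0]) (auto simp: l1_on_def intro!: divide_nonneg_nonneg sum_nonneg)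

lemma kappa_le_1:
  assumes "U \<subseteq> {..<p}"
  shows "kappa U K A s \<le> 1"
proof -
  define v :: "nat \<Rightarrow> real" where "v k = (if k = 0 then 1 else 0)" for k
  have Av: "mat_vec K A v j = A j 0" for j
    using K_pos sum.delta[of "{..<K}" 0 "\<lambda>k. A j k"]
    by (simp add: mat_vec_def v_def if_distrib[of "\<lambda>y. _ * y"] cong: if_cong)
  have v1: "l1 v = 1" using K_pos by (simp add: l1_on_def v_def if_distrib[of abs] cong: if_cong)
  have "v \<in> cone K {0}" using K_pos by (auto simp: cone_def l1_on_def v_def)
  then have "kappa U K A s \<le> l1_on U (mat_vec K A v) / l1 v"
    unfolding kappa_def using K_pos s_pos
    by (intro cInf_lower kappa_bdd) (auto intro!: exI[of _ "{0}"] exI[of _ v])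
  also have "\<dots> = (\<Sum>j\<in>U. A j 0)"
    unfolding v1 Av using assms K_pos
    by (auto simp: l1_on_def intro!: sum.cong abs_of_nonneg A_nonneg)
  also have "\<dots> \<le> (\<Sum>j<p. A j 0)"
    using assms K_pos by (intro sum_mono2) (auto intro: A_nonneg)
  finally show ?thesis using K_pos by (simp add: A_sum)
qed

text \<open>The cone for the set \<open>S\<close> alone, with the zero vector admitted.\<close>

definition in_cone :: "(nat \<Rightarrow> real) \<Rightarrow> bool" where
  "in_cone v \<longleftrightarrow> l1_on Sc v \<le> l1_on S v"

lemma l1_split: "l1 v = l1_on S v + l1_on Sc v"
  unfolding l1_on_def by (rule sum_split_S)

lemma l1_nonneg: "0 \<le> l1_on U v"
  by (auto simp: l1_on_def intro!: sum_nonneg)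

lemma kappa_l1_le:
  assumes v: "in_cone v" and U: "U \<subseteq> J"
  shows "kappa U K A s * l1 v \<le> (\<Sum>j\<in>U. q j * \<bar>pert v j\<bar>)"
proof (cases "\<exists>k<K. v k \<noteq> 0")
  case True
  then obtain k where k: "k < K" "v k \<noteq> 0" by auto
  have "\<bar>v k\<bar> \<le> l1 v"
    unfolding l1_on_def using k by (intro member_le_sum) auto
  then have pos: "0 < l1 v" using k by simp
  have "v \<in> cone K S" using v True by (simp add: cone_def in_cone_def)
  then have "kappa U K A s \<le> l1_on U (mat_vec K A v) / l1 v"
    unfolding kappa_def using S_sub card_S
    by (intro cInf_lower kappa_bdd) (auto intro!: exI[of _ S] exI[of _ v])
  then have "kappa U K A s * l1 v \<le> l1_on U (mat_vec K A v)"
    using pos by (simp add: field_simps)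
  also have "\<dots> = (\<Sum>j\<in>U. q j * \<bar>pert v j\<bar>)"
    unfolding l1_on_def
  proof (intro sum.cong refl)
    fix j assume "j \<in> U"
    then have "j \<in> J" using U by auto
    then show "\<bar>mat_vec K A v j\<bar> = q j * \<bar>pert v j\<bar>"
      by (subst q_pert[symmetric]) (auto simp: J_iff abs_mult)
  qed
  finally show ?thesis .
next
  case False
  then have "l1 v = 0" by (auto simp: l1_on_def)
  then show ?thesis using U q_nonneg by (auto intro!: sum_nonneg mult_nonneg_nonneg simp: J_iff subset_iff)
qed

lemma kappa_J_l1_le:
  assumes "in_cone v"
  shows "kappa J K A s * l1 v \<le> qnorm (pert v)"
proof -
  have "kappa J K A s * l1 v \<le> (\<Sum>j\<in>J. q j * \<bar>pert v j\<bar>)"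
    by (rule kappa_l1_le[OF assms]) simp
  also have "\<dots> \<le> (\<Sum>j<p. q j * \<bar>pert v j\<bar>)"
    using J_sub by (intro sum_mono2) (auto simp: q_nonneg)
  also have "\<dots> \<le> qnorm (pert v)" by (rule sum_q_abs_le_qnorm)
  finally show ?thesis .
qed

subsection \<open>Directions of ascent of the likelihood\<close>

text \<open>The estimation error is used only through these properties; they involve neither the maximiser
  nor the value \<open>-\<infinity>\<close> of the log-likelihood.\<close>

definition ascent :: "(nat \<Rightarrow> real) \<Rightarrow> (nat \<Rightarrow> real) \<Rightarrow> bool" where
  "ascent x v \<longleftrightarrow> (\<forall>k\<in>Sc. 0 \<le> v k) \<and> (\<Sum>k<K. v k) = 0 \<and>
    (\<forall>j<p. x j > 0 \<longrightarrow> pert v j > -1) \<and> 0 \<le> (\<Sum>j<p. x j * ln (1 + pert v j))"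

lemma data_nonneg: "x \<in> set_pmf law \<Longrightarrow> 0 \<le> x j"
  and data_sum: "x \<in> set_pmf law \<Longrightarrow> (\<Sum>j<p. x j) = 1"
  and data_pos: "x \<in> set_pmf law \<Longrightarrow> x j > 0 \<Longrightarrow> j \<in> J"
  using set_pmf_freqD[OF q_simplex N_pos, of x] by (auto simp: J_iff)

text \<open>By concavity of the logarithm, so that an error may be shrunk until a quadratic expansion
  applies.\<close>

lemma ascent_scale:
  assumes x: "x \<in> set_pmf law" and v: "ascent x v" and c: "0 \<le> c" "c \<le> 1"
  shows "ascent x (\<lambda>k. c * v k)"
proof -
  have low: "c * y > -1" if "y > -1" for y :: real
  proof (cases "y \<ge> 0")
    case True
    then show ?thesis using c mult_nonneg_nonneg[of c y] by linarith
  next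
    case False
    then have "1 * y \<le> c * y" using c by (intro mult_right_mono_neg) auto
    then show ?thesis using that by simp
  qed
  have ln: "c * ln (1 + y) \<le> ln (1 + c * y)" if "y > -1" for y :: real
  proof -
    have "(1 - c) * ln 1 + c * ln (1 + y) \<le> ln ((1 - c) *\<^sub>R 1 + c *\<^sub>R (1 + y))"
      using that c ln_concave by (intro concave_onD[where A = "{0<..}"]) auto
    then show ?thesis by (simp add: algebra_simps)
  qed
  have "0 \<le> c * (\<Sum>j<p. x j * ln (1 + pert v j))"
    using v c by (auto simp: ascent_def intro!: mult_nonneg_nonneg)
  also have "\<dots> = (\<Sum>j<p. x j * (c * ln (1 + pert v j)))"
    by (simp add: sum_distrib_left mult_ac)
  also have "\<dots> \<le> (\<Sum>j<p. x j * ln (1 + c * pert v j))"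
  proof (rule sum_mono)
    fix j assume j: "j \<in> {..<p}"
    show "x j * (c * ln (1 + pert v j)) \<le> x j * ln (1 + c * pert v j)"
    proof (cases "x j > 0")
      case True
      then show ?thesis using v j by (intro mult_left_mono ln) (auto simp: ascent_def)
    next
      case False
      then have "x j = 0" using data_nonneg[OF x, of j] by simp
      then show ?thesis by simp
    qed
  qed
  finally show ?thesis
    using v c low by (auto simp: ascent_def pert_scale sum_distrib_left[symmetric] intro!: mult_nonneg_nonneg)
qed

lemma l1_Sc_ascent: "ascent x v \<Longrightarrow> l1_on Sc v = (\<Sum>k\<in>Sc. v k)"
  by (auto simp: l1_on_def ascent_def intro!: sum.cong)

text \<open>Mass moved to inactive topics has been taken from active ones.  This is why the restricted condition
  number applies to the error without any tuning or sparsity of the estimator.\<close>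

lemma ascent_in_cone:
  assumes "ascent x v"
  shows "in_cone v"
proof -
  have "l1_on Sc v = - (\<Sum>k\<in>S. v k)"
    using assms sum_split_S[of v] l1_Sc_ascent[OF assms] by (auto simp: ascent_def)
  also have "\<dots> \<le> l1_on S v"
    unfolding l1_on_def using sum_abs[of v S] by linarith
  finally show ?thesis by (simp add: in_cone_def)
qed

text \<open>Every coordinate observed has positive probability under \<open>T\<^sub>*\<close>; hence the log-likelihood at \<open>T\<^sub>*\<close> is
  finite, and so is the one at the maximiser.\<close>

lemma ascent_mle:
  assumes x: "x \<in> set_pmf law" and T': "is_mle p K A x T'"
  shows "ascent x (\<lambda>k. T' k - T k)"
proof -
  let ?X = "{j. j < p \<and> x j > 0}"
  let ?q' = "mat_vec K A T'"
  have fin: "finite ?X" by simp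
  have T'_s: "T' \<in> prob_simplex K" and "\<not> (\<exists>y\<in>prob_simplex K. log_lik p K A x y > log_lik p K A x T')"
    using T' by (auto simp: is_mle_def is_arg_max_def)
  moreover have "T \<in> prob_simplex K" using T_sparse by (simp add: sparse_simplex_def)
  ultimately have le: "log_lik p K A x T \<le> log_lik p K A x T'" by (auto simp: not_less)
  have qpos: "q j > 0" if "j \<in> ?X" for j using data_pos[OF x, of j] that by (auto simp: J_iff)
  have LT: "log_lik p K A x T = ereal (\<Sum>j\<in>?X. x j * ln (q j))"
    unfolding log_lik_def sum_ereal[symmetric] using qpos by (intro sum.cong) (auto simp: ext_ln_def)
  have q'pos: "?q' j > 0" if j: "j \<in> ?X" for j
  proof (rule ccontr)
    assume n: "\<not> ?q' j > 0"
    have "log_lik p K A x T' = -\<infinity>"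
    proof -
      have "(\<Sum>i\<in>?X. ereal (x i) * ext_ln (?q' i)) = ereal (x j) * ext_ln (?q' j)
          + (\<Sum>i\<in>?X - {j}. ereal (x i) * ext_ln (?q' i))"
        by (rule sum.remove[OF fin j])
      moreover have "ereal (x j) * ext_ln (?q' j) = -\<infinity>" using j n by (auto simp: ext_ln_def)
      moreover have "(\<Sum>i\<in>?X - {j}. ereal (x i) * ext_ln (?q' i)) \<noteq> \<infinity>"
        by (subst sum_Pinfty) (auto simp: ext_ln_def)
      ultimately show ?thesis by (simp add: log_lik_def)
    qed
    then show False using le LT by simp
  qed
  have LT': "log_lik p K A x T' = ereal (\<Sum>j\<in>?X. x j * ln (?q' j))"
    unfolding log_lik_def sum_ereal[symmetric] using q'pos by (intro sum.cong) (auto simp: ext_ln_def)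
  let ?v = "\<lambda>k. T' k - T k"
  have pert: "1 + pert ?v j = ?q' j / q j" if "j \<in> ?X" for j
  proof -
    have "q j * pert ?v j = ?q' j - q j"
      using q_pert[of j ?v] data_pos[OF x, of j] that
      by (simp add: mat_vec_def right_diff_distrib sum_subtractf)
    then show ?thesis using qpos[OF that] by (simp add: field_simps)
  qed
  have "(\<Sum>j\<in>?X. x j * ln (q j)) \<le> (\<Sum>j\<in>?X. x j * ln (?q' j))" using le LT LT' by simp
  also have "\<dots> = (\<Sum>j\<in>?X. x j * ln (q j)) + (\<Sum>j\<in>?X. x j * ln (1 + pert ?v j))"
    unfolding sum.distrib[symmetric]
  proof (intro sum.cong refl)
    fix j assume j: "j \<in> ?X"
    have "ln (1 + pert ?v j) = ln (?q' j) - ln (q j)"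
      unfolding pert[OF j] by (rule ln_divide_pos[OF q'pos[OF j] qpos[OF j]])
    then show "x j * ln (?q' j) = x j * ln (q j) + x j * ln (1 + pert ?v j)"
      by (simp add: right_diff_distrib)
  qed
  finally have "0 \<le> (\<Sum>j\<in>?X. x j * ln (1 + pert ?v j))" by simp
  also have "\<dots> = (\<Sum>j<p. x j * ln (1 + pert ?v j))"
  proof (rule sum.mono_neutral_left)
    show "\<forall>j\<in>{..<p} - ?X. x j * ln (1 + pert ?v j) = 0"
    proof
      fix j assume "j \<in> {..<p} - ?X"
      then have "x j = 0" using data_nonneg[OF x, of j] by auto
      then show "x j * ln (1 + pert ?v j) = 0" by simp
    qed
  qed auto
  finally have "0 \<le> (\<Sum>j<p. x j * ln (1 + pert ?v j))" .
  moreover have "pert ?v j > -1" if "j < p" "x j > 0" for j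
    using pert[of j] q'pos[of j] qpos[of j] that by (smt (verit, best) divide_pos_pos mem_Collect_eq)
  moreover have "0 \<le> T' k - T k" if "k \<in> Sc" for k
    using that T'_s by (auto simp: supp_def prob_simplex_def)
  moreover have "(\<Sum>k<K. T' k - T k) = 0"
    using T'_s T_sum by (simp add: sum_subtractf prob_simplex_def)
  ultimately show ?thesis by (auto simp: ascent_def)
qed

text \<open>The estimation error is a direction of ascent of norm at most \<open>2\<close>; hence this event contains the
  event that the estimation error exceeds \<open>y\<close>, whatever maximiser is selected.\<close>

definition far :: "(nat \<Rightarrow> real) \<Rightarrow> real \<Rightarrow> bool" where
  "far x y \<longleftrightarrow> (\<exists>v. ascent x v \<and> l1 v \<le> 2 \<and> y < l1 v)"

lemma far_mono: "far x y \<Longrightarrow> y' \<le> y \<Longrightarrow> far x y'"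
  by (force simp: far_def)

lemma not_far: "2 \<le> y \<Longrightarrow> \<not> far x y"
  by (auto simp: far_def)

lemma sum_x_score: "k < K \<Longrightarrow> (\<Sum>j<p. x j * score k j) = Z x k + 1 - leak k"
  using sum_q_score[of k] by (simp add: Z_def left_diff_distrib sum_subtractf)

text \<open>The linear part of the likelihood is noise minus the mass that the direction puts on rows never
  observed, because the entries of a direction sum to zero.\<close>

lemma sum_x_pert:
  assumes "(\<Sum>k<K. v k) = 0"
  shows "(\<Sum>j<p. x j * pert v j) = (\<Sum>k\<in>S. v k * Z x k) + (\<Sum>k\<in>Sc. v k * (Z x k - leak k))"
proof -
  have "(\<Sum>j<p. x j * pert v j) = (\<Sum>k<K. v k * (\<Sum>j<p. x j * score k j))"
    unfolding pert_def sum_distrib_left by (subst sum.swap) (simp add: mult_ac)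
  also have "\<dots> = (\<Sum>k<K. v k * (Z x k - leak k)) + (\<Sum>k<K. v k)"
    unfolding sum.distrib[symmetric] by (intro sum.cong) (auto simp: sum_x_score algebra_simps)
  also have "(\<Sum>k<K. v k * (Z x k - leak k))
      = (\<Sum>k\<in>S. v k * Z x k) + (\<Sum>k\<in>Sc. v k * (Z x k - leak k))"
    by (simp add: sum_split_S leak_S)
  finally show ?thesis using assms by simp
qed

lemma error_le_2:
  assumes "T' \<in> prob_simplex K"
  shows "error K T T' \<le> 2"
proof -
  have "error K T T' \<le> (\<Sum>k<K. T' k + T k)"
    unfolding error_def l1_on_def using assms T_nonneg
    by (intro sum_mono) (force simp: prob_simplex_def abs_le_iff)
  also have "\<dots> = 2" using assms T_sum by (simp add: sum.distrib prob_simplex_def)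
  finally show ?thesis .
qed

end

section \<open>Stochastic order along a sequence\<close>

lemma prob_mono_on_support:
  assumes "\<And>x. x \<in> set_pmf P \<Longrightarrow> Q x \<Longrightarrow> R x"
  shows "measure_pmf.prob P {x. Q x} \<le> measure_pmf.prob P {x. R x}"
  by (rule measure_pmf.finite_measure_mono_AE) (use assms in \<open>auto simp: AE_measure_pmf_iff\<close>)

lemma prob_disj_le:
  "measure_pmf.prob P {x. Q x \<or> R x} \<le> measure_pmf.prob P {x. Q x} + measure_pmf.prob P {x. R x}"
  using measure_Un_le[of "{x. Q x}" "measure_pmf P" "{x. R x}"]
  by (simp add: Collect_disj_eq)

lemma prob_Bex_le:
  assumes "finite I" and "\<And>i. i \<in> I \<Longrightarrow> measure_pmf.prob P {x. Q i x} \<le> e i"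
  shows "measure_pmf.prob P {x. \<exists>i\<in>I. Q i x} \<le> (\<Sum>i\<in>I. e i)"
proof -
  have "{x. \<exists>i\<in>I. Q i x} = (\<Union>i\<in>I. {x. Q i x})" by auto
  then have "measure_pmf.prob P {x. \<exists>i\<in>I. Q i x} \<le> (\<Sum>i\<in>I. measure_pmf.prob P {x. Q i x})"
    using measure_pmf.finite_measure_subadditive_finite[OF assms(1), of "\<lambda>i. {x. Q i x}" P] by simp
  also have "\<dots> \<le> (\<Sum>i\<in>I. e i)" by (intro sum_mono assms)
  finally show ?thesis .
qed

text \<open>Boundedness in probability is required at every index, but the hypotheses on a sequence are
  asymptotic; as the error is bounded, finitely many instances are absorbed by the constant.\<close>

lemma bigo_prob_eventually:
  assumes ev: "\<And>\<epsilon>. \<epsilon> > 0 \<Longrightarrow> \<exists>B. eventually (\<lambda>m. measure_pmf.prob (P m) {x. Z m x > B * a m} \<le> \<epsilon>) sequentially"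
    and a: "\<And>m. a m > 0"
    and b: "\<And>m x. x \<in> set_pmf (P m) \<Longrightarrow> 0 \<le> Z m x \<and> Z m x \<le> b"
  shows "bigo_prob P Z a"
  unfolding bigo_prob_def
proof (intro allI impI)
  fix \<epsilon> :: real assume e: "\<epsilon> > 0"
  obtain B m0 where B: "\<And>m. m \<ge> m0 \<Longrightarrow> measure_pmf.prob (P m) {x. Z m x > B * a m} \<le> \<epsilon>"
    using ev[OF e] by (auto simp: eventually_sequentially)
  define B' where "B' = Max (insert B ((\<lambda>m. b / a m) ` {..<m0}))"
  have B'1: "B \<le> B'" and B'2: "\<And>m. m < m0 \<Longrightarrow> b / a m \<le> B'" by (auto simp: B'_def intro!: Max_ge)
  have "measure_pmf.prob (P m) {x. \<bar>Z m x / a m\<bar> > B'} \<le> \<epsilon>" for m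
  proof (cases "m < m0")
    case True
    have "measure_pmf.prob (P m) {x. \<bar>Z m x / a m\<bar> > B'} \<le> measure_pmf.prob (P m) {x. False}"
    proof (rule prob_mono_on_support)
      fix x assume x: "x \<in> set_pmf (P m)" and gt: "\<bar>Z m x / a m\<bar> > B'"
      have "\<bar>Z m x / a m\<bar> = Z m x / a m" using b[OF x] a[of m] by simp
      also have "\<dots> \<le> b / a m" using b[OF x] a[of m] by (intro divide_right_mono) auto
      finally show False using gt B'2[OF True] by simp
    qed
    then show ?thesis using e by simp
  next
    case False
    have "measure_pmf.prob (P m) {x. \<bar>Z m x / a m\<bar> > B'} \<le> measure_pmf.prob (P m) {x. Z m x > B * a m}"
    proof (rule prob_mono_on_support)
      fix x assume x: "x \<in> set_pmf (P m)" and gt: "\<bar>Z m x / a m\<bar> > B'"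
      have "\<bar>Z m x / a m\<bar> = Z m x / a m" using b[OF x] a[of m] by simp
      then have "B < Z m x / a m" using gt B'1 by simp
      then show "Z m x > B * a m" using a[of m] by (simp add: field_simps)
    qed
    then show ?thesis using B[of m] False by simp
  qed
  then show "\<exists>B. \<forall>m. measure_pmf.prob (P m) {x. \<bar>Z m x / a m\<bar> > B} \<le> \<epsilon>" by blast
qed

lemma trivial_bound_small_sample:
  fixes w n N0 B :: real
  assumes "0 < w0" "w0 \<le> w" "0 < n" "n \<le> N0" "2 * sqrt (N0 / w0) \<le> B"
  shows "2 \<le> B * sqrt (w / n)"
proof -
  have "2 = 2 * sqrt (N0 / w0) * sqrt (w0 / N0)"
    using assms by (simp add: real_sqrt_divide)
  also have "\<dots> \<le> B * sqrt (w / n)"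
    using assms by (intro mult_mono real_sqrt_le_mono frac_le) (auto intro: order.trans[rotated])
  finally show ?thesis .
qed

text \<open>Union bounds over \<open>K\<^sup>a\<close> events: since \<open>K\<close> may stay bounded, smallness comes from the constant \<open>m\<close>
  in the exponent.\<close>

lemma pow_mult_exp_le:
  assumes K: "2 \<le> (K::nat)" and E: "E \<ge> (real m + real a) * ln (real K)"
  shows "real K ^ a * exp (- E) \<le> 1 / 2 ^ m"
proof -
  have "exp (- E) \<le> exp (- ((real m + real a) * ln (real K)))" using E by simp
  also have "\<dots> = 1 / real K ^ (m + a)"
    using K exp_of_nat_mult[of "m + a" "ln (real K)"] by (simp add: exp_minus inverse_eq_divide)
  finally have "real K ^ a * exp (- E) \<le> real K ^ a * (1 / real K ^ (m + a))"
    by (intro mult_left_mono) auto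
  also have "\<dots> = 1 / real K ^ m" using K by (simp add: power_add)
  also have "\<dots> \<le> 1 / 2 ^ m" using K by (intro divide_left_mono power_mono) auto
  finally show ?thesis .
qed

section \<open>Noise in the slow rate\<close>

context topic_instance
begin

lemma Z_upper_tail:
  assumes "k < K" "0 < b" "\<And>j. j < p \<Longrightarrow> score k j \<le> b" "0 < \<tau>"
  shows "Pr {x. Z x k > \<tau>} \<le> exp (- (real N * min (\<tau>\<^sup>2 / (4 * b)) (\<tau> / (2 * b))))"
  unfolding Z_def
  by (rule freq_bernstein[OF q_simplex N_pos])
     (use assms sum_q_score_square[OF assms(1,3)] in auto)

lemma Z_lower_tail:
  assumes "k < K" "0 < b" "\<And>j. j < p \<Longrightarrow> score k j \<le> b" "0 < \<tau>"
  shows "Pr {x. - Z x k > \<tau>} \<le> exp (- (real N * min (\<tau>\<^sup>2 / (4 * b)) (\<tau> / (2 * b))))"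
proof -
  have "- Z x k = (\<Sum>j<p. (x j - q j) * (- score k j))" for x
    by (simp add: Z_def sum_negf)
  then show ?thesis
    using freq_bernstein[OF q_simplex N_pos, of b "\<lambda>j. - score k j" b \<tau>]
      assms sum_q_score_square[OF assms(1,3)] score_nonneg[OF _ assms(1)] by force
qed

lemma ln_K_pos: "0 < ln (real K)"
  using K_ge_2 by simp

lemma Z_max_tail:
  assumes "I \<subseteq> {..<K}" "0 < b" "\<And>k j. k \<in> I \<Longrightarrow> j < p \<Longrightarrow> score k j \<le> b" "0 < \<tau>"
    and "real N * min (\<tau>\<^sup>2 / (4 * b)) (\<tau> / (2 * b)) \<ge> (real m + 1) * ln (real K)"
  shows "Pr {x. \<exists>k\<in>I. Z x k > \<tau>} \<le> 1 / 2 ^ m"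
    and "Pr {x. \<exists>k\<in>I. - Z x k > \<tau>} \<le> 1 / 2 ^ m"
proof -
  define E where "E = real N * min (\<tau>\<^sup>2 / (4 * b)) (\<tau> / (2 * b))"
  have fin: "finite I" using assms(1) finite_subset by blast
  have "card I \<le> K" using card_mono[OF _ assms(1)] by simp
  then have "(\<Sum>k\<in>I. exp (- E)) \<le> real K * exp (- E)" by simp
  also have "\<dots> \<le> 1 / 2 ^ m"
    using pow_mult_exp_le[OF K_ge_2, of m 1 E] assms(5) by (simp add: E_def)
  finally have *: "(\<Sum>k\<in>I. exp (- E)) \<le> 1 / 2 ^ m" .
  have "Pr {x. \<exists>k\<in>I. Z x k > \<tau>} \<le> (\<Sum>k\<in>I. exp (- E))"
    unfolding E_def using assms by (intro prob_Bex_le fin Z_upper_tail) auto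
  then show "Pr {x. \<exists>k\<in>I. Z x k > \<tau>} \<le> 1 / 2 ^ m" using * by linarith
  have "Pr {x. \<exists>k\<in>I. - Z x k > \<tau>} \<le> (\<Sum>k\<in>I. exp (- E))"
    unfolding E_def using assms by (intro prob_Bex_le fin Z_lower_tail) auto
  then show "Pr {x. \<exists>k\<in>I. - Z x k > \<tau>} \<le> 1 / 2 ^ m" using * by linarith
qed

text \<open>The threshold \<open>1/8\<close> makes the exponent \<open>49/256 > 3/16\<close>.  With \<open>N \<Pi>\<^sub>*\<^sub>j \<ge> 16 log p\<close> the probability is
  at most \<open>p\<^sup>-\<^sup>3\<close>, which survives a union bound over the \<open>p\<close> rows.\<close>

lemma cell_lower_tail:
  assumes j: "j \<in> J"
  shows "Pr {x. x j < q j / 8} \<le> exp (- (3 / 16 * (real N * q j)))"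
proof -
  have q: "q j > 0" and jp: "j < p" using j by (auto simp: J_iff)
  let ?h = "\<lambda>i. if i = j then - 1 else (0::real)"
  have sums: "(\<Sum>i<p. q i * (?h i)\<^sup>2) = q j"
    using jp sum.delta[of "{..<p}" j q] by (simp add: if_distrib[of power2] if_distrib[of "\<lambda>y. _ * y"] cong: if_cong)
  have lin: "(\<Sum>i<p. (x i - q i) * ?h i) = q j - x j" for x
    using jp sum.delta[of "{..<p}" j "\<lambda>i. q i - x i"] by (simp add: if_distrib[of "\<lambda>y. _ * y"] cong: if_cong)
  have "Pr {x. (\<Sum>i<p. (x i - q i) * ?h i) > 7 / 8 * q j}
      \<le> exp (- (real N * min ((7 / 8 * q j)\<^sup>2 / (4 * q j)) (7 / 8 * q j / (2 * 1))))"
    by (rule freq_bernstein[OF q_simplex N_pos]) (use q sums in auto)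
  also have "{x. (\<Sum>i<p. (x i - q i) * ?h i) > 7 / 8 * q j} = {x. x j < q j / 8}"
    unfolding lin by auto
  also have "exp (- (real N * min ((7 / 8 * q j)\<^sup>2 / (4 * q j)) (7 / 8 * q j / (2 * 1))))
      \<le> exp (- (real N * (3 / 16 * q j)))"
    using q by (simp add: power2_eq_square)
  finally show ?thesis by (simp add: mult_ac)
qed

lemma J_under_sub: "J_under p N q \<subseteq> J"
proof
  fix j assume "j \<in> J_under p N q"
  moreover have "0 \<le> eps p N q j" if "j < p"
    unfolding eps_def using that q_nonneg[of j] K_less
    by (intro add_nonneg_nonneg mult_nonneg_nonneg divide_nonneg_nonneg real_sqrt_ge_zero) auto
  ultimately show "j \<in> J" by (auto simp: J_under_def J_iff)
qed

lemma J_under_large: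
  assumes "j \<in> J_under p N q"
  shows "16 * ln (real p) \<le> real N * q j"
proof -
  have j: "j < p" "q j > 2 * eps p N q j" "q j > 0"
    using assms J_under_sub by (auto simp: J_under_def J_iff)
  have lp: "0 \<le> ln (real p)" using K_less by simp
  have "4 * sqrt (q j * ln (real p) / real N) \<le> 2 * eps p N q j"
    using lp by (simp add: eps_def)
  then have "4 * sqrt (q j * ln (real p) / real N) \<le> q j" using j by simp
  then have "(4 * sqrt (q j * ln (real p) / real N))\<^sup>2 \<le> (q j)\<^sup>2"
    using lp j by (intro power_mono) auto
  then have "16 * (q j * ln (real p) / real N) \<le> q j * q j"
    using lp j by (simp add: power_mult_distrib power2_eq_square)
  then have "q j * (16 * ln (real p)) \<le> q j * (real N * q j)"
    using N_pos by (simp add: field_simps)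
  then show ?thesis using j(3) by simp
qed

lemma pert_abs_le:
  assumes "j < p" and "\<And>k. k < K \<Longrightarrow> score k j \<le> L"
  shows "\<bar>pert v j\<bar> \<le> L * l1 v"
proof -
  have "\<bar>pert v j\<bar> \<le> (\<Sum>k<K. \<bar>v k * score k j\<bar>)"
    unfolding pert_def by (rule sum_abs)
  also have "\<dots> \<le> (\<Sum>k<K. L * \<bar>v k\<bar>)"
    using assms score_nonneg[OF assms(1)]
    by (intro sum_mono) (simp add: abs_mult mult.commute[of L] mult_left_mono)
  finally show ?thesis by (simp add: l1_on_def sum_distrib_left)
qed

lemma sum_q_abs_pert_le:
  assumes "U \<subseteq> J"
  shows "(\<Sum>j\<in>U. q j * \<bar>pert v j\<bar>) \<le> l1 v"
proof -
  have "(\<Sum>j\<in>U. q j * \<bar>pert v j\<bar>) \<le> (\<Sum>j<p. q j * \<bar>pert v j\<bar>)"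
    using assms J_sub by (intro sum_mono2) (auto simp: q_nonneg)
  also have "\<dots> \<le> (\<Sum>j<p. \<Sum>k<K. \<bar>v k\<bar> * (q j * score k j))"
  proof (intro sum_mono)
    fix j assume "j \<in> {..<p}"
    then have jp: "j < p" by simp
    have "\<bar>pert v j\<bar> \<le> (\<Sum>k<K. \<bar>v k * score k j\<bar>)" unfolding pert_def by (rule sum_abs)
    also have "\<dots> = (\<Sum>k<K. \<bar>v k\<bar> * score k j)"
      using score_nonneg[OF jp] by (intro sum.cong) (auto simp: abs_mult)
    finally show "q j * \<bar>pert v j\<bar> \<le> (\<Sum>k<K. \<bar>v k\<bar> * (q j * score k j))"
      using mult_left_mono[OF _ q_nonneg[OF jp]] by (fastforce simp: sum_distrib_left mult_ac)
  qed
  also have "\<dots> = (\<Sum>k<K. \<bar>v k\<bar> * (1 - leak k))"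
    by (subst sum.swap) (simp add: sum_distrib_left[symmetric] sum_q_score)
  also have "\<dots> \<le> (\<Sum>k<K. \<bar>v k\<bar> * 1)"
    using leak_nonneg by (intro sum_mono mult_left_mono) auto
  finally show ?thesis by (simp add: l1_on_def)
qed

text \<open>On the likelihood side, the logarithmic inequality turns ascent into the bound \<open>2 \<tau> \<parallel>v\<parallel>\<^sub>1\<close> on the
  empirical weighted sum of \<open>e\<^sup>2 / (2 + e)\<close>, where \<open>e = pert v\<close>.  By the Cauchy-Schwarz inequality this
  sum dominates the square of the \<open>\<ell>\<^sub>1\<close> norm of \<open>A v\<close> over rows whose frequency is not much smaller than
  its mean, and that norm is at least \<open>\<kappa> \<parallel>v\<parallel>\<^sub>1\<close>.  One factor \<open>\<parallel>v\<parallel>\<^sub>1\<close> cancels.\<close>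

lemma slow_rate_deterministic:
  assumes x: "x \<in> set_pmf law" and v: "ascent x v" and v2: "l1 v \<le> 2"
    and U: "U \<subseteq> J" "\<And>j. j \<in> U \<Longrightarrow> q j / 8 \<le> x j"
    and Z: "\<And>k. k < K \<Longrightarrow> \<bar>Z x k\<bar> \<le> \<tau>"
    and \<kappa>: "0 < \<kappa>" "\<kappa> * l1 v \<le> (\<Sum>j\<in>U. q j * \<bar>pert v j\<bar>)"
  shows "l1 v \<le> 64 * \<tau> / \<kappa>\<^sup>2"
proof -
  define e where "e = pert v"
  define l where "l = l1 v"
  have l0: "0 \<le> l" unfolding l_def by (rule l1_nonneg)
  have \<tau>0: "0 \<le> \<tau>" using Z[OF K_pos] by linarith
  have xn: "\<And>j. 0 \<le> x j" using data_nonneg[OF x] .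
  have em: "e j > -1" if "j < p" "x j > 0" for j using v that by (auto simp: ascent_def e_def)
  have "(\<Sum>j<p. x j * e j) = (\<Sum>k\<in>S. v k * Z x k) + (\<Sum>k\<in>Sc. v k * (Z x k - leak k))"
    unfolding e_def using v by (intro sum_x_pert) (auto simp: ascent_def)
  also have "\<dots> \<le> (\<Sum>k\<in>S. \<bar>v k\<bar> * \<tau>) + (\<Sum>k\<in>Sc. \<bar>v k\<bar> * \<tau>)"
  proof (intro add_mono sum_mono)
    fix k assume "k \<in> S"
    then have "k < K" using S_sub by auto
    have "v k * Z x k \<le> \<bar>v k\<bar> * \<bar>Z x k\<bar>" by (simp add: abs_mult[symmetric])
    also have "\<dots> \<le> \<bar>v k\<bar> * \<tau>" using Z[OF \<open>k < K\<close>] by (intro mult_left_mono) auto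
    finally show "v k * Z x k \<le> \<bar>v k\<bar> * \<tau>" .
  next
    fix k assume k: "k \<in> Sc"
    have "v k \<ge> 0" using v k by (auto simp: ascent_def)
    moreover have "Z x k - leak k \<le> \<tau>" using Z[of k] leak_nonneg[of k] k by auto
    ultimately show "v k * (Z x k - leak k) \<le> \<bar>v k\<bar> * \<tau>" by (simp add: mult_left_mono)
  qed
  also have "\<dots> = \<tau> * l"
    unfolding l_def l1_on_def sum_split_S[of "\<lambda>k. \<bar>v k\<bar>"] by (simp add: sum_distrib_left algebra_simps)
  finally have lin: "(\<Sum>j<p. x j * e j) \<le> \<tau> * l" .
  have "0 \<le> (\<Sum>j<p. x j * ln (1 + e j))" using v by (simp add: ascent_def e_def)
  also have "\<dots> \<le> (\<Sum>j<p. x j * (e j - (e j)\<^sup>2 / (2 * (2 + e j))))"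
  proof (intro sum_mono)
    fix j assume "j \<in> {..<p}"
    then show "x j * ln (1 + e j) \<le> x j * (e j - (e j)\<^sup>2 / (2 * (2 + e j)))"
      using em[of j] xn[of j] ln_one_plus_le[of "e j"]
      by (cases "x j > 0") (auto simp del: distrib_left_numeral)
  qed
  also have "\<dots> = (\<Sum>j<p. x j * e j) - (\<Sum>j<p. x j * ((e j)\<^sup>2 / (2 + e j))) / 2"
    by (simp add: right_diff_distrib sum_subtractf sum_divide_distrib mult.commute[of 2]
        del: distrib_left_numeral distrib_right_numeral)
  finally have quad: "(\<Sum>j<p. x j * ((e j)\<^sup>2 / (2 + e j))) \<le> 2 * \<tau> * l" using lin by simp
  define B where "B = (\<Sum>j\<in>U. q j * \<bar>e j\<bar>)"
  have Up: "j < p" "q j > 0" "x j > 0" if "j \<in> U" for j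
  proof -
    have "j \<in> J" using that U(1) by blast
    then show "j < p" "q j > 0" by (auto simp: J_iff)
    then show "x j > 0" using U(2)[OF that] by linarith
  qed
  have B0: "0 \<le> B" unfolding B_def using Up by (intro sum_nonneg mult_nonneg_nonneg) (auto simp: less_imp_le)
  have Bl: "B \<le> l" unfolding B_def e_def l_def by (rule sum_q_abs_pert_le[OF U(1)])
  have "B = (\<Sum>j\<in>U. x j * (\<bar>e j / sqrt (2 + e j)\<bar> * \<bar>q j * sqrt (2 + e j) / x j\<bar>))"
    unfolding B_def
  proof (intro sum.cong refl)
    fix j assume j: "j \<in> U"
    then have "0 < sqrt (2 + e j)" using em[of j] Up[OF j] by simp
    then show "q j * \<bar>e j\<bar> = x j * (\<bar>e j / sqrt (2 + e j)\<bar> * \<bar>q j * sqrt (2 + e j) / x j\<bar>)"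
      using Up[OF j] by (simp add: abs_mult)
  qed
  also have "\<dots> \<le> sqrt (\<Sum>j\<in>U. x j * (e j / sqrt (2 + e j))\<^sup>2) * sqrt (\<Sum>j\<in>U. x j * (q j * sqrt (2 + e j) / x j)\<^sup>2)"
    by (intro sum_mult_le_sqrt xn)
  also have "\<dots> \<le> sqrt (2 * \<tau> * l) * sqrt 32"
  proof (intro mult_mono real_sqrt_le_mono)
    have "(\<Sum>j\<in>U. x j * (e j / sqrt (2 + e j))\<^sup>2) = (\<Sum>j\<in>U. x j * ((e j)\<^sup>2 / (2 + e j)))"
    proof (intro sum.cong refl)
      fix j assume "j \<in> U"
      then show "x j * (e j / sqrt (2 + e j))\<^sup>2 = x j * ((e j)\<^sup>2 / (2 + e j))"
        using em[of j] Up by (simp add: power_divide)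
    qed
    also have "\<dots> \<le> (\<Sum>j<p. x j * ((e j)\<^sup>2 / (2 + e j)))"
    proof (rule sum_mono2)
      fix j assume "j \<in> {..<p} - U"
      then show "0 \<le> x j * ((e j)\<^sup>2 / (2 + e j))"
        using em[of j] xn[of j] by (cases "x j > 0") auto
    qed (use Up in auto)
    also note quad
    finally show "(\<Sum>j\<in>U. x j * (e j / sqrt (2 + e j))\<^sup>2) \<le> 2 * \<tau> * l" .
    have "(\<Sum>j\<in>U. x j * (q j * sqrt (2 + e j) / x j)\<^sup>2) \<le> (\<Sum>j\<in>U. 8 * (q j * (2 + \<bar>e j\<bar>)))"
    proof (intro sum_mono)
      fix j assume j: "j \<in> U"
      have "x j * (q j * sqrt (2 + e j) / x j)\<^sup>2 = q j * (2 + e j) * (q j / x j)"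
        using em[of j] Up[OF j] by (simp add: power_divide power_mult_distrib power2_eq_square)
      also have "\<dots> \<le> q j * (2 + e j) * 8"
        using em[of j] Up[OF j] U(2)[OF j]
        by (intro mult_left_mono mult_nonneg_nonneg) (auto simp: divide_le_eq)
      also have "\<dots> \<le> 8 * (q j * (2 + \<bar>e j\<bar>))" using Up[OF j] by simp
      finally show "x j * (q j * sqrt (2 + e j) / x j)\<^sup>2 \<le> 8 * (q j * (2 + \<bar>e j\<bar>))" .
    qed
    also have "\<dots> = 8 * (2 * (\<Sum>j\<in>U. q j) + B)"
      by (simp add: B_def sum_distrib_left sum.distrib algebra_simps)
    also have "(\<Sum>j\<in>U. q j) \<le> (\<Sum>j<p. q j)"
      using Up by (intro sum_mono2) (auto simp: q_nonneg)
    finally show "(\<Sum>j\<in>U. x j * (q j * sqrt (2 + e j) / x j)\<^sup>2) \<le> 32"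
      using Bl v2 by (simp add: q_sum l_def)
  qed (use l0 \<tau>0 xn in \<open>auto intro!: sum_nonneg mult_nonneg_nonneg\<close>)
  finally have "B \<le> sqrt (2 * \<tau> * l) * sqrt 32" .
  then have "B\<^sup>2 \<le> (sqrt (2 * \<tau> * l) * sqrt 32)\<^sup>2" using B0 by (intro power_mono) auto
  then have "B\<^sup>2 \<le> 64 * \<tau> * l" using l0 \<tau>0 by (simp add: power_mult_distrib)
  moreover have "(\<kappa> * l)\<^sup>2 \<le> B\<^sup>2"
    using \<kappa> l0 unfolding B_def e_def l_def by (intro power_mono) auto
  ultimately have "l * (\<kappa>\<^sup>2 * l) \<le> l * (64 * \<tau>)" by (simp add: power_mult_distrib power2_eq_square mult_ac)
  then have "l = 0 \<or> \<kappa>\<^sup>2 * l \<le> 64 * \<tau>" using l0 by (cases "l = 0") auto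
  then show ?thesis using \<kappa>(1) \<tau>0 by (auto simp: l_def[symmetric] field_simps)
qed

end

section \<open>The slow rate\<close>

text \<open>The rows in \<open>J_under\<close> fail to have frequencies of the right order with probability up to
  \<open>p\<^sup>-\<^sup>2\<close>, which is not small if \<open>p\<close> is bounded.  In that case rows of mean count below a constant \<open>m\<^sub>1\<close>
  are discarded: for large \<open>N\<close> they carry at most half of the restricted condition number, and for
  bounded \<open>N\<close> the claim is trivial because the error never exceeds \<open>2\<close>.\<close>

lemma slow_rate_instance:
  fixes \<epsilon> \<kappa>0 \<Xi> D c :: real
  assumes e: "0 < \<epsilon>" and \<kappa>0: "0 < \<kappa>0" and \<Xi>: "1 \<le> \<Xi>" and D: "0 < D" and c: "0 < c" "c \<le> 1"
  shows "\<exists>B. \<forall>N p K s A T. topic_instance N p K s A T \<longrightarrow> c / real s \<le> T_min K T \<longrightarrow> xi p K A T \<le> \<Xi> \<longrightarrow>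
    \<kappa>0 \<le> kappa (J_under p N (mat_vec K A T)) K A s \<longrightarrow> real s * ln (real K) \<le> D * real N \<longrightarrow>
    measure_pmf.prob (freq_pmf p N (mat_vec K A T))
      {x. topic_instance.far p K A T x (B * sqrt (real s * ln (real K) / real N))} \<le> \<epsilon>"
proof -
  obtain m :: nat where m: "2 / \<epsilon> * 2 < 2 ^ m" using real_arch_pow[of 2 "2 / \<epsilon> * 2"] by auto
  \<comment> \<open>\<open>\<beta>\<close> scales the noise level so that both branches of the tail exponent reach \<open>(m + 1) log K\<close>;
      the factor \<open>1 + sqrt D\<close> serves the linear branch.\<close>
  define \<beta> where "\<beta> = 4 * \<Xi> / c * (real m + 1) * (1 + sqrt D)"
  define p0 where "p0 = 2 / \<epsilon>"
  define m1 where "m1 = 16 / 3 * (2 * p0 / \<epsilon>)"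
  \<comment> \<open>From \<open>N0\<close> on, at most \<open>p0\<close> discarded rows of mass below \<open>m1 / N\<close> contribute less than
      \<open>\<kappa>0 / 2\<close>.\<close>
  define N0 where "N0 = 2 * p0\<^sup>2 * m1 * \<Xi> / (c * \<kappa>0)"
  define B where "B = max (64 * \<beta> / (\<kappa>0 / 2)\<^sup>2) (2 * sqrt (N0 / ln 2))"
  have p0: "p0 > 0" and m1: "m1 > 0" and N0: "N0 > 0"
    using e \<Xi> c \<kappa>0 by (auto simp: p0_def m1_def N0_def)
  have Xc: "1 \<le> \<Xi> / c" using \<Xi> c by (simp add: field_simps)
  have "1 * 1 * 1 \<le> 4 * (\<Xi> / c) * (real m + 1) * (1 + sqrt D)"
    using Xc D \<Xi> c by (intro mult_mono) auto
  then have \<beta>ge1: "1 \<le> \<beta>" by (simp add: \<beta>_def)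
  show ?thesis
  proof (intro exI[of _ B] allI impI)
    fix N p K s A T
    assume inst: "topic_instance N p K s A T" and t: "c / real s \<le> T_min K T" and xi: "xi p K A T \<le> \<Xi>"
      and \<kappa>: "\<kappa>0 \<le> kappa (J_under p N (mat_vec K A T)) K A s" and sN: "real s * ln (real K) \<le> D * real N"
    interpret topic_instance N p K s A T by (rule inst)
    define rate where "rate = sqrt (real s * ln (real K) / real N)"
    define \<tau> where "\<tau> = \<beta> * rate"
    define L where "L = \<Xi> * real s / c"
    have sp: "real s > 0" and Np: "real N > 0" using s_pos N_pos by auto
    have ratepos: "rate > 0" unfolding rate_def using sp Np ln_K_pos by simp
    have Lpos: "L > 0" unfolding L_def using \<Xi> sp c by simp
    have tinv: "1 / tmin \<le> real s / c" using t tmin_pos sp c by (simp add: field_simps)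
    have score_L: "score k j \<le> L" if "k < K" "j < p" for k j
    proof (cases "k \<in> S")
      case True
      then have "score k j \<le> 1 / tmin" using that by (intro score_le_S)
      also have "\<dots> \<le> 1 * (real s / c)" using tinv by simp
      also have "\<dots> \<le> \<Xi> * (real s / c)" using \<Xi> sp c by (intro mult_right_mono) auto
      finally show ?thesis by (simp add: L_def)
    next
      case False
      then have "score k j \<le> ratio" using that by (intro score_le_Sc) auto
      also have "ratio = xi p K A T * (1 / tmin)" by (simp add: ratio_def)
      also have "\<dots> \<le> \<Xi> * (real s / c)" using tinv xi xi_nonneg tmin_pos \<Xi> by (intro mult_mono) auto
      finally show ?thesis by (simp add: L_def)
    qed
    have \<tau>pos: "\<tau> > 0" unfolding \<tau>_def using ratepos \<beta>ge1 by simp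
    have expo: "real N * min (\<tau>\<^sup>2 / (4 * L)) (\<tau> / (2 * L)) \<ge> (real m + 1) * ln (real K)"
    proof -
      have lK: "0 < ln (real K)" by (rule ln_K_pos)
      have "(real m + 1) * ln (real K) \<le> real N * (\<tau>\<^sup>2 / (4 * L))"
      proof -
        have "(real m + 1) * 1 \<le> (real m + 1) * (1 + sqrt D)" using D by (intro mult_left_mono) auto
        also have "\<dots> = \<beta> * (c / (4 * \<Xi>))" using \<Xi> c by (simp add: \<beta>_def)
        also have "\<dots> \<le> \<beta>\<^sup>2 * (c / (4 * \<Xi>))"
          using \<beta>ge1 \<Xi> c by (intro mult_right_mono) (auto simp: power2_eq_square)
        finally have "(real m + 1) * ln (real K) \<le> \<beta>\<^sup>2 * (c / (4 * \<Xi>)) * ln (real K)"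
          using lK by (intro mult_right_mono) auto
        also have "\<dots> = real N * (\<tau>\<^sup>2 / (4 * L))"
          unfolding \<tau>_def rate_def L_def using sp Np lK c \<Xi>
          by (simp add: power_mult_distrib field_simps)
        finally show ?thesis .
      qed
      moreover have "(real m + 1) * ln (real K) \<le> real N * (\<tau> / (2 * L))"
      proof -
        have rr: "ln (real K) / sqrt D \<le> real N * rate / real s"
        proof -
          have sq: "(ln (real K) / sqrt D)\<^sup>2 \<le> (real N * rate / real s)\<^sup>2"
          proof -
            have "(ln (real K) / sqrt D)\<^sup>2 = ln (real K) * ln (real K) / D"
              using D by (simp add: power_divide power2_eq_square)
            also have "\<dots> \<le> ln (real K) * (real N / real s)"
            proof -
              have "ln (real K) / D \<le> real N / real s" using sN D sp by (simp add: field_simps)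
              then have "ln (real K) * (ln (real K) / D) \<le> ln (real K) * (real N / real s)"
                using lK by (intro mult_left_mono) auto
              then show ?thesis by simp
            qed
            also have "\<dots> = (real N * rate / real s)\<^sup>2"
              unfolding rate_def using sp Np lK
              by (simp add: power_divide power_mult_distrib) (simp add: power2_eq_square)
            finally show ?thesis .
          qed
          show ?thesis by (rule power2_le_imp_le[OF sq]) (use ratepos Np sp in auto)
        qed
        have "(real m + 1) * 1 \<le> (real m + 1) * (2 * ((1 + sqrt D) / sqrt D))"
          using D by (intro mult_left_mono) (auto simp: field_simps)
        also have "\<dots> = \<beta> * c / (2 * \<Xi>) / sqrt D" using \<Xi> c D by (simp add: \<beta>_def field_simps)
        finally have "(real m + 1) * ln (real K) \<le> \<beta> * c / (2 * \<Xi>) / sqrt D * ln (real K)"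
          using lK by (intro mult_right_mono) auto
        also have "\<dots> = \<beta> * c / (2 * \<Xi>) * (ln (real K) / sqrt D)" by simp
        also have "\<dots> \<le> \<beta> * c / (2 * \<Xi>) * (real N * rate / real s)"
          using \<beta>ge1 c \<Xi> by (intro mult_left_mono rr) auto
        also have "\<dots> = real N * (\<tau> / (2 * L))"
          unfolding \<tau>_def L_def using sp c \<Xi> by (simp add: mult_ac)
        finally show ?thesis .
      qed
      ultimately show ?thesis by (auto simp: min_def)
    qed
    define m' where "m' = (if p0 \<le> real p then 0 else m1)"
    define U where "U = {j \<in> J_under p N q. m' \<le> real N * q j}"
    have UJ: "U \<subseteq> J" using J_under_sub by (auto simp: U_def)
    have finU: "finite U" using UJ finite_subset finite_J by blast
    have pp: "real p \<ge> 1" using K_less by simp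
    have cardU: "real (card U) \<le> real p" using card_mono[of "{..<p}" U] UJ J_sub by force
    have tail_Z: "Pr {x. \<exists>k\<in>{..<K}. Z x k > \<tau>} \<le> \<epsilon> / 4"
        "Pr {x. \<exists>k\<in>{..<K}. - Z x k > \<tau>} \<le> \<epsilon> / 4"
    proof -
      have "1 / 2 ^ m \<le> \<epsilon> / 4" using m e by (simp add: field_simps)
      then show "Pr {x. \<exists>k\<in>{..<K}. Z x k > \<tau>} \<le> \<epsilon> / 4"
        "Pr {x. \<exists>k\<in>{..<K}. - Z x k > \<tau>} \<le> \<epsilon> / 4"
        using Z_max_tail[of "{..<K}" L \<tau> m] Lpos score_L \<tau>pos expo by force+
    qed
    have tail_U: "Pr {x. \<exists>j\<in>U. x j < q j / 8} \<le> \<epsilon> / 2"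
    proof -
      define y where "y = (if p0 \<le> real p then 3 * ln (real p) else 3 / 16 * m1)"
      have "Pr {x. \<exists>j\<in>U. x j < q j / 8} \<le> (\<Sum>j\<in>U. exp (- y))"
      proof (intro prob_Bex_le finU order.trans[OF cell_lower_tail])
        fix j assume j: "j \<in> U"
        then show "j \<in> J" using UJ by auto
        show "exp (- (3 / 16 * (real N * q j))) \<le> exp (- y)"
          using j J_under_large[of j] by (auto simp: U_def m'_def y_def)
      qed
      also have "\<dots> \<le> real p * exp (- y)" using cardU by simp
      also have "\<dots> \<le> \<epsilon> / 2"
      proof (cases "p0 \<le> real p")
        case True
        have "real p * exp (- y) = real p / real p ^ 3"
          using True pp exp_of_nat_mult[of 3 "ln (real p)"] by (simp add: y_def exp_minus divide_inverse)
        also have "\<dots> = 1 / (real p * real p)" using pp by (simp add: power3_eq_cube)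
        also have "\<dots> \<le> 1 / (1 * p0)" using True pp p0 by (intro divide_left_mono mult_mono) auto
        finally show ?thesis using e by (simp add: p0_def)
      next
        case False
        define w where "w = 2 * p0 / \<epsilon>"
        have w: "w > 0" using p0 e by (simp add: w_def)
        have "real p * exp (- y) \<le> p0 * exp (- w)"
          using False by (intro mult_mono) (auto simp: y_def m1_def w_def)
        also have "\<dots> \<le> p0 * (1 / w)"
        proof (intro mult_left_mono)
          have "w \<le> exp w" using exp_ge_add_one_self[of w] by linarith
          then show "exp (- w) \<le> 1 / w" using w by (simp add: exp_minus field_simps)
        qed (use p0 in auto)
        also have "\<dots> = \<epsilon> / 2" using p0 e by (simp add: w_def)
        finally show ?thesis .
      qed
      finally show ?thesis .
    qed
    show "Pr {x. far x (B * sqrt (real s * ln (real K) / real N))} \<le> \<epsilon>"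
    proof (cases "real p < p0 \<and> real N < N0")
      case True
      have "1 * ln 2 \<le> real s * ln (real K)" using s_pos K_ge_2 by (intro mult_mono) auto
      then have "2 \<le> B * sqrt (real s * ln (real K) / real N)"
        using True Np by (intro trivial_bound_small_sample[of "ln 2" _ _ N0]) (auto simp: B_def)
      then have empty: "{x. far x (B * sqrt (real s * ln (real K) / real N))} = {}"
        using not_far by auto
      show ?thesis unfolding empty using e by simp
    next
      case False
      have half: "\<kappa>0 / 2 * l1 v \<le> (\<Sum>j\<in>U. q j * \<bar>pert v j\<bar>)" if v: "in_cone v" for v
      proof -
        let ?l = "l1 v"
        have l0: "0 \<le> ?l" by (rule l1_nonneg)
        have fin: "finite (J_under p N q)" using J_under_sub finite_J finite_subset by blast
        have "\<kappa>0 * ?l \<le> kappa (J_under p N q) K A s * ?l" using \<kappa> l0 by (rule mult_right_mono)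
        also have "\<dots> \<le> (\<Sum>j\<in>J_under p N q. q j * \<bar>pert v j\<bar>)"
          by (rule kappa_l1_le[OF v J_under_sub])
        also have "\<dots> = (\<Sum>j\<in>J_under p N q - U. q j * \<bar>pert v j\<bar>) + (\<Sum>j\<in>U. q j * \<bar>pert v j\<bar>)"
          by (rule sum.subset_diff[OF _ fin]) (auto simp: U_def)
        also have "(\<Sum>j\<in>J_under p N q - U. q j * \<bar>pert v j\<bar>) \<le> \<kappa>0 / 2 * ?l"
        proof (cases "p0 \<le> real p")
          case True
          have "J_under p N q - U = {}"
            using q_nonneg by (auto simp: U_def m'_def True J_under_def)
          then have "(\<Sum>j\<in>J_under p N q - U. q j * \<bar>pert v j\<bar>) = 0" by (simp only: sum.empty)
          then show ?thesis using \<kappa>0 l0 by simp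
        next
          case p: False
          then have N: "N0 \<le> real N" using False by simp
          have "(\<Sum>j\<in>J_under p N q - U. q j * \<bar>pert v j\<bar>) \<le> (\<Sum>j\<in>J_under p N q - U. m1 / real N * (L * ?l))"
          proof (intro sum_mono mult_mono)
            fix j assume j: "j \<in> J_under p N q - U"
            then show "q j \<le> m1 / real N" using p Np by (auto simp: U_def m'_def field_simps)
            have "j < p" using j by (auto simp: J_under_def)
            then show "\<bar>pert v j\<bar> \<le> L * ?l" using score_L by (intro pert_abs_le)
          qed (use m1 in auto)
          also have "\<dots> = real (card (J_under p N q - U)) * (m1 / real N * (L * ?l))" by simp
          also have "\<dots> \<le> real p * (m1 / real N * (L * ?l))"
          proof -
            have "card (J_under p N q - U) \<le> card {..<p}" by (rule card_mono) (auto simp: J_under_def)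
            then show ?thesis using m1 Lpos l0 by (intro mult_right_mono) auto
          qed
          also have "\<dots> \<le> p0 * (m1 / N0 * ((\<Xi> * p0 / c) * ?l))"
          proof -
            have "s < p" using s_less K_less by simp
            then have "L \<le> \<Xi> * p0 / c" unfolding L_def using p \<Xi> c
              by (intro divide_right_mono mult_left_mono) auto
            then show ?thesis using p N N0 m1 l0 Lpos Np p0
              by (intro mult_mono frac_le order_refl) auto
          qed
          also have "\<dots> = \<kappa>0 / 2 * ?l"
            using p0 m1 \<Xi> c \<kappa>0 by (simp add: N0_def power2_eq_square)
          finally show ?thesis .
        qed
        finally show ?thesis by simp
      qed
      have "Pr {x. far x (B * sqrt (real s * ln (real K) / real N))}
        \<le> Pr {x. (\<exists>j\<in>U. x j < q j / 8) \<or>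
            ((\<exists>k\<in>{..<K}. Z x k > \<tau>) \<or> (\<exists>k\<in>{..<K}. - Z x k > \<tau>))}"
      proof (rule prob_mono_on_support, rule ccontr)
        fix x assume x: "x \<in> set_pmf law"
          and ex: "far x (B * sqrt (real s * ln (real K) / real N))"
          and bad: "\<not> ((\<exists>j\<in>U. x j < q j / 8) \<or> ((\<exists>k\<in>{..<K}. Z x k > \<tau>) \<or> (\<exists>k\<in>{..<K}. - Z x k > \<tau>)))"
        obtain v where v: "ascent x v" "l1 v \<le> 2" "l1 v > B * rate"
          using ex by (auto simp: rate_def far_def)
        have "l1 v \<le> 64 * \<tau> / (\<kappa>0 / 2)\<^sup>2"
        proof (rule slow_rate_deterministic[OF x v(1,2) UJ])
          show "q j / 8 \<le> x j" if "j \<in> U" for j using bad that by (auto simp: not_less)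
          show "\<bar>Z x k\<bar> \<le> \<tau>" if "k < K" for k using bad that by (force simp: not_less abs_le_iff)
          show "0 < \<kappa>0 / 2" using \<kappa>0 by simp
          show "\<kappa>0 / 2 * l1 v \<le> (\<Sum>j\<in>U. q j * \<bar>pert v j\<bar>)"
            by (rule half[OF ascent_in_cone[OF v(1)]])
        qed
        also have "\<dots> = 64 * \<beta> / (\<kappa>0 / 2)\<^sup>2 * rate" by (simp add: \<tau>_def)
        also have "\<dots> \<le> B * rate" unfolding B_def using ratepos by (intro mult_right_mono) auto
        finally show False using v(3) by simp
      qed
      also have "\<dots> \<le> \<epsilon> / 2 + (\<epsilon> / 4 + \<epsilon> / 4)"
        by (intro order.trans[OF prob_disj_le] add_mono tail_U tail_Z)
      finally show ?thesis by simp
    qed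
  qed
qed

section \<open>Linear and quadratic forms in the scores\<close>

lemma abs_sum_mult_le_sqrt:
  fixes a b :: "'i \<Rightarrow> real"
  shows "\<bar>\<Sum>i\<in>I. a i * b i\<bar> \<le> sqrt (\<Sum>i\<in>I. (a i)\<^sup>2) * sqrt (\<Sum>i\<in>I. (b i)\<^sup>2)"
  using sum_mult_le_sqrt[of I "\<lambda>_. 1" a b] sum_abs[of "\<lambda>i. a i * b i" I]
  by (simp add: abs_mult)

context topic_instance
begin

definition restrict_to :: "nat set \<Rightarrow> (nat \<Rightarrow> real) \<Rightarrow> nat \<Rightarrow> real" where
  "restrict_to I v k = (if k \<in> I then v k else 0)"

abbreviation "active v \<equiv> pert (restrict_to S v)"

lemma pert_restrict: "I \<subseteq> {..<K} \<Longrightarrow> pert (restrict_to I v) j = (\<Sum>k\<in>I. v k * score k j)"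
  by (simp add: pert_def restrict_to_def if_distrib[of "\<lambda>y. y * _"] sum.If_cases Int_absorb1 cong: if_cong)

lemma pert_split: "pert v j = active v j + pert (restrict_to Sc v) j"
  by (simp only: pert_restrict[OF S_sub] pert_restrict[OF Diff_subset]) (simp add: pert_def sum_split_S)

lemma l1_restrict_S: "l1 (restrict_to S v) = l1_on S v"
  unfolding l1_split by (simp add: l1_on_def restrict_to_def)

lemma restrict_S_in_cone: "in_cone (restrict_to S v)"
  using l1_nonneg[of S v] by (simp add: in_cone_def l1_on_def restrict_to_def)

lemma pert_S_abs_le:
  assumes "j < p"
  shows "\<bar>active v j\<bar> \<le> l1_on S v / tmin"
proof -
  have "\<bar>active v j\<bar> \<le> (\<Sum>k\<in>S. \<bar>v k * score k j\<bar>)"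
    unfolding pert_restrict[OF S_sub] by (rule sum_abs)
  also have "\<dots> \<le> (\<Sum>k\<in>S. \<bar>v k\<bar> * (1 / tmin))"
  proof (rule sum_mono)
    fix k assume k: "k \<in> S"
    then have "0 \<le> score k j" using S_sub assms by (intro score_nonneg) auto
    then show "\<bar>v k * score k j\<bar> \<le> \<bar>v k\<bar> * (1 / tmin)"
      using score_le_S[OF k assms] by (simp only: abs_mult abs_of_nonneg) (intro mult_left_mono, auto)
  qed
  finally show ?thesis by (simp add: l1_on_def sum_divide_distrib)
qed

definition S_controlled :: "real \<Rightarrow> real \<Rightarrow> (nat \<Rightarrow> real) \<Rightarrow> bool" where
  "S_controlled g \<eta> x \<longleftrightarrow> (\<forall>v. let r = active v in
     \<bar>\<Sum>j<p. (x j - q j) * r j\<bar> \<le> g * qnorm r \<and>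
     \<bar>\<Sum>j<p. (x j - q j) * (r j)\<^sup>2\<bar> \<le> \<eta> * (qnorm r)\<^sup>2)"

text \<open>The sum of squares of an orthonormal basis at a point is the squared norm of the evaluation
  functional there.  It is small because a function of unit norm in the span has
  coefficients of \<open>\<ell>\<^sub>1\<close> norm at most \<open>1 / k0\<close>, and active scores are at most \<open>1 / T\<^sub>m\<^sub>i\<^sub>n\<close>.\<close>

lemma S_orthonormal_basis:
  assumes k0: "0 < k0" "k0 \<le> kappa J K A s"
  obtains r \<phi> where "r \<le> s" "orthonormal_on {..<p} q r \<phi>"
    "\<And>v. \<exists>c. \<forall>j<p. active v j = (\<Sum>a<r. c a * \<phi> a j)"
    "\<And>j. j < p \<Longrightarrow> (\<Sum>a<r. (\<phi> a j)\<^sup>2) \<le> 1 / (k0 * tmin)\<^sup>2"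
proof -
  obtain r \<phi> where r: "r \<le> card S" and on: "orthonormal_on J q r \<phi>"
    and span: "\<forall>k\<in>S. \<exists>c. \<forall>i\<in>J. score k i = (\<Sum>a<r. c a * \<phi> a i)"
    and comb: "\<forall>a<r. \<exists>c. \<forall>i\<in>J. \<phi> a i = (\<Sum>k\<in>S. c k * score k i)"
    using gram_schmidt[of S J q score] by (auto simp: J_iff)
  define \<psi> where "\<psi> a j = (if j \<in> J then \<phi> a j else 0)" for a j
  have onp: "orthonormal_on {..<p} q r \<psi>"
  proof -
    have "(\<Sum>i<p. q i * (\<psi> a i * \<psi> b i)) = (\<Sum>i\<in>J. q i * (\<phi> a i * \<phi> b i))" for a b
      using J_sub by (intro sum.mono_neutral_cong_right) (auto simp: \<psi>_def)
    then show ?thesis using on by (simp add: orthonormal_on_def)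
  qed
  have sp: "\<exists>c. \<forall>j<p. active v j = (\<Sum>a<r. c a * \<psi> a j)" for v
  proof -
    obtain C where C: "\<And>k i. k \<in> S \<Longrightarrow> i \<in> J \<Longrightarrow> score k i = (\<Sum>a<r. C k a * \<phi> a i)"
      using span by metis
    have "active v j = (\<Sum>a<r. (\<Sum>k\<in>S. v k * C k a) * \<psi> a j)" if "j < p" for j
    proof (cases "j \<in> J")
      case True
      have "active v j = (\<Sum>k\<in>S. v k * (\<Sum>a<r. C k a * \<phi> a j))"
        unfolding pert_restrict[OF S_sub] using C True by (intro sum.cong) auto
      also have "\<dots> = (\<Sum>a<r. (\<Sum>k\<in>S. v k * C k a) * \<phi> a j)"
        unfolding sum_distrib_left sum_distrib_right by (subst sum.swap) (simp add: mult_ac)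
      finally show ?thesis using True by (simp add: \<psi>_def)
    next
      case False
      then show ?thesis using that by (simp add: \<psi>_def pert_outside)
    qed
    then show ?thesis by (intro exI[of _ "\<lambda>a. \<Sum>k\<in>S. v k * C k a"]) blast
  qed
  have bd: "(\<Sum>a<r. (\<psi> a j)\<^sup>2) \<le> 1 / (k0 * tmin)\<^sup>2" if jp: "j < p" for j
  proof (cases "j \<in> J")
    case True
    obtain C where C: "\<And>a i. a < r \<Longrightarrow> i \<in> J \<Longrightarrow> \<phi> a i = (\<Sum>k\<in>S. C a k * score k i)"
      using comb by metis
    define F where "F = (\<Sum>a<r. (\<phi> a j)\<^sup>2)"
    define u where "u k = (\<Sum>a<r. \<phi> a j * C a k)" for k
    have F0: "0 \<le> F" by (auto simp: F_def intro: sum_nonneg)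
    have pu: "active u i = (\<Sum>a<r. \<phi> a j * \<psi> a i)" if "i < p" for i
    proof (cases "i \<in> J")
      case True
      have "active u i = (\<Sum>k\<in>S. \<Sum>a<r. \<phi> a j * (C a k * score k i))"
        unfolding pert_restrict[OF S_sub] u_def sum_distrib_right by (simp only: mult.assoc)
      also have "\<dots> = (\<Sum>a<r. \<phi> a j * (\<Sum>k\<in>S. C a k * score k i))"
        unfolding sum_distrib_left by (rule sum.swap)
      finally have "active u i = (\<Sum>a<r. \<phi> a j * (\<Sum>k\<in>S. C a k * score k i))" .
      also have "\<dots> = (\<Sum>a<r. \<phi> a j * \<phi> a i)" using C True by (intro sum.cong) auto
      finally show ?thesis using True by (simp add: \<psi>_def)
    next
      case False
      then show ?thesis using that by (simp add: \<psi>_def pert_outside)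
    qed
    have "(qnorm (active u))\<^sup>2 = (\<Sum>i<p. q i * (\<Sum>a<r. \<phi> a j * \<psi> a i)\<^sup>2)"
      unfolding qnorm_square by (intro sum.cong) (auto simp: pu)
    also have "\<dots> = F" unfolding F_def by (rule sum_square_orthonormal[OF onp])
    finally have nF: "qnorm (active u) = sqrt F"
      using qnorm_nonneg by (metis real_sqrt_unique)
    have "F = active u j" using jp True by (simp add: pu \<psi>_def F_def power2_eq_square)
    also have "\<dots> \<le> l1_on S u / tmin" using pert_S_abs_le[OF jp, of u] by linarith
    finally have "F * tmin \<le> l1_on S u" using tmin_pos by (simp add: field_simps)
    then have "k0 * (F * tmin) \<le> k0 * l1_on S u" using k0 by (intro mult_left_mono) auto
    also have "\<dots> \<le> kappa J K A s * l1_on S u" using k0 l1_nonneg by (intro mult_right_mono) auto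
    also have "\<dots> \<le> sqrt F"
      using kappa_J_l1_le[OF restrict_S_in_cone, of u] by (simp add: l1_restrict_S nF)
    finally have "F * (k0 * tmin) \<le> sqrt F" by (simp add: mult_ac)
    moreover have "(sqrt F * (k0 * tmin)) * sqrt F = (sqrt F * sqrt F) * (k0 * tmin)"
      by (simp only: mult_ac)
    moreover have "sqrt F * sqrt F = F" using F0 by simp
    ultimately have "(sqrt F * (k0 * tmin)) * sqrt F \<le> 1 * sqrt F" by (simp only: mult_1)
    then have "sqrt F = 0 \<or> sqrt F * (k0 * tmin) \<le> 1"
      using F0 by (metis mult_right_le_imp_le order_le_less real_sqrt_ge_zero)
    then have "sqrt F * (k0 * tmin) \<le> 1" by auto
    then have "sqrt F \<le> 1 / (k0 * tmin)" using k0 tmin_pos by (simp add: field_simps)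
    then have "(sqrt F)\<^sup>2 \<le> (1 / (k0 * tmin))\<^sup>2" using F0 by (intro power_mono) auto
    then have "F \<le> 1 / (k0 * tmin)\<^sup>2" using F0 by (simp add: power_divide)
    then show ?thesis using True by (simp add: F_def \<psi>_def)
  next
    case False
    then show ?thesis by (simp add: \<psi>_def)
  qed
  show ?thesis by (rule that[of r \<psi>]) (use r card_S onp sp bd in auto)
qed

text \<open>In an orthonormal basis the linear forms have total variance at most \<open>s / N\<close>, which gives the rate
  without a logarithm, and the quadratic forms have total variance at most \<open>s / (k0 T\<^sub>m\<^sub>i\<^sub>n)\<^sup>2 / N\<close>, the
  trace of a Gram matrix times the bound on the evaluation functionals.  Chebyshev's inequality for the
  Frobenius norm is sharp enough here, because \<open>s T\<^sub>m\<^sub>i\<^sub>n \<le> 1\<close> and \<open>N T\<^sub>m\<^sub>i\<^sub>n\<^sup>3\<close> is large.\<close>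

lemma S_controlled_prob:
  assumes k0: "0 < k0" "k0 \<le> kappa J K A s" and g: "0 < g" and \<eta>: "0 < \<eta>"
  shows "Pr {x. \<not> S_controlled g \<eta> x}
    \<le> real s / (real N * g\<^sup>2) + real s / (real N * (\<eta> * k0 * tmin)\<^sup>2)"
proof -
  obtain r \<phi> where r: "r \<le> s" and on: "orthonormal_on {..<p} q r \<phi>"
    and span: "\<And>v. \<exists>c. \<forall>j<p. active v j = (\<Sum>a<r. c a * \<phi> a j)"
    and bd: "\<And>j. j < p \<Longrightarrow> (\<Sum>a<r. (\<phi> a j)\<^sup>2) \<le> 1 / (k0 * tmin)\<^sup>2"
    using S_orthonormal_basis[OF k0] by blast
  define G where "G a x = (\<Sum>j<p. (x j - q j) * \<phi> a j)" for a x
  define H where "H a b x = (\<Sum>j<p. (x j - q j) * (\<phi> a j * \<phi> b j))" for a b x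
  let ?G = "\<lambda>x. \<Sum>a<r. (G a x)\<^sup>2" and ?H = "\<lambda>x. \<Sum>a<r. \<Sum>c<r. (H a c x)\<^sup>2"
  define b where "b = 1 / (k0 * tmin)\<^sup>2"
  have Np: "real N > 0" using N_pos by simp
  have b0: "0 \<le> b" by (simp add: b_def)
  have trace: "(\<Sum>j<p. q j * (\<Sum>a<r. (\<phi> a j)\<^sup>2)) = real r"
  proof -
    have "(\<Sum>j<p. q j * (\<Sum>a<r. (\<phi> a j)\<^sup>2)) = (\<Sum>a<r. \<Sum>j<p. q j * (\<phi> a j * \<phi> a j))"
      unfolding sum_distrib_left by (subst sum.swap) (simp add: power2_eq_square)
    also have "\<dots> = (\<Sum>a<r. 1)" using on by (intro sum.cong) (auto simp: orthonormal_on_def)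
    finally show ?thesis by simp
  qed
  have int: "integrable (measure_pmf law) f" for f :: "(nat \<Rightarrow> real) \<Rightarrow> real"
    by (rule integrable_freq[OF q_simplex])
  have EG: "mean ?G \<le> real s / real N"
  proof -
    have "mean ?G = (\<Sum>a<r. mean (\<lambda>x. (G a x)\<^sup>2))"
      by (rule Bochner_Integration.integral_sum) (rule int)
    also have "\<dots> \<le> (\<Sum>a<r. (\<Sum>j<p. q j * (\<phi> a j)\<^sup>2) / real N)"
      unfolding G_def by (intro sum_mono expectation_freq_square q_simplex N_pos)
    also have "\<dots> = (\<Sum>j<p. q j * (\<Sum>a<r. (\<phi> a j)\<^sup>2)) / real N"
      unfolding sum_divide_distrib[symmetric] sum_distrib_left by (subst sum.swap) simp
    also have "\<dots> \<le> real s / real N" unfolding trace using r by (intro divide_right_mono) auto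
    finally show ?thesis .
  qed
  have EH: "mean ?H \<le> b * real s / real N"
  proof -
    have "mean ?H
        = (\<Sum>a<r. \<Sum>c<r. mean (\<lambda>x. (H a c x)\<^sup>2))"
      by (subst Bochner_Integration.integral_sum[OF int], rule sum.cong[OF refl])
         (rule Bochner_Integration.integral_sum[OF int])
    also have "\<dots> \<le> (\<Sum>a<r. \<Sum>c<r. (\<Sum>j<p. q j * (\<phi> a j * \<phi> c j)\<^sup>2) / real N)"
      unfolding H_def by (intro sum_mono expectation_freq_square q_simplex N_pos)
    also have "\<dots> = (\<Sum>a<r. \<Sum>c<r. \<Sum>j<p. q j * (\<phi> a j * \<phi> c j)\<^sup>2) / real N"
      by (simp add: sum_divide_distrib)
    also have "(\<Sum>a<r. \<Sum>c<r. \<Sum>j<p. q j * (\<phi> a j * \<phi> c j)\<^sup>2)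
        = (\<Sum>a<r. \<Sum>j<p. \<Sum>c<r. q j * (\<phi> a j * \<phi> c j)\<^sup>2)"
      by (intro sum.cong refl sum.swap)
    also have "\<dots> = (\<Sum>j<p. \<Sum>a<r. \<Sum>c<r. q j * (\<phi> a j * \<phi> c j)\<^sup>2)"
      by (rule sum.swap)
    also have "\<dots> = (\<Sum>j<p. q j * (\<Sum>a<r. (\<phi> a j)\<^sup>2) * (\<Sum>c<r. (\<phi> c j)\<^sup>2))"
    proof (intro sum.cong refl)
      fix j
      have "(\<Sum>a<r. \<Sum>c<r. q j * (\<phi> a j * \<phi> c j)\<^sup>2) = q j * (\<Sum>a<r. \<Sum>c<r. (\<phi> a j)\<^sup>2 * (\<phi> c j)\<^sup>2)"
        by (simp only: sum_distrib_left power_mult_distrib)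
      then show "(\<Sum>a<r. \<Sum>c<r. q j * (\<phi> a j * \<phi> c j)\<^sup>2)
          = q j * (\<Sum>a<r. (\<phi> a j)\<^sup>2) * (\<Sum>c<r. (\<phi> c j)\<^sup>2)"
        by (simp only: sum_product[symmetric] mult.assoc)
    qed
    also have "\<dots> \<le> (\<Sum>j<p. q j * (\<Sum>a<r. (\<phi> a j)\<^sup>2) * b)"
      using bd by (intro sum_mono mult_left_mono mult_nonneg_nonneg sum_nonneg) (auto simp: b_def q_nonneg)
    also have "\<dots> = b * real r" by (simp add: sum_distrib_right[symmetric] trace)
    finally have "mean ?H \<le> b * real r / real N"
      using Np by (simp add: divide_right_mono)
    also have "\<dots> \<le> b * real s / real N" using r b0 by (intro divide_right_mono mult_left_mono) auto
    finally show ?thesis .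
  qed
  have "Pr {x. \<not> S_controlled g \<eta> x}
      \<le> Pr {x. ?G x \<ge> g\<^sup>2 \<or> ?H x \<ge> \<eta>\<^sup>2}"
  proof (rule prob_mono_on_support, rule ccontr)
    fix x assume nc: "\<not> S_controlled g \<eta> x"
      and "\<not> (?G x \<ge> g\<^sup>2 \<or> ?H x \<ge> \<eta>\<^sup>2)"
    then have "?G x \<le> g\<^sup>2" "?H x \<le> \<eta>\<^sup>2" by auto
    then have Gg: "sqrt (?G x) \<le> g" and Hh: "sqrt (?H x) \<le> \<eta>"
      using g \<eta> by (auto intro!: real_le_lsqrt sum_nonneg)
    have "S_controlled g \<eta> x" unfolding S_controlled_def Let_def
    proof (intro allI conjI)
      fix v
      obtain c where c: "\<And>j. j < p \<Longrightarrow> active v j = (\<Sum>a<r. c a * \<phi> a j)" using span by blast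
      let ?n = "qnorm (active v)"
      have "?n\<^sup>2 = (\<Sum>i<p. q i * (\<Sum>a<r. c a * \<phi> a i)\<^sup>2)"
        unfolding qnorm_square by (intro sum.cong) (auto simp: c)
      also have "\<dots> = (\<Sum>a<r. (c a)\<^sup>2)" by (rule sum_square_orthonormal[OF on])
      finally have n2: "?n\<^sup>2 = (\<Sum>a<r. (c a)\<^sup>2)" .
      then have n: "?n = sqrt (\<Sum>a<r. (c a)\<^sup>2)" using qnorm_nonneg by (metis real_sqrt_unique)
      have "(\<Sum>j<p. (x j - q j) * active v j) = (\<Sum>j<p. \<Sum>a<r. c a * ((x j - q j) * \<phi> a j))"
        by (intro sum.cong) (auto simp: c sum_distrib_left mult_ac)
      also have "\<dots> = (\<Sum>a<r. c a * G a x)"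
        unfolding G_def by (subst sum.swap) (simp add: sum_distrib_left)
      finally have "\<bar>\<Sum>j<p. (x j - q j) * active v j\<bar> \<le> ?n * sqrt (?G x)"
        using abs_sum_mult_le_sqrt[of c "\<lambda>a. G a x" "{..<r}"] by (simp add: n)
      also have "\<dots> \<le> ?n * g" by (intro mult_left_mono Gg qnorm_nonneg)
      finally show "\<bar>\<Sum>j<p. (x j - q j) * active v j\<bar> \<le> g * ?n" by (simp add: mult.commute)
      have "(\<Sum>j<p. (x j - q j) * (active v j)\<^sup>2)
          = (\<Sum>j<p. \<Sum>i\<in>{..<r} \<times> {..<r}. c (fst i) * c (snd i) * ((x j - q j) * (\<phi> (fst i) j * \<phi> (snd i) j)))"
      proof (intro sum.cong refl)
        fix j assume "j \<in> {..<p}"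
        then have "(x j - q j) * (active v j)\<^sup>2
            = (\<Sum>a<r. \<Sum>d<r. c a * c d * ((x j - q j) * (\<phi> a j * \<phi> d j)))"
          by (simp add: c power2_eq_square sum_product sum_distrib_left mult_ac)
        then show "(x j - q j) * (active v j)\<^sup>2
            = (\<Sum>i\<in>{..<r} \<times> {..<r}. c (fst i) * c (snd i) * ((x j - q j) * (\<phi> (fst i) j * \<phi> (snd i) j)))"
          by (simp add: sum.cartesian_product case_prod_beta)
      qed
      also have "\<dots> = (\<Sum>i\<in>{..<r} \<times> {..<r}. c (fst i) * c (snd i) * H (fst i) (snd i) x)"
        unfolding H_def by (subst sum.swap) (simp add: sum_distrib_left)
      finally have "\<bar>\<Sum>j<p. (x j - q j) * (active v j)\<^sup>2\<bar>
          \<le> sqrt (\<Sum>i\<in>{..<r} \<times> {..<r}. (c (fst i) * c (snd i))\<^sup>2)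
            * sqrt (\<Sum>i\<in>{..<r} \<times> {..<r}. (H (fst i) (snd i) x)\<^sup>2)"
        using abs_sum_mult_le_sqrt[of "\<lambda>i. c (fst i) * c (snd i)" "\<lambda>i. H (fst i) (snd i) x" "{..<r} \<times> {..<r}"] by simp
      also have "(\<Sum>i\<in>{..<r} \<times> {..<r}. (H (fst i) (snd i) x)\<^sup>2) = (\<Sum>a<r. \<Sum>d<r. (H a d x)\<^sup>2)"
        by (simp add: sum.cartesian_product case_prod_beta)
      also have "(\<Sum>i\<in>{..<r} \<times> {..<r}. (c (fst i) * c (snd i))\<^sup>2) = (?n\<^sup>2)\<^sup>2"
      proof -
        have "(?n\<^sup>2)\<^sup>2 = (\<Sum>a<r. \<Sum>d<r. (c a * c d)\<^sup>2)"
          unfolding n2 by (simp add: power2_eq_square[of "sum _ _"] sum_product power_mult_distrib)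
        then show ?thesis by (simp add: sum.cartesian_product case_prod_beta)
      qed
      also have "sqrt ((?n\<^sup>2)\<^sup>2) = ?n\<^sup>2" by (rule real_sqrt_unique) auto
      also have "?n\<^sup>2 * sqrt (\<Sum>a<r. \<Sum>d<r. (H a d x)\<^sup>2) \<le> ?n\<^sup>2 * \<eta>"
        by (intro mult_left_mono Hh) auto
      finally show "\<bar>\<Sum>j<p. (x j - q j) * (active v j)\<^sup>2\<bar> \<le> \<eta> * ?n\<^sup>2" by (simp add: mult.commute)
    qed
    then show False using nc by simp
  qed
  also have "\<dots> \<le> Pr {x. ?G x \<ge> g\<^sup>2}
      + Pr {x. ?H x \<ge> \<eta>\<^sup>2}"
    by (rule prob_disj_le)
  also have "\<dots> \<le> mean ?G / g\<^sup>2
      + mean ?H / \<eta>\<^sup>2"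
    using g \<eta> by (intro add_mono markov_finite_pmf finite_set_pmf_freq q_simplex sum_nonneg) auto
  also have "\<dots> \<le> (real s / real N) / g\<^sup>2 + (b * real s / real N) / \<eta>\<^sup>2"
    by (intro add_mono divide_right_mono EG EH) auto
  also have "\<dots> = real s / (real N * g\<^sup>2) + real s / (real N * (\<eta> * k0 * tmin)\<^sup>2)"
    by (simp add: b_def power_mult_distrib mult_ac)
  finally show ?thesis .
qed

text \<open>Entries of the deviation of the empirical Gram matrix of the scores.  They serve pairs with an inactive
  topic, where the small bound on inactive scores allows a union bound; pairs of active topics are covered by
  the orthonormal basis.\<close>

definition gram_dev :: "(nat \<Rightarrow> real) \<Rightarrow> nat \<Rightarrow> nat \<Rightarrow> real" where
  "gram_dev x k l = (\<Sum>j<p. (x j - q j) * (score k j * score l j))"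

lemma gram_dev_tail:
  assumes k: "k < K" and l: "l \<in> Sc" and \<rho>: "0 < \<rho>" "ratio \<le> \<rho>" "\<rho> \<le> R" and t: "0 < t"
  defines "b \<equiv> (1 / tmin + R) * \<rho>"
  shows "Pr {x. \<bar>gram_dev x k l\<bar> > t}
    \<le> 2 * exp (- (real N * min (t\<^sup>2 / (4 * (b * R))) (t / (2 * b))))"
proof -
  define h where "h j = score k j * score l j" for j
  have lK: "l < K" using l by simp
  have R0: "0 < R" using \<rho> by simp
  have tp: "0 < 1 / tmin + R" using tmin_pos R0 by (simp add: add_pos_pos)
  have b0: "0 < b" unfolding b_def using tp \<rho> by simp
  have sk: "score k j \<le> 1 / tmin + R" if j: "j < p" for j
    using \<rho> by (intro score_le k j) auto
  have hb: "0 \<le> h j" "h j \<le> b" if j: "j < p" for j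
  proof -
    show "0 \<le> h j" unfolding h_def using score_nonneg[OF j] k lK by simp
    have "score l j \<le> \<rho>" using score_le_Sc[OF l j] \<rho> by simp
    then show "h j \<le> b"
      unfolding h_def b_def using sk[OF j] score_nonneg[OF j] k lK tp by (intro mult_mono) auto
  qed
  have hv: "(\<Sum>j<p. q j * (h j)\<^sup>2) \<le> b * R"
  proof -
    have "(\<Sum>j<p. q j * (h j)\<^sup>2) \<le> (\<Sum>j<p. b * R * (q j * score k j))"
    proof (rule sum_mono)
      fix j assume "j \<in> {..<p}"
      then have j: "j < p" by simp
      have "score l j \<le> R" using score_le_Sc[OF l j] \<rho> by simp
      then have "h j * h j \<le> b * (score k j * R)"
        using hb[OF j] b0 score_nonneg[OF j] k lK by (intro mult_mono) (auto simp: h_def intro: mult_left_mono)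
      then have "q j * (h j * h j) \<le> q j * (b * (score k j * R))" by (intro mult_left_mono q_nonneg j)
      then show "q j * (h j)\<^sup>2 \<le> b * R * (q j * score k j)" by (simp add: power2_eq_square mult_ac)
    qed
    also have "\<dots> = b * R * (1 - leak k)" by (simp add: sum_distrib_left[symmetric] sum_q_score k)
    also have "\<dots> \<le> b * R * 1" using b0 R0 leak_nonneg[OF k] by (intro mult_left_mono) auto
    finally show ?thesis by simp
  qed
  let ?e = "exp (- (real N * min (t\<^sup>2 / (4 * (b * R))) (t / (2 * b))))"
  have 1: "Pr {x. (\<Sum>j<p. (x j - q j) * h j) > t} \<le> ?e"
    by (rule freq_bernstein[OF q_simplex N_pos]) (use b0 R0 hb hv t in auto)
  have hneg: "- h j \<le> b" if "j < p" for j using hb[OF that] b0 by linarith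
  have 2: "Pr {x. (\<Sum>j<p. (x j - q j) * - h j) > t} \<le> ?e"
    by (rule freq_bernstein[OF q_simplex N_pos]) (use b0 R0 hneg hv t in auto)
  have "Pr {x. \<bar>gram_dev x k l\<bar> > t}
      \<le> Pr {x. (\<Sum>j<p. (x j - q j) * h j) > t \<or> (\<Sum>j<p. (x j - q j) * - h j) > t}"
    by (rule prob_mono_on_support) (auto simp: gram_dev_def h_def sum_negf abs_if split: if_splits)
  also have "\<dots> \<le> ?e + ?e" by (intro order.trans[OF prob_disj_le] add_mono 1 2)
  finally show ?thesis by simp
qed

section \<open>Deterministic part of the fast rate\<close>

text \<open>In both regimes below a bound is first obtained for errors so small that a quadratic expansion
  of the likelihood is accurate; it then holds for all errors, because they may be shrunk
  continuously and the bound excludes the boundary of the region of validity.\<close>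

lemma shrinking_bound:
  fixes y b \<tau> :: real
  assumes "\<And>c. 0 \<le> c \<Longrightarrow> c \<le> 1 \<Longrightarrow> c * y \<le> \<tau> \<Longrightarrow> c * y \<le> b" and "b < \<tau>" "0 \<le> \<tau>"
  shows "y \<le> b"
proof (cases "y \<le> \<tau>")
  case True
  then show ?thesis using assms(1)[of 1] by simp
next
  case False
  then have "\<tau> / y * y \<le> b" using assms(3) by (intro assms(1)) auto
  then show ?thesis using False assms by simp
qed

lemma l1_S_le_qnorm:
  assumes k0: "0 < k0" "k0 \<le> kappa J K A s"
  shows "k0 * l1_on S v \<le> qnorm (active v)"
proof -
  have "k0 * l1_on S v \<le> kappa J K A s * l1_on S v" using k0 l1_nonneg by (intro mult_right_mono)
  also have "\<dots> \<le> qnorm (active v)"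
    using kappa_J_l1_le[OF restrict_S_in_cone, of v] by (simp add: l1_restrict_S)
  finally show ?thesis .
qed

lemma l1_le_qnorm:
  assumes k0: "0 < k0" "k0 \<le> kappa J K A s" and "in_cone v"
  shows "k0 * l1 v \<le> qnorm (pert v)"
proof -
  have "k0 * l1 v \<le> kappa J K A s * l1 v" using k0 l1_nonneg by (intro mult_right_mono)
  also have "\<dots> \<le> qnorm (pert v)" by (rule kappa_J_l1_le[OF assms(3)])
  finally show ?thesis .
qed

lemma sum_S_Z: "(\<Sum>k\<in>S. v k * Z x k) = (\<Sum>j<p. (x j - q j) * active v j)"
  unfolding pert_restrict[OF S_sub] Z_def sum_distrib_left by (subst sum.swap) (simp add: mult_ac)

text \<open>Inactive topics lose at least \<open>\<delta>\<close> of likelihood per unit of mass on rows never observed.  This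
  exceeds both their noise and the cross term of their contribution with that of the active topics, so
  that only the active part of the direction remains and the parametric rate \<open>g\<close> results.  The inactive
  part is expanded to first order only, which needs no bound on its relative size.\<close>

lemma penalised_local_bound:
  assumes x: "x \<in> set_pmf law" and v: "ascent x v" and k0: "0 < k0" "k0 \<le> kappa J K A s"
    and ctrl: "S_controlled g \<eta> x" and g: "0 < g" and \<eta>: "\<eta> \<le> 1 / 2"
    and \<delta>: "\<And>k. k \<in> Sc \<Longrightarrow> \<delta> \<le> leak k" "\<And>k. k \<in> Sc \<Longrightarrow> Z x k \<le> \<delta> / 4" "0 \<le> \<delta>"
    and loc1: "qnorm (active v) \<le> k0 * tmin / 2"
    and loc2: "sqrt ratio * qnorm (active v) \<le> \<delta> / 8"
  shows "qnorm (active v) \<le> 10 * g"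
proof -
  define r where "r = active v"
  define z where "z = pert (restrict_to Sc v)"
  define n where "n = qnorm r"
  define W where "W = (\<Sum>k\<in>Sc. v k)"
  have n0: "0 \<le> n" unfolding n_def by (rule qnorm_nonneg)
  have xn: "\<And>j. 0 \<le> x j" using data_nonneg[OF x] .
  have vS: "0 \<le> v k" if "k \<in> Sc" for k using v that by (auto simp: ascent_def)
  have W0: "0 \<le> W" unfolding W_def using vS by (rule sum_nonneg)
  have zj: "z j = (\<Sum>k\<in>Sc. v k * score k j)" for j by (simp add: z_def pert_restrict)
  have z0: "0 \<le> z j" if "j < p" for j
    unfolding zj using vS score_nonneg that by (intro sum_nonneg mult_nonneg_nonneg) auto
  have r12: "\<bar>r j\<bar> \<le> 1 / 2" if "j < p" for j
  proof -
    have "k0 * l1_on S v \<le> k0 * (tmin / 2)"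
      using l1_S_le_qnorm[OF k0, of v] loc1 by simp
    then have "l1_on S v \<le> tmin / 2" using k0 by simp
    then have "l1_on S v / tmin \<le> 1 / 2" using tmin_pos by (simp add: field_simps)
    then show ?thesis unfolding r_def using pert_S_abs_le[OF that, of v] by linarith
  qed
  have lin: "\<bar>\<Sum>j<p. (x j - q j) * r j\<bar> \<le> g * n" and quad: "\<bar>\<Sum>j<p. (x j - q j) * (r j)\<^sup>2\<bar> \<le> \<eta> * n\<^sup>2"
    using ctrl by (auto simp: S_controlled_def Let_def r_def n_def)
  have q2: "(\<Sum>j<p. x j * (r j)\<^sup>2) = n\<^sup>2 + (\<Sum>j<p. (x j - q j) * (r j)\<^sup>2)"
    unfolding n_def qnorm_square by (simp add: left_diff_distrib sum_subtractf)
  have \<eta>n: "\<eta> * n\<^sup>2 \<le> 1 / 2 * n\<^sup>2" using \<eta> by (intro mult_right_mono) auto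
  have xr_low: "n\<^sup>2 / 2 \<le> (\<Sum>j<p. x j * (r j)\<^sup>2)" and xr_up: "(\<Sum>j<p. x j * (r j)\<^sup>2) \<le> 3 / 2 * n\<^sup>2"
    using q2 quad \<eta>n by (auto simp: abs_le_iff)
  have cross: "(\<Sum>j<p. x j * (\<bar>r j\<bar> * z j)) \<le> W * (\<delta> / 4)"
  proof -
    have "(\<Sum>j<p. x j * (\<bar>r j\<bar> * z j)) = (\<Sum>k\<in>Sc. v k * (\<Sum>j<p. x j * (\<bar>r j\<bar> * score k j)))"
      unfolding zj sum_distrib_left by (subst sum.swap) (simp add: mult_ac)
    also have "\<dots> \<le> (\<Sum>k\<in>Sc. v k * (\<delta> / 4))"
    proof (intro sum_mono mult_left_mono vS)
      fix k assume k: "k \<in> Sc"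
      then have kK: "k < K" by simp
      have "(\<Sum>j<p. x j * (\<bar>r j\<bar> * score k j)) = (\<Sum>j<p. x j * (\<bar>r j\<bar> * \<bar>score k j\<bar>))"
        using score_nonneg[OF _ kK] by (intro sum.cong) auto
      also have "\<dots> \<le> sqrt (\<Sum>j<p. x j * (r j)\<^sup>2) * sqrt (\<Sum>j<p. x j * (score k j)\<^sup>2)"
        by (intro sum_mult_le_sqrt xn)
      also have "\<dots> \<le> sqrt (3 / 2 * n\<^sup>2) * sqrt (2 * ratio)"
      proof (intro mult_mono real_sqrt_le_mono xr_up)
        have "(\<Sum>j<p. x j * (score k j)\<^sup>2) \<le> (\<Sum>j<p. ratio * (x j * score k j))"
          unfolding power2_eq_square
        proof (rule sum_mono)
          fix j assume "j \<in> {..<p}"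
          then have "score k j * score k j \<le> ratio * score k j"
            using score_le_Sc[OF k] score_nonneg[OF _ kK] by (intro mult_right_mono) auto
          then show "x j * (score k j * score k j) \<le> ratio * (x j * score k j)"
            using mult_left_mono[OF _ xn, of "score k j * score k j" "ratio * score k j" j] by (simp add: mult_ac)
        qed
        also have "\<dots> = ratio * (Z x k + 1 - leak k)" by (simp add: sum_distrib_left[symmetric] sum_x_score kK)
        also have "\<dots> \<le> ratio * 2"
        proof (intro mult_left_mono ratio_nonneg)
          show "Z x k + 1 - leak k \<le> 2" using \<delta>(1,2)[OF k] \<delta>(3) leak_le_1[OF kK] by linarith
        qed
        finally show "(\<Sum>j<p. x j * (score k j)\<^sup>2) \<le> 2 * ratio" by simp
      qed (auto intro!: sum_nonneg mult_nonneg_nonneg xn)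
      also have "\<dots> = sqrt 3 * (sqrt ratio * n)"
        using n0 by (simp add: real_sqrt_mult[symmetric]) (simp add: real_sqrt_mult)
      also have "\<dots> \<le> 2 * (\<delta> / 8)"
      proof (intro mult_mono)
        show "sqrt 3 \<le> (2::real)" by (rule real_le_lsqrt) auto
      qed (use loc2 n0 ratio_nonneg in \<open>auto simp: n_def r_def\<close>)
      finally show "(\<Sum>j<p. x j * (\<bar>r j\<bar> * score k j)) \<le> \<delta> / 4" by simp
    qed
    also have "\<dots> = W * (\<delta> / 4)" unfolding W_def by (rule sum_distrib_right[symmetric])
    finally show ?thesis .
  qed
  have "0 \<le> (\<Sum>j<p. x j * ln (1 + (r j + z j)))"
    using v by (simp add: ascent_def pert_split[of v] r_def z_def)
  also have "\<dots> \<le> (\<Sum>j<p. x j * (r j - (r j)\<^sup>2 / 5 + z j + 2 * \<bar>r j\<bar> * z j))"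
    using r12 z0 xn by (intro sum_mono mult_left_mono ln_one_plus_add_le) auto
  also have "\<dots> = (\<Sum>j<p. x j * pert v j) - (\<Sum>j<p. x j * (r j)\<^sup>2) / 5 + 2 * (\<Sum>j<p. x j * (\<bar>r j\<bar> * z j))"
    unfolding pert_split[of v] r_def[symmetric] z_def[symmetric]
    by (simp add: distrib_left right_diff_distrib sum.distrib sum_subtractf sum_divide_distrib
        sum_distrib_left mult_ac)
  also have "(\<Sum>j<p. x j * pert v j) = (\<Sum>j<p. (x j - q j) * r j) + (\<Sum>k\<in>Sc. v k * (Z x k - leak k))"
    using sum_x_pert[of v x] v by (simp add: ascent_def sum_S_Z r_def)
  also have "(\<Sum>k\<in>Sc. v k * (Z x k - leak k)) \<le> (\<Sum>k\<in>Sc. v k * (- 3 / 4 * \<delta>))"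
  proof (intro sum_mono mult_left_mono vS)
    fix k assume "k \<in> Sc"
    then show "Z x k - leak k \<le> - 3 / 4 * \<delta>" using \<delta>(1,2)[of k] by simp
  qed
  also have "\<dots> = W * (- 3 / 4 * \<delta>)" unfolding W_def by (rule sum_distrib_right[symmetric])
  finally have "0 \<le> g * n + W * (- 3 / 4 * \<delta>) - n\<^sup>2 / 2 / 5 + 2 * (W * (\<delta> / 4))"
    using lin xr_low cross by (simp add: abs_le_iff)
  moreover have "0 \<le> W * \<delta>" using W0 \<delta>(3) by simp
  ultimately have "n * n \<le> n * (10 * g)" by (simp add: power2_eq_square algebra_simps)
  then have "n \<le> 10 * g" using n0 g by (cases "n = 0") auto
  then show ?thesis by (simp add: n_def r_def)
qed

lemma qnorm_triangle: "qnorm (\<lambda>j. f j + h j) \<le> qnorm f + qnorm h"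
proof -
  have *: "qnorm f = L2_set (\<lambda>j. sqrt (q j) * f j) {..<p}" for f
    unfolding qnorm_def L2_set_def
    by (intro arg_cong[where f = sqrt] sum.cong) (auto simp: power_mult_distrib q_nonneg)
  show ?thesis
    using L2_set_triangle_ineq[of "\<lambda>j. sqrt (q j) * f j" "\<lambda>j. sqrt (q j) * h j" "{..<p}"]
    by (simp add: * distrib_left)
qed

text \<open>When inactive scores are bounded, noise \<open>z0\<close> of the order of the rate can be afforded for the inactive
  topics as well, and the empirical quadratic form is comparable with its mean on the whole cone.\<close>

lemma unpenalised_local_bound:
  assumes x: "x \<in> set_pmf law" and v: "ascent x v" and k0: "0 < k0" "k0 \<le> kappa J K A s"
    and ctrl: "S_controlled g \<eta> x" and g: "0 < g" and \<eta>: "0 < \<eta>" "\<eta> * \<gamma>\<^sup>2 \<le> 1 / 4"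
    and \<gamma>: "\<gamma> = 1 + sqrt R / k0" and R: "ratio \<le> R"
    and z0: "\<And>k. k \<in> Sc \<Longrightarrow> Z x k \<le> z0" "0 \<le> z0"
    and D: "\<And>k l. k < K \<Longrightarrow> l \<in> Sc \<Longrightarrow> \<bar>gram_dev x k l\<bar> \<le> k0\<^sup>2 / 8"
    and loc: "qnorm (pert v) \<le> k0 / (1 / tmin + R)"
  shows "qnorm (pert v) \<le> 12 * (\<gamma> * g + z0 / k0)"
proof -
  define e where "e = pert v"
  define r where "r = active v"
  define z where "z = pert (restrict_to Sc v)"
  define Q where "Q = qnorm e"
  define W where "W = (\<Sum>k\<in>Sc. v k)"
  define l where "l = l1 v"
  have R0: "0 \<le> R" using R ratio_nonneg by simp
  have Q0: "0 \<le> Q" unfolding Q_def by (rule qnorm_nonneg)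
  have l0: "0 \<le> l" unfolding l_def by (rule l1_nonneg)
  have xn: "\<And>j. 0 \<le> x j" using data_nonneg[OF x] .
  have vS: "0 \<le> v k" if "k \<in> Sc" for k using v that by (auto simp: ascent_def)
  have W0: "0 \<le> W" unfolding W_def using vS by (rule sum_nonneg)
  have Wl: "W \<le> l" using l1_nonneg[of S v] l1_Sc_ascent[OF v] by (simp add: l_def l1_split W_def)
  have lQ: "k0 * l \<le> Q" unfolding l_def Q_def e_def by (rule l1_le_qnorm[OF k0 ascent_in_cone[OF v]])
  then have lQ': "l \<le> Q / k0" using k0 by (simp add: field_simps)
  have er: "e j = r j + z j" for j by (simp add: e_def r_def z_def pert_split[of v])
  have zj: "z j = (\<Sum>k\<in>Sc. v k * score k j)" for j by (simp add: z_def pert_restrict)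
  have tR: "0 < 1 / tmin + R" using tmin_pos R0 by (simp add: add_pos_nonneg)
  have e1: "\<bar>e j\<bar> \<le> 1" if j: "j < p" for j
  proof -
    have "\<bar>e j\<bar> \<le> (1 / tmin + R) * l"
      unfolding e_def l_def
    proof (rule pert_abs_le[OF j])
      fix k assume "k < K"
      then show "score k j \<le> 1 / tmin + R"
        by (rule score_le[OF _ j R])
    qed
    also have "\<dots> \<le> (1 / tmin + R) * (Q / k0)" using tR lQ' by (intro mult_left_mono) auto
    also have "\<dots> \<le> (1 / tmin + R) * (1 / (1 / tmin + R))"
    proof (intro mult_left_mono)
      show "Q / k0 \<le> 1 / (1 / tmin + R)" using loc k0 tR by (simp add: Q_def e_def field_simps)
    qed (use tR in auto)
    finally show ?thesis using tR by simp
  qed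
  have zW: "qnorm z \<le> sqrt R * W"
  proof -
    have zb: "0 \<le> z j" "z j \<le> R * W" if "j < p" for j
    proof -
      show "0 \<le> z j" unfolding zj using vS score_nonneg that by (intro sum_nonneg mult_nonneg_nonneg) auto
      have "z j \<le> (\<Sum>k\<in>Sc. v k * R)"
        unfolding zj using vS score_le_Sc[OF _ that] R by (intro sum_mono mult_left_mono) (auto intro: order.trans)
      then show "z j \<le> R * W" by (simp add: W_def sum_distrib_left mult.commute[of R])
    qed
    have "(\<Sum>j<p. q j * z j) = (\<Sum>k\<in>Sc. v k * (\<Sum>j<p. q j * score k j))"
      unfolding zj sum_distrib_left by (subst sum.swap) (simp add: mult_ac)
    also have "\<dots> \<le> (\<Sum>k\<in>Sc. v k * 1)"
      using vS leak_nonneg by (intro sum_mono mult_left_mono) (auto simp: sum_q_score)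
    finally have qz: "(\<Sum>j<p. q j * z j) \<le> W" by (simp add: W_def)
    have "(\<Sum>j<p. q j * (z j)\<^sup>2) \<le> (\<Sum>j<p. R * W * (q j * z j))"
      unfolding power2_eq_square
    proof (rule sum_mono)
      fix j assume "j \<in> {..<p}"
      then show "q j * (z j * z j) \<le> R * W * (q j * z j)"
        using mult_left_mono[OF mult_right_mono[OF zb(2) zb(1)] q_nonneg, of j j j] by (simp add: mult_ac)
    qed
    also have "\<dots> \<le> R * W * W"
      unfolding sum_distrib_left[symmetric] using qz R0 W0 by (intro mult_left_mono) auto
    finally have "qnorm z \<le> sqrt (R * W * W)" unfolding qnorm_def by (rule real_sqrt_le_mono)
    also have "R * W * W = R * W\<^sup>2" by (simp add: power2_eq_square)
    also have "sqrt (R * W\<^sup>2) = sqrt R * W" using W0 by (simp add: real_sqrt_mult)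
    finally show ?thesis .
  qed
  have nr: "qnorm r \<le> \<gamma> * Q"
  proof -
    have "qnorm r = qnorm (\<lambda>j. e j + - 1 * z j)" by (simp add: er)
    also have "\<dots> \<le> qnorm e + qnorm (\<lambda>j. - 1 * z j)" by (rule qnorm_triangle)
    also have "qnorm (\<lambda>j. - 1 * z j) = qnorm z" by (simp add: qnorm_def)
    also have "qnorm z \<le> sqrt R * (Q / k0)"
      using zW Wl lQ' R0 by (meson mult_left_mono order.trans real_sqrt_ge_zero)
    finally show ?thesis using k0 by (simp add: \<gamma> Q_def algebra_simps)
  qed
  have \<gamma>0: "0 \<le> \<gamma>" using \<gamma> R0 k0 by simp
  have lin: "\<bar>\<Sum>j<p. (x j - q j) * r j\<bar> \<le> g * qnorm r" and quad: "\<bar>\<Sum>j<p. (x j - q j) * (r j)\<^sup>2\<bar> \<le> \<eta> * (qnorm r)\<^sup>2"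
    using ctrl by (auto simp: S_controlled_def Let_def r_def)
  have quad': "\<bar>\<Sum>j<p. (x j - q j) * (r j)\<^sup>2\<bar> \<le> Q\<^sup>2 / 4"
  proof -
    have "\<eta> * (qnorm r)\<^sup>2 \<le> \<eta> * (\<gamma> * Q)\<^sup>2"
      using \<eta> nr qnorm_nonneg by (intro mult_left_mono power_mono) auto
    also have "\<dots> = (\<eta> * \<gamma>\<^sup>2) * Q\<^sup>2" by (simp add: power_mult_distrib)
    also have "\<dots> \<le> 1 / 4 * Q\<^sup>2" using \<eta> by (intro mult_right_mono) auto
    finally show ?thesis using quad by simp
  qed
  have mixed: "\<bar>\<Sum>j<p. (x j - q j) * (z j * (r j + e j))\<bar> \<le> Q\<^sup>2 / 4"
  proof -
    define w where "w k = restrict_to S v k + v k" for k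
    have re: "r j + e j = (\<Sum>k<K. w k * score k j)" for j
      unfolding r_def e_def w_def pert_add[symmetric] by (simp add: pert_def)
    have w1: "(\<Sum>k<K. \<bar>w k\<bar>) \<le> 2 * l"
      unfolding l_def l1_on_def sum_distrib_left by (intro sum_mono) (auto simp: w_def restrict_to_def)
    have "(\<Sum>j<p. (x j - q j) * (z j * (r j + e j)))
        = (\<Sum>j<p. \<Sum>m\<in>Sc. \<Sum>k<K. v m * w k * ((x j - q j) * (score k j * score m j)))"
    proof (intro sum.cong refl)
      fix j
      have "z j * (r j + e j) = (\<Sum>m\<in>Sc. \<Sum>k<K. (v m * score m j) * (w k * score k j))"
        unfolding re zj by (rule sum_product)
      then show "(x j - q j) * (z j * (r j + e j))
          = (\<Sum>m\<in>Sc. \<Sum>k<K. v m * w k * ((x j - q j) * (score k j * score m j)))"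
        by (simp add: sum_distrib_left mult_ac)
    qed
    also have "\<dots> = (\<Sum>m\<in>Sc. \<Sum>j<p. \<Sum>k<K. v m * w k * ((x j - q j) * (score k j * score m j)))"
      by (rule sum.swap)
    also have "\<dots> = (\<Sum>m\<in>Sc. \<Sum>k<K. \<Sum>j<p. v m * w k * ((x j - q j) * (score k j * score m j)))"
      by (intro sum.cong refl sum.swap)
    also have "\<dots> = (\<Sum>m\<in>Sc. \<Sum>k<K. v m * w k * gram_dev x k m)"
      unfolding gram_dev_def sum_distrib_left ..
    finally have "\<bar>\<Sum>j<p. (x j - q j) * (z j * (r j + e j))\<bar> \<le> (\<Sum>m\<in>Sc. \<Sum>k<K. \<bar>v m * w k * gram_dev x k m\<bar>)"
      by (auto intro!: order.trans[OF sum_abs] sum_mono)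
    also have "\<dots> \<le> (\<Sum>m\<in>Sc. \<Sum>k<K. v m * \<bar>w k\<bar> * (k0\<^sup>2 / 8))"
    proof (intro sum_mono)
      fix m k assume m: "m \<in> Sc" and k: "k \<in> {..<K}"
      have "\<bar>v m * w k * gram_dev x k m\<bar> = v m * \<bar>w k\<bar> * \<bar>gram_dev x k m\<bar>"
        using vS[OF m] by (simp add: abs_mult)
      also have "\<dots> \<le> v m * \<bar>w k\<bar> * (k0\<^sup>2 / 8)"
        using D[OF _ m, of k] k vS[OF m] by (intro mult_left_mono) auto
      finally show "\<bar>v m * w k * gram_dev x k m\<bar> \<le> v m * \<bar>w k\<bar> * (k0\<^sup>2 / 8)" .
    qed
    also have "\<dots> = W * (\<Sum>k<K. \<bar>w k\<bar>) * (k0\<^sup>2 / 8)"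
      unfolding W_def sum_product by (simp only: sum_distrib_right)
    also have "\<dots> \<le> l * (2 * l) * (k0\<^sup>2 / 8)"
      using Wl w1 W0 l0 by (intro mult_right_mono mult_mono) (auto intro: sum_nonneg)
    also have "\<dots> = (k0 * l)\<^sup>2 / 4" by (simp add: power2_eq_square)
    also have "\<dots> \<le> Q\<^sup>2 / 4" using lQ k0 l0 by (intro divide_right_mono power_mono) auto
    finally show ?thesis .
  qed
  have xe: "Q\<^sup>2 / 2 \<le> (\<Sum>j<p. x j * (e j)\<^sup>2)"
  proof -
    have "(\<Sum>j<p. x j * (e j)\<^sup>2) = (\<Sum>j<p. q j * (e j)\<^sup>2) + (\<Sum>j<p. (x j - q j) * (e j)\<^sup>2)"
      by (simp add: sum.distrib[symmetric] algebra_simps)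
    also have "(\<Sum>j<p. q j * (e j)\<^sup>2) = Q\<^sup>2" by (simp add: Q_def qnorm_square)
    also have "(\<Sum>j<p. (x j - q j) * (e j)\<^sup>2)
        = (\<Sum>j<p. (x j - q j) * (r j)\<^sup>2) + (\<Sum>j<p. (x j - q j) * (z j * (r j + e j)))"
      unfolding sum.distrib[symmetric] by (intro sum.cong) (auto simp: er power2_eq_square algebra_simps)
    finally show ?thesis using quad' mixed by (simp add: abs_le_iff)
  qed
  have "0 \<le> (\<Sum>j<p. x j * ln (1 + e j))" using v by (simp add: ascent_def e_def)
  also have "\<dots> \<le> (\<Sum>j<p. x j * (e j - (e j)\<^sup>2 / 6))"
  proof (intro sum_mono)
    fix j assume j: "j \<in> {..<p}"
    show "x j * ln (1 + e j) \<le> x j * (e j - (e j)\<^sup>2 / 6)"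
    proof (cases "x j > 0")
      case True
      then have em: "e j > -1" using v j by (auto simp: ascent_def e_def)
      have "ln (1 + e j) \<le> e j - (e j)\<^sup>2 / (2 * (2 + e j))" by (rule ln_one_plus_le[OF em])
      also have "\<dots> \<le> e j - (e j)\<^sup>2 / 6"
        using em e1[of j] j by (intro diff_left_mono divide_left_mono mult_pos_pos) auto
      finally show ?thesis using xn by (intro mult_left_mono) auto
    next
      case False
      then have "x j = 0" using xn[of j] by simp
      then show ?thesis by simp
    qed
  qed
  also have "\<dots> = (\<Sum>j<p. x j * e j) - (\<Sum>j<p. x j * (e j)\<^sup>2) / 6"
    by (simp add: right_diff_distrib sum_subtractf sum_divide_distrib)
  also have "(\<Sum>j<p. x j * e j) = (\<Sum>j<p. (x j - q j) * r j) + (\<Sum>k\<in>Sc. v k * (Z x k - leak k))"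
    using sum_x_pert[of v x] v by (simp add: ascent_def sum_S_Z r_def e_def)
  also have "(\<Sum>k\<in>Sc. v k * (Z x k - leak k)) \<le> (\<Sum>k\<in>Sc. v k * z0)"
  proof (intro sum_mono mult_left_mono vS)
    fix k assume "k \<in> Sc"
    then show "Z x k - leak k \<le> z0" using z0(1)[of k] leak_nonneg[of k] by simp
  qed
  also have "\<dots> = W * z0" by (simp add: W_def sum_distrib_right)
  finally have "Q\<^sup>2 / 12 \<le> g * qnorm r + W * z0" using lin xe by (simp add: abs_le_iff)
  also have "\<dots> \<le> g * (\<gamma> * Q) + Q / k0 * z0"
    using nr g Wl lQ' z0(2) by (intro add_mono mult_left_mono mult_right_mono) auto
  finally have "Q * Q \<le> Q * (12 * (\<gamma> * g + z0 / k0))" by (simp add: power2_eq_square algebra_simps)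
  then have "Q \<le> 12 * (\<gamma> * g + z0 / k0)" using Q0 g z0(2) k0 \<gamma>0 by (cases "Q = 0") auto
  then show ?thesis by (simp add: Q_def e_def)
qed

end

section \<open>The fast rate\<close>

text \<open>An arbitrary factor \<open>M\<close> is gained for large \<open>N\<close>: if \<open>s\<close> is large, then \<open>log s\<close> provides it;
  if \<open>s\<close> is bounded and \<open>T\<^sub>m\<^sub>i\<^sub>n\<close> is small, the third power of \<open>T\<^sub>m\<^sub>i\<^sub>n\<close> does; otherwise \<open>N\<close> itself does.\<close>

lemma sample_size_gain:
  fixes M :: real
  assumes M: "1 \<le> M"
  shows "\<exists>N0 > 0. \<forall>N p K s A T. topic_instance N p K s A T \<longrightarrow> real N * (T_min K T)^3 \<ge> ln (real s) \<longrightarrow>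
    real N \<ge> N0 \<longrightarrow> real N * (T_min K T)\<^sup>2 \<ge> M * real s"
proof -
  define s0 where "s0 = exp M"
  define t0 where "t0 = ln 2 / (M * s0)"
  define N0 where "N0 = max M (M * s0 / t0\<^sup>2)"
  have s0: "s0 > 0" and t0: "t0 > 0" using M by (auto simp: s0_def t0_def)
  have N0: "N0 > 0" using M by (simp add: N0_def)
  show ?thesis
  proof (intro exI[of _ N0] conjI N0 allI impI)
    fix N p K s A T
    assume inst: "topic_instance N p K s A T" and cond: "real N * (T_min K T)^3 \<ge> ln (real s)"
      and N: "real N \<ge> N0"
    interpret topic_instance N p K s A T by (rule inst)
    show "real N * tmin\<^sup>2 \<ge> M * real s"
    proof (cases "s = 1")
      case True
      then show ?thesis using N by (simp add: tmin_eq_1 N0_def)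
    next
      case False
      then have s2: "2 \<le> s" using s_pos by simp
      have gain: "y / tmin \<le> real N * tmin\<^sup>2" if "y \<le> ln (real s)" for y
      proof -
        have "y \<le> (real N * tmin\<^sup>2) * tmin" using that cond by (simp add: power2_eq_square power3_eq_cube mult_ac)
        then show ?thesis using tmin_pos by (simp add: field_simps)
      qed
      have st: "real s \<le> 1 / tmin" using s_tmin tmin_pos by (simp add: field_simps)
      show ?thesis
      proof (cases "s0 \<le> real s")
        case True
        then have "M \<le> ln (real s)" using s2 s0 by (simp add: s0_def ln_ge_iff)
        have "M * real s \<le> M * (1 / tmin)" using M st by (intro mult_left_mono) auto
        also have "\<dots> \<le> real N * tmin\<^sup>2" using gain[OF \<open>M \<le> ln (real s)\<close>] by simp
        finally show ?thesis .
      next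
        case False
        have Ms: "M * real s \<le> M * s0" using False M by (intro mult_left_mono) auto
        show ?thesis
        proof (cases "tmin \<le> t0")
          case True
          have "M * s0 = ln 2 / t0" using M s0 by (simp add: t0_def)
          also have "\<dots> \<le> ln 2 / tmin" using True tmin_pos t0 by (intro divide_left_mono) auto
          also have "\<dots> \<le> real N * tmin\<^sup>2" using s2 by (intro gain) auto
          finally show ?thesis using Ms by simp
        next
          case False
          have "M * s0 = M * s0 / t0\<^sup>2 * t0\<^sup>2" using t0 by simp
          also have "\<dots> \<le> N0 * t0\<^sup>2" by (intro mult_right_mono) (auto simp: N0_def)
          also have "\<dots> \<le> real N * tmin\<^sup>2"
            using N N0 False t0 by (intro mult_mono power_mono) auto
          finally show ?thesis using Ms by simp
        qed
      qed
    qed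
  qed
qed

context topic_instance
begin

text \<open>The first regime: \<open>ratio * log K\<close> is large.  The separation hypothesis then gives more than a union
  bound over \<open>K\<close> topics requires: the excess factor \<open>e\<^sup>-\<^sup>R\<close> is arbitrarily small even for bounded \<open>K\<close>, and
  the cross term stays below the leaked mass at errors of any fixed multiple of the rate.\<close>

lemma fast_rate_leaking:
  fixes \<delta> \<beta> R k0 :: real
  assumes k0: "0 < k0" "k0 \<le> kappa J K A s" and \<beta>: "0 < \<beta>" and R: "R = 50 * \<beta>\<^sup>2 + R0" "1 \<le> R0"
    and \<delta>: "\<And>k. k \<in> Sc \<Longrightarrow> \<delta> \<le> leak k" "0 \<le> \<delta>"
    and c1: "144 * (ratio\<^sup>2 * real s * ln (real K)) \<le> \<delta>\<^sup>2 * real N"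
    and c2: "144 * (ratio * ln (real K)) \<le> \<delta>\<^sup>2 * real N"
    and big: "R \<le> ratio * ln (real K)"
    and size: "401 * \<beta>\<^sup>2 / k0\<^sup>2 * (real s / real N) \<le> tmin\<^sup>2"
    and g: "g = \<beta> * sqrt (real s / real N)"
  shows "Pr {x. far x (20 / k0 * g)}
    \<le> Pr {x. \<not> S_controlled g (1/2) x} + exp (- R)"
proof -
  have sp: "0 < real s" and Np: "0 < real N" using s_pos N_pos by auto
  have lK: "0 < ln (real K)" by (rule ln_K_pos)
  have Rp: "0 < R" using R by (simp add: add_nonneg_pos)
  have rp: "0 < ratio"
    using big Rp lK ratio_nonneg by (metis less_le_trans mult_zero_left order_le_less)
  have "0 < \<delta>\<^sup>2 * real N" using c2 rp lK by (auto intro: less_le_trans[rotated])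
  then have \<delta>p: "0 < \<delta>" using \<delta>(2) by (cases "\<delta> = 0") auto
  have \<delta>1: "\<delta> \<le> 1"
  proof -
    obtain k where k: "k \<in> Sc" using Sc_nonempty by auto
    then show ?thesis using \<delta>(1)[OF k] leak_le_1[of k] by simp
  qed
  have gp: "0 < g" using \<beta> sp Np by (simp add: g)
  have g2: "g\<^sup>2 = \<beta>\<^sup>2 * (real s / real N)" using sp Np by (simp add: g power_mult_distrib)
  have tail: "Pr {x. \<exists>k\<in>Sc. Z x k > \<delta> / 4} \<le> exp (- R)"
  proof -
    define E where "E = real N * min ((\<delta> / 4)\<^sup>2 / (4 * ratio)) (\<delta> / 4 / (2 * ratio))"
    have "ln (real K) + R \<le> E"
    proof -
      \<comment> \<open>Half of each separation hypothesis: \<open>c1\<close> contributes \<open>R\<close> to the exponent, \<open>c2\<close> contributes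
          \<open>log K\<close>.\<close>
      have "ratio * R \<le> ratio * (ratio * ln (real K)) * 1" using big rp by simp
      also have "\<dots> \<le> ratio * (ratio * ln (real K)) * real s"
        using rp lK s_pos by (intro mult_left_mono) auto
      finally have "144 * (ratio * R) \<le> \<delta>\<^sup>2 * real N"
        using c1 by (simp add: power2_eq_square mult_ac)
      then have "72 * (ratio * (ln (real K) + R)) \<le> \<delta>\<^sup>2 * real N" using c2 by (simp add: distrib_left)
      then have "64 * (ratio * (ln (real K) + R)) \<le> \<delta>\<^sup>2 * real N"
        using rp lK Rp by (smt (verit) mult_pos_pos)
      then have "ln (real K) + R \<le> real N * (\<delta>\<^sup>2 / (64 * ratio))" using rp by (simp add: field_simps)
      also have "\<dots> \<le> E"
      proof -
        have "\<delta>\<^sup>2 / (64 * ratio) = (\<delta> / 4)\<^sup>2 / (4 * ratio)" by (simp add: power_divide)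
        moreover have "\<delta>\<^sup>2 / (64 * ratio) \<le> \<delta> / 4 / (2 * ratio)"
        proof -
          have "\<delta>\<^sup>2 \<le> \<delta> * 8" using \<delta>p \<delta>1 by (simp add: power2_eq_square)
          then have "\<delta>\<^sup>2 / (64 * ratio) \<le> \<delta> * 8 / (64 * ratio)" using rp by (intro divide_right_mono) auto
          also have "\<dots> = \<delta> / 4 / (2 * ratio)" by simp
          finally show ?thesis .
        qed
        ultimately show ?thesis unfolding E_def by (intro mult_left_mono) auto
      qed
      finally show ?thesis .
    qed
    have "Pr {x. \<exists>k\<in>Sc. Z x k > \<delta> / 4} \<le> (\<Sum>k\<in>Sc. exp (- E))"
      unfolding E_def using rp \<delta>p score_le_Sc by (intro prob_Bex_le Z_upper_tail) auto
    also have "\<dots> \<le> real K * exp (- E)"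
      using card_mono[of "{..<K}" Sc] by (simp add: mult_right_mono)
    also have "\<dots> \<le> real K * exp (- (ln (real K) + R))" using \<open>ln (real K) + R \<le> E\<close> by (intro mult_left_mono) auto
    also have "\<dots> = exp (- R)" using K_pos by (simp add: exp_minus exp_diff divide_inverse)
    finally show ?thesis .
  qed
  have "Pr {x. far x (20 / k0 * g)}
      \<le> Pr {x. \<not> S_controlled g (1/2) x \<or> (\<exists>k\<in>Sc. Z x k > \<delta> / 4)}"
  proof (rule prob_mono_on_support, rule ccontr)
    fix x assume x: "x \<in> set_pmf law" and ex: "far x (20 / k0 * g)"
      and bad: "\<not> (\<not> S_controlled g (1/2) x \<or> (\<exists>k\<in>Sc. Z x k > \<delta> / 4))"
    from ex obtain v where v: "ascent x v" "l1 v > 20 / k0 * g" by (auto simp: far_def)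
    define n where "n = qnorm (active v)"
    define \<tau> where "\<tau> = min (k0 * tmin / 2) (\<delta> / (8 * sqrt ratio))"
    have "n \<le> 10 * g"
    proof (rule shrinking_bound)
      show "10 * g < \<tau>"
      proof -
        have "(10 * g)\<^sup>2 < (k0 * tmin / 2)\<^sup>2"
        proof -
          have "0 < \<beta>\<^sup>2 * (real s / real N)" using \<beta> sp Np by simp
          then have "400 * (\<beta>\<^sup>2 * (real s / real N)) < 401 * (\<beta>\<^sup>2 * (real s / real N))" by linarith
          also have "\<dots> = k0\<^sup>2 * (401 * \<beta>\<^sup>2 / k0\<^sup>2 * (real s / real N))" using k0 by simp
          also have "\<dots> \<le> k0\<^sup>2 * tmin\<^sup>2" by (intro mult_left_mono size) auto
          finally show ?thesis by (simp add: power_mult_distrib power_divide g2)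
        qed
        then have 1: "10 * g < k0 * tmin / 2"
          by (rule power2_less_imp_less) (use k0 tmin_pos in auto)
        have "(10 * g)\<^sup>2 < (\<delta> / (8 * sqrt ratio))\<^sup>2"
        proof -
          have "(144 * (50 * \<beta>\<^sup>2)) * (ratio * real s) < (144 * R) * (ratio * real s)"
            using R rp sp by (intro mult_strict_right_mono) auto
          also have "\<dots> \<le> (144 * (ratio * ln (real K))) * (ratio * real s)"
            using big rp sp by (intro mult_right_mono mult_left_mono) auto
          also have "\<dots> \<le> \<delta>\<^sup>2 * real N" using c1 by (simp add: power2_eq_square mult_ac)
          finally have "7200 * \<beta>\<^sup>2 * (ratio * real s) < \<delta>\<^sup>2 * real N" by simp
          moreover have "6400 * \<beta>\<^sup>2 * (ratio * real s) \<le> 7200 * \<beta>\<^sup>2 * (ratio * real s)"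
            using rp by (intro mult_right_mono) auto
          ultimately have "6400 * \<beta>\<^sup>2 * (ratio * real s) < \<delta>\<^sup>2 * real N" by linarith
          then have "100 * (\<beta>\<^sup>2 * (real s / real N)) < \<delta>\<^sup>2 / (64 * ratio)"
            using Np rp by (simp add: field_simps)
          then show ?thesis using rp by (simp add: power_mult_distrib power_divide g2)
        qed
        then have 2: "10 * g < \<delta> / (8 * sqrt ratio)"
          by (rule power2_less_imp_less) (use \<delta>p rp in auto)
        show ?thesis using 1 2 by (simp add: \<tau>_def)
      qed
      show "0 \<le> \<tau>" unfolding \<tau>_def using k0 tmin_pos \<delta>p rp by simp
      fix c :: real assume c: "0 \<le> c" "c \<le> 1" "c * n \<le> \<tau>"
      let ?v = "\<lambda>k. c * v k"
      have "active ?v = (\<lambda>j. c * active v j)"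
        by (auto simp: pert_restrict[OF S_sub] sum_distrib_left mult_ac)
      then have cn: "qnorm (active ?v) = c * n" using c by (simp add: qnorm_scale n_def)
      have "qnorm (active ?v) \<le> 10 * g"
      proof (rule penalised_local_bound[OF x ascent_scale[OF x v(1) c(1,2)] k0 _ gp _ \<delta>(1) _ \<delta>(2)])
        show "S_controlled g (1/2) x" using bad by simp
        show "Z x k \<le> \<delta> / 4" if "k \<in> Sc" for k
          using bad that by (meson not_less)
        show "qnorm (active ?v) \<le> k0 * tmin / 2"
          unfolding cn using c(3) by (simp add: \<tau>_def)
        have "c * n \<le> \<delta> / (8 * sqrt ratio)" using c(3) by (simp add: \<tau>_def)
        then show "sqrt ratio * qnorm (active ?v) \<le> \<delta> / 8"
          unfolding cn using rp by (simp add: field_simps)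
      qed auto
      then show "c * n \<le> 10 * g" by (simp add: cn)
    qed
    moreover have "k0 * l1_on S v \<le> n" unfolding n_def by (rule l1_S_le_qnorm[OF k0])
    moreover have "l1 v \<le> 2 * l1_on S v"
      using ascent_in_cone[OF v(1)] by (simp add: l1_split in_cone_def)
    ultimately have "k0 * l1 v \<le> 20 * g"
      using mult_left_mono[of "l1 v" "2 * l1_on S v" k0] k0 by linarith
    then have "l1 v \<le> 20 / k0 * g" using k0 by (simp add: field_simps)
    then show False using v(2) by simp
  qed
  also have "\<dots> \<le> Pr {x. \<not> S_controlled g (1/2) x} + exp (- R)"
    by (intro order.trans[OF prob_disj_le] add_left_mono tail)
  finally show ?thesis .
qed

text \<open>The complementary regime: \<open>ratio \<le> R / log K\<close>.  Bernstein's bound with this value absorbs the logarithm of the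
  number of inactive topics into the constant \<open>R\<close>.\<close>

lemma fast_rate_light:
  fixes \<beta> R R' k0 :: real
  assumes k0: "0 < k0" "k0 \<le> kappa J K A s" and \<beta>: "0 < \<beta>" and R: "1 \<le> R" "R' = R / ln 2"
    and small: "ratio * ln (real K) \<le> R"
    and \<gamma>: "\<gamma> = 1 + sqrt R' / k0" and \<eta>: "\<eta> = 1 / (4 * \<gamma>\<^sup>2)"
    and G: "G = 12 * (\<gamma> * \<beta> + 4 * R * (real m + 1) / k0)"
    and g: "g = \<beta> * sqrt (real s / real N)"
    and size: "(G * (1 + R') / k0 + 1)\<^sup>2 * (real s / real N) \<le> tmin\<^sup>2"
    and size2: "(real m + 2) * (1 + R') * (256 * R * R' / k0^4 + 16 * R / k0\<^sup>2) * (real s / real N) \<le> tmin\<^sup>2"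
  shows "Pr {x. far x (G / k0 * sqrt (real s / real N))}
    \<le> Pr {x. \<not> S_controlled g \<eta> x} + 3 / 2 ^ m"
proof -
  define rate where "rate = sqrt (real s / real N)"
  define \<rho> where "\<rho> = R / ln (real K)"
  define z0 where "z0 = 4 * R * (real m + 1) / sqrt (real N)"
  define b where "b = (1 / tmin + R') * \<rho>"
  have sp: "1 \<le> real s" and Np: "1 \<le> real N" using s_pos N_pos by auto
  have lK: "0 < ln (real K)" by (rule ln_K_pos)
  have l2K: "ln 2 \<le> ln (real K)" using K_ge_2 by simp
  have ratep: "0 < rate" unfolding rate_def using sp Np by simp
  have gp: "0 < g" using \<beta> ratep by (simp add: g rate_def)
  have \<rho>: "0 < \<rho>" "ratio \<le> \<rho>" "\<rho> \<le> R'"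
  proof -
    show "0 < \<rho>" using R lK by (simp add: \<rho>_def)
    show "ratio \<le> \<rho>" using small lK by (simp add: \<rho>_def field_simps)
    show "\<rho> \<le> R'" unfolding \<rho>_def R(2) using R l2K lK by (intro divide_left_mono) auto
  qed
  have R'p: "0 < R'" using \<rho> by simp
  have \<gamma>1: "1 \<le> \<gamma>" using \<gamma> R'p k0 by simp
  have Gp: "0 < G" unfolding G using \<gamma>1 \<beta> R k0 by (intro mult_pos_pos add_pos_nonneg) auto
  have z0p: "0 < z0" unfolding z0_def using R Np by simp
  have Ztail: "Pr {x. \<exists>k\<in>Sc. Z x k > z0} \<le> 1 / 2 ^ m"
  proof (rule Z_max_tail(1)[OF _ \<rho>(1) _ z0p])
    show "Sc \<subseteq> {..<K}" by auto
    show "score k j \<le> \<rho>" if "k \<in> Sc" "j < p" for k j using score_le_Sc[OF that] \<rho> by simp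
    have m1: "1 \<le> real m + 1" by simp
    have e1: "real N * (z0\<^sup>2 / (4 * \<rho>)) = 4 * R * (real m + 1)\<^sup>2 * ln (real K)"
      using Np R lK by (simp add: z0_def \<rho>_def power_divide power_mult_distrib) (simp add: power2_eq_square)
    have e2: "real N * (z0 / (2 * \<rho>)) = 2 * sqrt (real N) * (real m + 1) * ln (real K)"
    proof -
      have "real N / sqrt (real N) = sqrt (real N)" by (rule real_div_sqrt) simp
      moreover have "real N * (z0 / (2 * \<rho>)) = 2 * (real N / sqrt (real N)) * (real m + 1) * ln (real K)"
        using R lK Np real_sqrt_gt_zero[of "real N"] by (simp add: z0_def \<rho>_def field_simps)
      ultimately show ?thesis by simp
    qed
    have "(real m + 1) * ln (real K) \<le> 4 * R * (real m + 1)\<^sup>2 * ln (real K)"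
    proof (rule mult_right_mono)
      have "1 * (1 * (real m + 1)) \<le> 4 * R * ((real m + 1) * (real m + 1))"
        using R m1 by (intro mult_mono) auto
      then show "real m + 1 \<le> 4 * R * (real m + 1)\<^sup>2" by (simp add: power2_eq_square)
    qed (use lK in auto)
    moreover have "(real m + 1) * ln (real K) \<le> 2 * sqrt (real N) * (real m + 1) * ln (real K)"
    proof (rule mult_right_mono)
      have "1 * (real m + 1) \<le> (2 * sqrt (real N)) * (real m + 1)"
      proof (intro mult_right_mono)
        show "1 \<le> 2 * sqrt (real N)" using real_sqrt_ge_one[OF Np] by linarith
      qed auto
      then show "real m + 1 \<le> 2 * sqrt (real N) * (real m + 1)" by simp
    qed (use lK in auto)
    ultimately have "(real m + 1) * ln (real K) \<le> min (real N * (z0\<^sup>2 / (4 * \<rho>))) (real N * (z0 / (2 * \<rho>)))"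
      unfolding e1 e2 by simp
    also have "\<dots> = real N * min (z0\<^sup>2 / (4 * \<rho>)) (z0 / (2 * \<rho>))"
      by (simp add: min_mult_distrib_left)
    finally show "(real m + 1) * ln (real K) \<le> real N * min (z0\<^sup>2 / (4 * \<rho>)) (z0 / (2 * \<rho>))" .
  qed
  \<comment> \<open>The accuracy that the local bound demands of the Gram entries; \<open>t\<^sup>2 / 4 = k0\<^sup>4 / 256\<close> and
      \<open>t / 2 = k0\<^sup>2 / 16\<close> are the constants in \<open>size2\<close>.\<close>
  define t where "t = k0\<^sup>2 / 8"
  have tp: "0 < t" using k0 by (simp add: t_def)
  have bp: "0 < b" unfolding b_def using \<rho> R'p tmin_pos by (simp add: add_pos_pos)
  have Dtail: "Pr {x. \<exists>k\<in>{..<K}. \<exists>l\<in>Sc. \<bar>gram_dev x k l\<bar> > t} \<le> 2 / 2 ^ m"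
  proof -
    define E where "E = real N * min (t\<^sup>2 / (4 * (b * R'))) (t / (2 * b))"
    have fb: "b \<le> (1 + R') * R / (tmin * ln (real K))"
    proof -
      have "1 / tmin + R' \<le> 1 / tmin + R' / tmin"
        using tmin_le_1 tmin_pos R'p by (simp add: field_simps)
      then have "b \<le> (1 / tmin + R' / tmin) * \<rho>" unfolding b_def using \<rho> by (intro mult_right_mono) auto
      also have "\<dots> = (1 + R') * R / (tmin * ln (real K))" by (simp add: \<rho>_def add_divide_distrib[symmetric])
      finally show ?thesis .
    qed
    have Nt: "(real m + 2) * (1 + R') * (256 * R * R' / k0^4 + 16 * R / k0\<^sup>2) \<le> real N * tmin"
    proof -
      let ?c = "(real m + 2) * (1 + R') * (256 * R * R' / k0^4 + 16 * R / k0\<^sup>2)"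
      have c0: "0 \<le> ?c" using R R'p k0 by (intro mult_nonneg_nonneg add_nonneg_nonneg divide_nonneg_nonneg) auto
      have "?c * 1 \<le> ?c * real s" using c0 sp by (intro mult_left_mono)
      also have "\<dots> \<le> real N * tmin\<^sup>2" using size2 Np by (simp add: field_simps)
      also have "\<dots> \<le> real N * (tmin * 1)"
        unfolding power2_eq_square using tmin_pos tmin_le_1 by (intro mult_left_mono) auto
      finally show ?thesis by simp
    qed
    have ge: "(real m + 2) * ln (real K) * y * b \<le> real N"
      if y: "0 \<le> y" "y * R \<le> 256 * R * R' / k0^4 + 16 * R / k0\<^sup>2" for y
    proof -
      have "(real m + 2) * ln (real K) * y * b \<le> (real m + 2) * ln (real K) * y * ((1 + R') * R / (tmin * ln (real K)))"
        using y lK by (intro mult_left_mono fb) auto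
      also have "\<dots> = ((real m + 2) * (1 + R') * (y * R)) / tmin" using lK by simp
      also have "\<dots> \<le> ((real m + 2) * (1 + R') * (256 * R * R' / k0^4 + 16 * R / k0\<^sup>2)) / tmin"
        using y R'p tmin_pos by (intro divide_right_mono mult_left_mono) auto
      also have "\<dots> \<le> real N * tmin / tmin" using Nt tmin_pos by (intro divide_right_mono) auto
      finally show ?thesis using tmin_pos by simp
    qed
    have E1: "(real m + 2) * ln (real K) \<le> real N * (t\<^sup>2 / (4 * (b * R')))"
    proof -
      have "(real m + 2) * ln (real K) * (256 * R' / k0^4) * b \<le> real N"
        by (rule ge) (use R R'p k0 in auto)
      then show ?thesis using bp R'p k0 by (simp add: t_def power_divide field_simps)
    qed
    have E2: "(real m + 2) * ln (real K) \<le> real N * (t / (2 * b))"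
    proof -
      have "(real m + 2) * ln (real K) * (16 / k0\<^sup>2) * b \<le> real N"
        by (rule ge) (use R R'p k0 in auto)
      then show ?thesis using bp k0 by (simp add: t_def field_simps)
    qed
    have "(real m + 2) * ln (real K) \<le> E" unfolding E_def using E1 E2 by (auto simp: min_def)
    then have KE: "real K ^ 2 * exp (- E) \<le> 1 / 2 ^ m" using pow_mult_exp_le[OF K_ge_2, of m 2 E] by simp
    have "Pr {x. \<exists>k\<in>{..<K}. \<exists>l\<in>Sc. \<bar>gram_dev x k l\<bar> > t}
        \<le> (\<Sum>k<K. \<Sum>l\<in>Sc. 2 * exp (- E))"
    proof (intro prob_Bex_le)
      fix k l assume "k \<in> {..<K}" "l \<in> Sc"
      then show "Pr {x. \<bar>gram_dev x k l\<bar> > t} \<le> 2 * exp (- E)"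
        unfolding E_def b_def by (intro gram_dev_tail \<rho> tp) auto
    qed auto
    also have "\<dots> = real K * (real (card Sc) * (2 * exp (- E)))" by simp
    also have "\<dots> \<le> real K * (real K * (2 * exp (- E)))"
      using card_mono[of "{..<K}" Sc] by (intro mult_left_mono mult_right_mono) auto
    also have "\<dots> \<le> 2 / 2 ^ m" using KE by (simp add: power2_eq_square)
    finally show ?thesis .
  qed
  have "Pr {x. far x (G / k0 * sqrt (real s / real N))}
      \<le> Pr {x. \<not> S_controlled g \<eta> x \<or>
          ((\<exists>k\<in>Sc. Z x k > z0) \<or> (\<exists>k\<in>{..<K}. \<exists>l\<in>Sc. \<bar>gram_dev x k l\<bar> > t))}"
  proof (rule prob_mono_on_support, rule ccontr)
    fix x assume x: "x \<in> set_pmf law"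
      and ex: "far x (G / k0 * sqrt (real s / real N))"
      and bad: "\<not> (\<not> S_controlled g \<eta> x \<or>
          ((\<exists>k\<in>Sc. Z x k > z0) \<or> (\<exists>k\<in>{..<K}. \<exists>l\<in>Sc. \<bar>gram_dev x k l\<bar> > t)))"
    from ex obtain v where v: "ascent x v" "l1 v > G / k0 * rate" by (auto simp: rate_def far_def)
    define Q where "Q = qnorm (pert v)"
    have bnd: "12 * (\<gamma> * g + z0 / k0) \<le> G * rate"
    proof -
      have "1 / sqrt (real N) \<le> rate"
        unfolding rate_def using sp Np by (simp add: real_sqrt_divide divide_right_mono)
      then have "4 * R * (real m + 1) * (1 / sqrt (real N)) \<le> 4 * R * (real m + 1) * rate"
        using R by (intro mult_left_mono) auto
      then have "z0 / k0 \<le> 4 * R * (real m + 1) * rate / k0"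
        using k0 by (intro divide_right_mono) (auto simp: z0_def)
      then have "12 * (\<gamma> * g + z0 / k0) \<le> 12 * (\<gamma> * g + 4 * R * (real m + 1) * rate / k0)"
        by (intro mult_left_mono add_left_mono) auto
      also have "\<dots> = G * rate" by (simp add: G g rate_def[symmetric] algebra_simps)
      finally show ?thesis .
    qed
    have tR: "0 < 1 / tmin + R'" using tmin_pos R'p by (simp add: add_pos_pos)
    have "Q \<le> G * rate"
    proof (rule shrinking_bound)
      show "G * rate < k0 / (1 / tmin + R')"
      proof -
        have "((G * (1 + R') / k0 + 1) * rate)\<^sup>2 \<le> tmin\<^sup>2"
          using size sp Np by (simp add: power_mult_distrib rate_def)
        then have "(G * (1 + R') / k0 + 1) * rate \<le> tmin"
          by (rule power2_le_imp_le) (use tmin_pos in auto)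
        then have "G * (1 + R') / k0 * rate < tmin" using ratep by (simp add: distrib_right)
        then have "G * rate * (1 + R') < k0 * tmin" using k0 by (simp add: field_simps)
        moreover have "tmin * (1 / tmin + R') \<le> 1 + R'"
          using tmin_pos tmin_le_1 R'p by (simp add: distrib_left mult_left_le_one_le)
        ultimately have "G * rate * (tmin * (1 / tmin + R')) < k0 * tmin"
          using Gp ratep by (meson le_less_trans mult_left_mono mult_nonneg_nonneg less_imp_le)
        then have "(G * rate * (1 / tmin + R')) * tmin < k0 * tmin" by (simp add: mult_ac)
        then have "G * rate * (1 / tmin + R') < k0" using tmin_pos by simp
        then show ?thesis using tR by (simp add: less_divide_eq)
      qed
      show "0 \<le> k0 / (1 / tmin + R')" using k0 tR by simp
      fix c :: real assume c: "0 \<le> c" "c \<le> 1" "c * Q \<le> k0 / (1 / tmin + R')"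
      let ?v = "\<lambda>k. c * v k"
      have "pert ?v = (\<lambda>j. c * pert v j)" by (auto simp: pert_scale)
      then have cQ: "qnorm (pert ?v) = c * Q" using c by (simp add: qnorm_scale Q_def)
      have "qnorm (pert ?v) \<le> 12 * (\<gamma> * g + z0 / k0)"
      proof (rule unpenalised_local_bound[OF x ascent_scale[OF x v(1) c(1,2)] k0 _ gp _ _ \<gamma>])
        show "S_controlled g \<eta> x" using bad by simp
        show "0 < \<eta>" "\<eta> * \<gamma>\<^sup>2 \<le> 1 / 4" using \<gamma>1 by (auto simp: \<eta>)
        show "ratio \<le> R'" using \<rho> by simp
        show "Z x k \<le> z0" if "k \<in> Sc" for k
          using bad that by (meson not_less)
        show "0 \<le> z0" using z0p by simp
        show "\<bar>gram_dev x k l\<bar> \<le> k0\<^sup>2 / 8" if "k < K" "l \<in> Sc" for k l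
          using bad that by (force simp: not_less t_def)
        show "qnorm (pert ?v) \<le> k0 / (1 / tmin + R')" unfolding cQ by (rule c(3))
      qed
      then show "c * Q \<le> G * rate" using bnd by (simp add: cQ)
    qed
    moreover have "k0 * l1 v \<le> Q"
      unfolding Q_def by (rule l1_le_qnorm[OF k0 ascent_in_cone[OF v(1)]])
    ultimately have "l1 v \<le> G / k0 * rate" using k0 by (simp add: field_simps)
    then show False using v(2) by simp
  qed
  also have "\<dots> \<le> Pr {x. \<not> S_controlled g \<eta> x} + (1 / 2 ^ m + 2 / 2 ^ m)"
    by (intro order.trans[OF prob_disj_le] add_left_mono order.trans[OF prob_disj_le] add_mono Ztail Dtail)
  finally show ?thesis by simp
qed

lemma fast_rate_conditionE:
  assumes "fast_rate_condition 1 (1 / 12) N n p K s A T"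
  obtains \<delta> where "ln (real s) \<le> real N * tmin ^ 3" "0 \<le> \<delta>" "\<And>k. k \<in> Sc \<Longrightarrow> \<delta> \<le> leak k"
    "144 * (ratio\<^sup>2 * real s * ln (real K)) \<le> \<delta>\<^sup>2 * real N"
    "144 * (ratio * ln (real K)) \<le> \<delta>\<^sup>2 * real N"
proof -
  \<comment> \<open>Replacing \<open>\<kappa>\<close> by its upper bound \<open>1\<close> weakens both conditions.\<close>
  define \<kappa> where "\<kappa> = kappa (J_under p N q) K A s"
  define \<delta> where "\<delta> = Min (leak ` Sc)"
  have leak_eq: "leak = (\<lambda>k. \<Sum>j\<in>{..<p} - J. A j k)" by (auto simp: leak_def)
  have k: "0 < \<kappa>" and N1: "real N \<ge> ln (real (max s n)) / (\<kappa> ^ 4 * tmin ^ 3)"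
    and sep: "(inverse \<kappa> * sqrt (xi p K A T * real s / tmin) + 1) *
      sqrt (xi p K A T * ln (real K) / (tmin * real N)) \<le> 1 / 12 * \<delta>"
    using assms unfolding fast_rate_condition_def Let_def \<kappa>_def \<delta>_def leak_eq by auto
  have "\<kappa> \<le> 1" unfolding \<kappa>_def by (rule kappa_le_1) (auto simp: J_under_def)
  then have k4: "\<kappa> ^ 4 \<le> 1" and ik: "1 \<le> inverse \<kappa>"
    using k by (auto simp: power_le_one one_le_inverse)
  have Np: "real N > 0" using N_pos by simp
  have lK: "0 < ln (real K)" by (rule ln_K_pos)
  have size: "real N * tmin ^ 3 \<ge> ln (real s)"
  proof -
    have "ln (real s) \<le> ln (real (max s n))" using s_pos by simp
    also have "\<dots> \<le> real N * (\<kappa> ^ 4 * tmin ^ 3)"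
      using N1 k tmin_pos by (simp add: divide_le_eq)
    also have "\<dots> \<le> real N * (1 * tmin ^ 3)"
      using k4 tmin_pos by (intro mult_left_mono mult_right_mono) auto
    finally show ?thesis by simp
  qed
  define a where "a = sqrt (ratio * real s)"
  define b where "b = sqrt (ratio * ln (real K) / real N)"
  have a0: "0 \<le> a" and b0: "0 \<le> b"
    using ratio_nonneg lK Np by (auto simp: a_def b_def)
  have "(inverse \<kappa> * a + 1) * b \<le> 1 / 12 * \<delta>"
    using sep by (simp add: a_def b_def ratio_def divide_divide_eq_left mult_ac)
  moreover have "(1 * a + 1) * b \<le> (inverse \<kappa> * a + 1) * b"
    using ik a0 b0 by (intro mult_right_mono add_right_mono) auto
  ultimately have ab: "a * b + b \<le> 1 / 12 * \<delta>" by (simp add: distrib_right)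
  have abn: "0 \<le> a * b" using a0 b0 by simp
  have "12 * (a * b) \<le> \<delta>" "12 * b \<le> \<delta>" and \<delta>0: "0 \<le> \<delta>"
    using ab abn b0 by linarith+
  then have "(12 * (a * b))\<^sup>2 \<le> \<delta>\<^sup>2" "(12 * b)\<^sup>2 \<le> \<delta>\<^sup>2"
    using abn b0 power_mono[of "12 * (a * b)" \<delta> 2] power_mono[of "12 * b" \<delta> 2] by auto
  moreover have "(12 * (a * b))\<^sup>2 = 144 * (ratio\<^sup>2 * real s * ln (real K)) / real N"
    "(12 * b)\<^sup>2 = 144 * (ratio * ln (real K)) / real N"
    using ratio_nonneg lK Np by (auto simp: a_def b_def power_mult_distrib power2_eq_square[of ratio])
  ultimately have c1: "144 * (ratio\<^sup>2 * real s * ln (real K)) \<le> \<delta>\<^sup>2 * real N"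
    and c2: "144 * (ratio * ln (real K)) \<le> \<delta>\<^sup>2 * real N"
    using Np by (auto simp: pos_divide_le_eq)
  have "\<delta> \<le> leak k" if "k \<in> Sc" for k
    using that unfolding \<delta>_def by (intro Min_le) auto
  then show ?thesis by (rule that[OF size \<delta>0 _ c1 c2])
qed

end

text \<open>The constants in the hypotheses are fixed, while the probability of failure has to be arbitrarily small.
  The slack comes from the threshold \<open>R\<close> between the two regimes and from the gain in the
  sample size condition for large \<open>N\<close>.\<close>

lemma fast_rate_instance:
  fixes \<epsilon> k0 :: real
  assumes e: "0 < \<epsilon>" and k0: "0 < k0"
  shows "\<exists>B. \<forall>N p K s A T \<delta>. topic_instance N p K s A T \<longrightarrow>
    k0 \<le> kappa (J_bar p (mat_vec K A T)) K A s \<longrightarrow> real N * (T_min K T)^3 \<ge> ln (real s) \<longrightarrow>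
    0 \<le> \<delta> \<longrightarrow> (\<forall>k\<in>{..<K} - supp K T. \<delta> \<le> topic_instance.leak p K A T k) \<longrightarrow>
    144 * ((topic_instance.ratio p K A T)\<^sup>2 * real s * ln (real K)) \<le> \<delta>\<^sup>2 * real N \<longrightarrow>
    144 * (topic_instance.ratio p K A T * ln (real K)) \<le> \<delta>\<^sup>2 * real N \<longrightarrow>
    measure_pmf.prob (freq_pmf p N (mat_vec K A T))
      {x. topic_instance.far p K A T x (B * sqrt (real s / real N))} \<le> \<epsilon>"
proof -
  obtain m :: nat where m: "6 / \<epsilon> < 2 ^ m" using real_arch_pow[of 2 "6 / \<epsilon>"] by auto
  define \<beta> where "\<beta> = 2 / sqrt \<epsilon>"
  define R where "R = 50 * \<beta>\<^sup>2 + (4 / \<epsilon> + 1)"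
  define R' where "R' = R / ln 2"
  define \<gamma> where "\<gamma> = 1 + sqrt R' / k0"
  define \<eta> where "\<eta> = 1 / (4 * \<gamma>\<^sup>2)"
  define G where "G = 12 * (\<gamma> * \<beta> + 4 * R * (real m + 1) / k0)"
  \<comment> \<open>\<open>M1\<close> and \<open>M2\<close> keep the error bounds inside the regions of validity of the two expansions, \<open>M3\<close>
      controls the Gram entries, and \<open>M4\<close> the quadratic forms on the active span.\<close>
  define M1 where "M1 = 401 * \<beta>\<^sup>2 / k0\<^sup>2"
  define M2 where "M2 = (G * (1 + R') / k0 + 1)\<^sup>2"
  define M3 where "M3 = (real m + 2) * (1 + R') * (256 * R * R' / k0^4 + 16 * R / k0\<^sup>2)"
  define M4 where "M4 = 4 / (\<epsilon> * (\<eta> * k0)\<^sup>2)"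
  define M where "M = 1 + M1 + M2 + M3 + M4"
  have \<beta>p: "0 < \<beta>" using e by (simp add: \<beta>_def)
  have R1: "1 \<le> R" using e by (simp add: R_def)
  have R'p: "0 < R'" using R1 by (simp add: R'_def)
  have \<gamma>1: "1 \<le> \<gamma>" using R'p k0 by (simp add: \<gamma>_def)
  have \<eta>p: "0 < \<eta>" using \<gamma>1 by (simp add: \<eta>_def)
  have \<eta>h: "\<eta> \<le> 1 / 2"
  proof -
    have "1 \<le> \<gamma>\<^sup>2" using \<gamma>1 by simp
    then have "1 / (4 * \<gamma>\<^sup>2) \<le> 1 / 4" by (intro divide_left_mono) auto
    then show ?thesis by (simp add: \<eta>_def)
  qed
  have Mi: "0 \<le> M1" "0 \<le> M2" "0 \<le> M3" "0 \<le> M4"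
    using R1 R'p k0 e unfolding M1_def M2_def M3_def M4_def
    by (auto intro!: mult_nonneg_nonneg add_nonneg_nonneg divide_nonneg_nonneg)
  have "1 \<le> M" using Mi by (simp add: M_def)
  then obtain N0 where N0: "N0 > 0" and gain: "\<And>N p K s A T. topic_instance N p K s A T \<Longrightarrow>
      real N * (T_min K T)^3 \<ge> ln (real s) \<Longrightarrow> real N \<ge> N0 \<Longrightarrow> real N * (T_min K T)\<^sup>2 \<ge> M * real s"
    using sample_size_gain[of M] by blast
  define B where "B = max (max (20 / k0 * \<beta>) (G / k0)) (2 * sqrt N0)"
  show ?thesis
  proof (intro exI[of _ B] allI impI)
    fix N p K s A T \<delta>
    assume inst: "topic_instance N p K s A T"
      and kap: "k0 \<le> kappa (J_bar p (mat_vec K A T)) K A s"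
      and cond: "real N * (T_min K T)^3 \<ge> ln (real s)" and \<delta>0: "0 \<le> \<delta>"
      and \<delta>: "\<forall>k\<in>{..<K} - supp K T. \<delta> \<le> topic_instance.leak p K A T k"
      and c1: "144 * ((topic_instance.ratio p K A T)\<^sup>2 * real s * ln (real K)) \<le> \<delta>\<^sup>2 * real N"
      and c2: "144 * (topic_instance.ratio p K A T * ln (real K)) \<le> \<delta>\<^sup>2 * real N"
    interpret topic_instance N p K s A T by (rule inst)
    define rate where "rate = sqrt (real s / real N)"
    define g where "g = \<beta> * rate"
    have sp: "1 \<le> real s" and Np: "1 \<le> real N" using s_pos N_pos by auto
    have ratep: "0 < rate" unfolding rate_def using sp Np by simp
    have gp: "0 < g" using \<beta>p ratep by (simp add: g_def)
    show "Pr {x. far x (B * sqrt (real s / real N))} \<le> \<epsilon>"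
    proof (cases "real N < N0")
      case True
      have "2 \<le> B * sqrt (real s / real N)"
        using True sp Np by (intro trivial_bound_small_sample[of 1 _ _ N0]) (auto simp: B_def)
      then have empty: "{x. far x (B * sqrt (real s / real N))} = {}"
        using not_far by auto
      show ?thesis unfolding empty using e by simp
    next
      case False
      then have Ms: "M * real s \<le> real N * tmin\<^sup>2" using gain[OF inst cond] by simp
      have Mt: "y * (real s / real N) \<le> tmin\<^sup>2" if "y \<le> M" for y
      proof -
        have "y * real s \<le> M * real s" using that sp by (intro mult_right_mono) auto
        then show ?thesis using Ms Np by (simp add: field_simps)
      qed
      have ctrl: "Pr {x. \<not> S_controlled g \<zeta> x} \<le> \<epsilon> / 2" if \<zeta>: "\<eta> \<le> \<zeta>" for \<zeta>
      proof -
        have "Pr {x. \<not> S_controlled g \<zeta> x}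
            \<le> real s / (real N * g\<^sup>2) + real s / (real N * (\<zeta> * k0 * tmin)\<^sup>2)"
          using \<eta>p \<zeta> by (intro S_controlled_prob k0 kap gp) auto
        also have "real s / (real N * g\<^sup>2) = \<epsilon> / 4"
          using sp Np e by (simp add: g_def rate_def \<beta>_def power_mult_distrib power_divide)
        also have "real s / (real N * (\<zeta> * k0 * tmin)\<^sup>2) \<le> real s / (real N * (\<eta> * k0 * tmin)\<^sup>2)"
          using sp Np \<zeta> \<eta>p k0 tmin_pos
          by (intro divide_left_mono mult_left_mono power_mono mult_right_mono mult_pos_pos zero_less_power) auto
        also have "\<dots> \<le> \<epsilon> / 4"
        proof -
          have "M4 * (real s / real N) \<le> tmin\<^sup>2" using Mi by (intro Mt) (auto simp: M_def)
          then show ?thesis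
            using e \<eta>p k0 tmin_pos Np unfolding M4_def by (simp add: power_mult_distrib field_simps)
        qed
        finally show ?thesis by simp
      qed
      show ?thesis
      proof (cases "R \<le> ratio * ln (real K)")
        case True
        have BG: "20 / k0 * g \<le> B * rate"
          unfolding g_def mult.assoc[symmetric] B_def using ratep by (intro mult_right_mono) auto
        have "Pr {x. far x (B * sqrt (real s / real N))}
          \<le> Pr {x. far x (20 / k0 * g)}"
          using BG by (intro prob_mono_on_support) (auto simp: rate_def intro: far_mono)
        also have "\<dots> \<le> Pr {x. \<not> S_controlled g (1/2) x} + exp (- R)"
        proof (rule fast_rate_leaking[OF k0 kap \<beta>p R_def _ _ \<delta>0 c1 c2 True])
          show "1 \<le> 4 / \<epsilon> + 1" using e by simp
          show "\<delta> \<le> leak k" if "k \<in> Sc" for k using \<delta> that by auto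
          show "401 * \<beta>\<^sup>2 / k0\<^sup>2 * (real s / real N) \<le> tmin\<^sup>2"
            using Mt[of M1] Mi by (simp add: M_def M1_def)
          show "g = \<beta> * sqrt (real s / real N)" by (simp add: g_def rate_def)
        qed
        also have "\<dots> \<le> \<epsilon> / 2 + \<epsilon> / 2"
        proof (intro add_mono ctrl \<eta>h)
          have "R \<le> exp R" using exp_ge_add_one_self[of R] by linarith
          then have "exp (- R) \<le> 1 / R" using R1 by (simp add: exp_minus field_simps)
          also have "\<dots> \<le> 1 / (2 / \<epsilon>)"
          proof (intro divide_left_mono mult_pos_pos)
            have "2 / \<epsilon> \<le> 4 / \<epsilon>" using e by (simp add: divide_right_mono)
            moreover have "0 \<le> 50 * \<beta>\<^sup>2" by simp
            ultimately show "2 / \<epsilon> \<le> R" unfolding R_def by linarith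
          qed (use e R1 in auto)
          finally show "exp (- R) \<le> \<epsilon> / 2" by simp
        qed
        finally show ?thesis by simp
      next
        case False
        have BG: "G / k0 * rate \<le> B * rate" unfolding B_def using ratep by (intro mult_right_mono) auto
        have "Pr {x. far x (B * sqrt (real s / real N))}
          \<le> Pr {x. far x (G / k0 * sqrt (real s / real N))}"
          using BG by (intro prob_mono_on_support) (auto simp: rate_def intro: far_mono)
        also have "\<dots> \<le> Pr {x. \<not> S_controlled g \<eta> x} + 3 / 2 ^ m"
        proof (rule fast_rate_light[OF k0 kap \<beta>p R1 R'_def _ \<gamma>_def \<eta>_def G_def])
          show "ratio * ln (real K) \<le> R" using False by simp
          show "g = \<beta> * sqrt (real s / real N)" by (simp add: g_def rate_def)
          show "(G * (1 + R') / k0 + 1)\<^sup>2 * (real s / real N) \<le> tmin\<^sup>2"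
            using Mt[of M2] Mi by (simp add: M_def M2_def)
          show "(real m + 2) * (1 + R') * (256 * R * R' / k0^4 + 16 * R / k0\<^sup>2) * (real s / real N) \<le> tmin\<^sup>2"
            using Mt[of M3] Mi by (simp add: M_def M3_def)
        qed
        also have "\<dots> \<le> \<epsilon> / 2 + \<epsilon> / 2"
          using m e by (intro add_mono ctrl) (auto simp: field_simps)
        finally show ?thesis by simp
      qed
    qed
  qed
qed

section \<open>Sequences of instances\<close>

lemma inverse_bounded_lower:
  assumes "inverse_bounded f"
  obtains k0 where "0 < k0" "eventually (\<lambda>m. k0 \<le> f m) sequentially"
proof -
  obtain c where c: "c > 0" "eventually (\<lambda>m. norm (inverse (f m)) \<le> c * norm (1::real)) sequentially"
    using assms landau_o.bigE unfolding inverse_bounded_def by blast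
  have "eventually (\<lambda>m. 1 / c \<le> f m) sequentially"
    using c(2) assms[unfolded inverse_bounded_def, THEN conjunct1]
  proof eventually_elim
    case (elim m)
    then show ?case using c(1) by (simp add: field_simps)
  qed
  then show ?thesis using that[of "1 / c"] c by simp
qed

lemma admissible_topic_instance:
  assumes "admissible_sequence N n p K s A T That"
  shows "topic_instance (N m) (p m) (K m) (s m) (A m) (T m)"
  using assms unfolding admissible_sequence_def by unfold_locales auto

lemma admissible_error_range:
  assumes "admissible_sequence N n p K s A T That"
    and "x \<in> set_pmf (freq_pmf (p m) (N m) (mat_vec (K m) (A m) (T m)))"
  shows "0 \<le> error (K m) (T m) (That m x)" and "error (K m) (T m) (That m x) \<le> 2"
    and "topic_instance.ascent (p m) (K m) (A m) (T m) x (\<lambda>k. That m x k - T m k)"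
proof -
  interpret topic_instance "N m" "p m" "K m" "s m" "A m" "T m"
    by (rule admissible_topic_instance[OF assms(1)])
  have mle: "is_mle (p m) (K m) (A m) x (That m x)"
    using assms unfolding admissible_sequence_def by blast
  then have "That m x \<in> prob_simplex (K m)" by (simp add: is_mle_def is_arg_max_def)
  then show "error (K m) (T m) (That m x) \<le> 2" by (rule error_le_2)
  show "0 \<le> error (K m) (T m) (That m x)" unfolding error_def by (rule l1_nonneg)
  show "ascent x (\<lambda>k. That m x k - T m k)" by (rule ascent_mle[OF assms(2) mle])
qed

text \<open>Directions of ascent stand in for the estimation error, so that bounds on single instances need not
  mention the estimator.\<close>

lemma bigo_prob_from_instances:
  assumes adm: "admissible_sequence N n p K s A T That" and a: "\<And>m. a m > 0"
    and B: "\<And>\<epsilon>. \<epsilon> > 0 \<Longrightarrow> \<exists>B. eventually (\<lambda>m.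
      measure_pmf.prob (freq_pmf (p m) (N m) (mat_vec (K m) (A m) (T m)))
        {x. topic_instance.far (p m) (K m) (A m) (T m) x (B * a m)} \<le> \<epsilon>) sequentially"
  shows "bigo_prob (\<lambda>m. freq_pmf (p m) (N m) (mat_vec (K m) (A m) (T m)))
    (\<lambda>m X. error (K m) (T m) (That m X)) a" (is "bigo_prob ?P ?Z a")
proof (rule bigo_prob_eventually[OF _ a])
  fix m x assume "x \<in> set_pmf (?P m)"
  then show "0 \<le> ?Z m x \<and> ?Z m x \<le> 2" using admissible_error_range[OF adm] by blast
next
  fix \<epsilon> :: real assume "\<epsilon> > 0"
  then obtain B where ev: "eventually (\<lambda>m. measure_pmf.prob (?P m)
      {x. topic_instance.far (p m) (K m) (A m) (T m) x (B * a m)} \<le> \<epsilon>) sequentially"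
    using B by blast
  have "measure_pmf.prob (?P m) {x. ?Z m x > B * a m}
      \<le> measure_pmf.prob (?P m) {x. topic_instance.far (p m) (K m) (A m) (T m) x (B * a m)}" for m
  proof (rule prob_mono_on_support)
    fix x assume x: "x \<in> set_pmf (?P m)" and gt: "?Z m x > B * a m"
    show "topic_instance.far (p m) (K m) (A m) (T m) x (B * a m)"
      unfolding topic_instance.far_def[OF admissible_topic_instance[OF adm]]
      using admissible_error_range[OF adm x] gt
      by (intro exI[of _ "\<lambda>k. That m x k - T m k"]) (simp add: error_def)
  qed
  then show "\<exists>B. eventually (\<lambda>m. measure_pmf.prob (?P m) {x. ?Z m x > B * a m} \<le> \<epsilon>) sequentially"
    using ev by (intro exI[of _ B]) (auto elim!: eventually_mono intro: order.trans)
qed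

lemma slow_rate_sequence:
  assumes c: "0 < c" "c \<le> 1" and adm: "admissible_sequence N n p K s A T That"
    and bal: "\<And>m. T m \<in> balanced_sparse_simplex c (K m) (s m)"
    and xi: "(\<lambda>m. xi (p m) (K m) (A m) (T m)) \<in> O(\<lambda>_. 1)"
    and kap: "inverse_bounded (\<lambda>m.
        kappa (J_under (p m) (N m) (mat_vec (K m) (A m) (T m))) (K m) (A m) (s m))"
    and sN: "(\<lambda>m. real (s m) * ln (real (K m))) \<in> O(\<lambda>m. real (N m))"
  shows "bigo_prob (\<lambda>m. freq_pmf (p m) (N m) (mat_vec (K m) (A m) (T m)))
        (\<lambda>m X. error (K m) (T m) (That m X))
        (\<lambda>m. sqrt (real (s m) * ln (real (K m)) / real (N m)))"
proof (rule bigo_prob_from_instances[OF adm])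
  note inst = admissible_topic_instance[OF adm]
  fix m
  interpret topic_instance "N m" "p m" "K m" "s m" "A m" "T m" by (rule inst)
  show "0 < sqrt (real (s m) * ln (real (K m)) / real (N m))"
    using s_pos N_pos ln_K_pos by simp
next
  note inst = admissible_topic_instance[OF adm]
  fix \<epsilon> :: real assume e: "\<epsilon> > 0"
  obtain k0 where k0: "0 < k0" and ek: "eventually (\<lambda>m. k0 \<le>
      kappa (J_under (p m) (N m) (mat_vec (K m) (A m) (T m))) (K m) (A m) (s m)) sequentially"
    using inverse_bounded_lower[OF kap] by blast
  obtain X where X: "X > 0" and ex: "eventually (\<lambda>m. norm (xi (p m) (K m) (A m) (T m)) \<le> X * norm (1::real)) sequentially"
    using landau_o.bigE[OF xi] by blast
  obtain D where D: "D > 0" and ed: "eventually (\<lambda>m. norm (real (s m) * ln (real (K m))) \<le> D * norm (real (N m))) sequentially"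
    using landau_o.bigE[OF sN] by blast
  have X1: "1 \<le> max 1 X" by simp
  show "\<exists>B. eventually (\<lambda>m.
      measure_pmf.prob (freq_pmf (p m) (N m) (mat_vec (K m) (A m) (T m)))
        {x. topic_instance.far (p m) (K m) (A m) (T m) x (B * sqrt (real (s m) * ln (real (K m)) / real (N m)))} \<le> \<epsilon>)
      sequentially"
    using slow_rate_instance[OF e k0 X1 D c]
  proof (elim exE, goal_cases)
    case (1 B)
    show ?case
      using ek ex ed
    proof (intro exI[of _ B], eventually_elim)
      case (elim m)
      show ?case
      proof (rule 1[rule_format, OF inst])
        show "c / real (s m) \<le> T_min (K m) (T m)"
          using bal[of m] by (simp add: balanced_sparse_simplex_def)
      qed (use elim in auto)
    qed
  qed
qed

lemma fast_rate_sequence: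
  assumes adm: "admissible_sequence N n p K s A T That"
    and cond: "\<And>m. fast_rate_condition 1 (1 / 12) (N m) (n m) (p m) (K m) (s m) (A m) (T m)"
    and kap: "inverse_bounded (\<lambda>m.
        kappa (J_bar (p m) (mat_vec (K m) (A m) (T m))) (K m) (A m) (s m))"
  shows "bigo_prob (\<lambda>m. freq_pmf (p m) (N m) (mat_vec (K m) (A m) (T m)))
        (\<lambda>m X. error (K m) (T m) (That m X))
        (\<lambda>m. sqrt (real (s m) / real (N m)))"
proof (rule bigo_prob_from_instances[OF adm])
  note inst = admissible_topic_instance[OF adm]
  fix m
  interpret topic_instance "N m" "p m" "K m" "s m" "A m" "T m" by (rule inst)
  show "0 < sqrt (real (s m) / real (N m))"
    using s_pos N_pos by simp
next
  note inst = admissible_topic_instance[OF adm]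
  fix \<epsilon> :: real assume e: "\<epsilon> > 0"
  obtain k0 where k0: "0 < k0" and ek: "eventually (\<lambda>m. k0 \<le>
      kappa (J_bar (p m) (mat_vec (K m) (A m) (T m))) (K m) (A m) (s m)) sequentially"
    using inverse_bounded_lower[OF kap] by blast
  show "\<exists>B. eventually (\<lambda>m.
      measure_pmf.prob (freq_pmf (p m) (N m) (mat_vec (K m) (A m) (T m)))
        {x. topic_instance.far (p m) (K m) (A m) (T m) x (B * sqrt (real (s m) / real (N m)))} \<le> \<epsilon>)
      sequentially"
    using fast_rate_instance[OF e k0]
  proof (elim exE, goal_cases)
    case (1 B)
    show ?case
      using ek
    proof (intro exI[of _ B], eventually_elim)
      case (elim m)
      interpret topic_instance "N m" "p m" "K m" "s m" "A m" "T m" by (rule inst)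
      show ?case
        by (rule fast_rate_conditionE[OF cond[of m]], rule 1[rule_format, OF inst elim(2)])
    qed
  qed
qed

section \<open>The two rates\<close>

theorem corollary6:
  shows
  "(\<forall>cstar::real. \<forall>N n p K s :: nat \<Rightarrow> nat. \<forall>A T That.
      0 < cstar \<longrightarrow> cstar \<le> 1 \<longrightarrow>
      admissible_sequence N n p K s A T That \<longrightarrow>
      (\<forall>m. T m \<in> balanced_sparse_simplex cstar (K m) (s m)) \<longrightarrow>
      (\<lambda>m. xi (p m) (K m) (A m) (T m)) \<in> O(\<lambda>_. 1) \<longrightarrow>
      inverse_bounded (\<lambda>m.
        kappa (J_under (p m) (N m) (mat_vec (K m) (A m) (T m))) (K m) (A m) (s m)) \<longrightarrow>
      (\<lambda>m. real (s m) * ln (real (K m))) \<in> O(\<lambda>m. real (N m)) \<longrightarrow>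
      bigo_prob (\<lambda>m. freq_pmf (p m) (N m) (mat_vec (K m) (A m) (T m)))
        (\<lambda>m X. error (K m) (T m) (That m X))
        (\<lambda>m. sqrt (real (s m) * ln (real (K m)) / real (N m))))
   \<and>
   (\<exists>C>0. \<exists>c>0. \<forall>N n p K s :: nat \<Rightarrow> nat. \<forall>A T That.
      admissible_sequence N n p K s A T That \<longrightarrow>
      (\<forall>m. fast_rate_condition C c (N m) (n m) (p m) (K m) (s m) (A m) (T m)) \<longrightarrow>
      inverse_bounded (\<lambda>m.
        kappa (J_bar (p m) (mat_vec (K m) (A m) (T m))) (K m) (A m) (s m)) \<longrightarrow>
      bigo_prob (\<lambda>m. freq_pmf (p m) (N m) (mat_vec (K m) (A m) (T m)))
        (\<lambda>m X. error (K m) (T m) (That m X))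
        (\<lambda>m. sqrt (real (s m) / real (N m))))"
proof (rule conjI, goal_cases)
  case 1
  show ?case by (intro allI impI, rule slow_rate_sequence) auto
next
  case 2
  show ?case
    by (rule exI[of _ 1], rule conjI[OF zero_less_one], rule exI[of _ "1 / 12"])
       (auto intro: fast_rate_sequence)
qed

end
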